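(* Let $L$ be a Hopf algebra over a commutative ring $k$ with antipode $S$, and consider the forgetful functors $F:\mathcal{YD}_L^L\to\mathcal{M}_L$ and $H:\mathcal{YD}_L^L\to\mathcal{M}^L$. 1) The following statements are equivalent: (a) $F$ is $H$-separable; (b) there exists a $k$-linear map $\theta:L\otimes L\to L$ such that for all $g,h\in L$ $$\theta(g\otimes h_{(1)})\otimes h_{(2)}=\theta(g_{(2)}\otimes h)_{(2)}\otimes S\bigl(\theta(g_{(2)}\otimes h)_{(1)}\bigr)g_{(1)}\theta(g_{(2)}\otimes h)_{(3)},\qquad \theta(h_{(1)}\otimes h_{(2)})=\varepsilon(h)1_L;$$ (c) there exists a $k$-linear map $\gamma:L\to\mathrm{End}_k(L)$ such that for all $g,h\in L$ $$\gamma(h_{(1)})(g)\otimes h_{(2)}=\gamma(h)(g_{(2)})_{(2)}\otimes S\bigl(\gamma(h)(g_{(2)})_{(1)}\bigr)g_{(1)}\gamma(h)(g_{(2)})_{(3)},\qquad \gamma(h_{(2)})(h_{(1)})=\varepsilon(h)1_L.$$ In this case every $M\in\mathcal{YD}_L^L$ is relative injective as a right $L$-comodule. 2) The following statements are equivalent: (a) $H$ is $F$-separable; (b) there exists a $k$-linear map $e:L\to L\otimes L$, $e(h)=\sum e^1(h)\otimes e^2(h)$, such that for all $g,h\in L$ $$\sum e^1(g)\otimes e^2(g)h=\sum h_{(2)}e^1\bigl(S(h_{(1)})gh_{(3)}\bigr)\otimes e^2\bigl(S(h_{(1)})gh_{(3)}\bigr),\qquad \sum e^1(g)e^2(g)=\varepsilon(g)1_L.$$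 In this case every $M\in\mathcal{YD}_L^L$ is relative projective as a right $L$-module. Furthermore, if $L$ is finitely generated and projective over $k$, the conditions (a), (b) of 2) are also equivalent to: (c) there exists an element $\sum_{i=1}^n f_i\otimes h_i\in\mathrm{End}_k(L)\otimes L$ such that for all $g,h\in L$ $$\sum_{i=1}^n f_i(g)\otimes h_ih=\sum_{i=1}^n h_{(2)}f_i\bigl(S(h_{(1)})gh_{(3)}\bigr)\otimes h_i,\qquad \sum_{i=1}^n f_i(g)h_i=\varepsilon(g)1_L.$$
   Context: Sweedler notation is used; $\otimes=\otimes_k$. $\mathcal{YD}_L^L$ is the category of (right-right) Yetter-Drinfeld modules: right $L$-modules and right $L$-comodules $M$, with coaction $\rho(m)=m_{[0]}\otimes m_{[1]}$, such that $\rho(mh)=m_{[0]}h_{(2)}\otimes S(h_{(1)})m_{[1]}h_{(3)}$ for all $m\in M$, $h\in L$; morphisms are $L$-linear $L$-colinear maps. $\mathcal{M}_L$ and $\mathcal{M}^L$ are the categories of right $L$-modules and right $L$-comodules. A right $L$-comodule $M$ is relative injective if for every colinear map $i:U\to V$ with a $k$-linear left inverse and every colinear $f:U\to M$ there is a colinear $g:V\to M$ with $g\circ i=f$. A right $L$-module $M$ is relative projective if for every $L$-linear map $p:U\to V$ with a $k$-linear right inverse and every $L$-linear $f:M\to V$ there is an $L$-linear $g:M\to U$ with $p\circ g=f$. For functors $U:\mathcal{C}\to\mathcal{D}$ and $V:\mathcal{C}\to\mathcal{E}$, $U$ is $V$-separable if there is a family of maps $\mathcal{P}_{X,Y}:\mathrm{Hom}_{\mathcal{D}}(U(X),U(Y))\to\mathrm{Hom}_{\mathcal{E}}(V(X),V(Y))$,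 natural in $X,Y\in\mathcal{C}$ (i.e. $\mathcal{P}_{X,T}(U(v)\circ h\circ U(u))=V(v)\circ\mathcal{P}_{Y,Z}(h)\circ V(u)$ for $u:X\to Y$, $v:Z\to T$, $h:U(Y)\to U(Z)$), with $\mathcal{P}_{X,Y}(U(f))=V(f)$ for all $f:X\to Y$ in $\mathcal{C}$. *)

theory Defs
  imports "HOL-Algebra.Module" "HOL-Algebra.Free_Abelian_Groups" "HOL-Algebra.Generated_Groups"
begin

section \<open>Linear maps\<close>

definition k_linear ::
  "'k ring \<Rightarrow> ('k, 'm, 'x) module_scheme \<Rightarrow> ('k, 'n, 'y) module_scheme \<Rightarrow> ('m \<Rightarrow> 'n) \<Rightarrow> bool"
where
  "k_linear K M N f \<longleftrightarrow>
     f \<in> carrier M \<rightarrow> carrier N \<and>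
     (\<forall>x\<in>carrier M. \<forall>y\<in>carrier M. f (x \<oplus>\<^bsub>M\<^esub> y) = f x \<oplus>\<^bsub>N\<^esub> f y) \<and>
     (\<forall>a\<in>carrier K. \<forall>x\<in>carrier M. f (a \<odot>\<^bsub>M\<^esub> x) = a \<odot>\<^bsub>N\<^esub> f x)"

text \<open>The module record of the library carries a multiplication and a unit, which are irrelevant
  for a module and are left \<^const>\<open>undefined\<close> in the modules built here.\<close>

definition End_module :: "'k ring \<Rightarrow> ('k, 'm, 'x) module_scheme \<Rightarrow> ('k, 'm \<Rightarrow> 'm) module"
where
  "End_module K M =
     \<lparr>carrier = {f \<in> extensional (carrier M). k_linear K M M f},
      monoid.mult = undefined, one = undefined,
      ring.zero = (\<lambda>x\<in>carrier M. \<zero>\<^bsub>M\<^esub>),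
      ring.add = (\<lambda>f g. \<lambda>x\<in>carrier M. f x \<oplus>\<^bsub>M\<^esub> g x),
      smult = (\<lambda>a f. \<lambda>x\<in>carrier M. a \<odot>\<^bsub>M\<^esub> f x)\<rparr>"

definition finitely_generated :: "'k ring \<Rightarrow> ('k, 'm, 'x) module_scheme \<Rightarrow> bool"
where
  "finitely_generated K M \<longleftrightarrow>
     (\<exists>A. finite A \<and> A \<subseteq> carrier M \<and>
        (\<forall>x\<in>carrier M. \<exists>c\<in>A \<rightarrow> carrier K. x = (\<Oplus>\<^bsub>M\<^esub>a\<in>A. c a \<odot>\<^bsub>M\<^esub> a)))"

text \<open>The type argument is the universe of the modules in the lifting problem.\<close>

definition projective_module :: "'u itself \<Rightarrow> 'k ring \<Rightarrow> ('k, 'm, 'x) module_scheme \<Rightarrow> bool"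
where
  "projective_module universe K M \<longleftrightarrow>
     (\<forall>(U :: ('k, 'u) module) (V :: ('k, 'u) module) p f.
        module K U \<and> module K V \<and>
        k_linear K U V p \<and> p ` carrier U = carrier V \<and> k_linear K M V f \<longrightarrow>
        (\<exists>g. k_linear K M U g \<and> (\<forall>x\<in>carrier M. p (g x) = f x)))"


section \<open>Tensor products\<close>

text \<open>The tensor product over \<open>K\<close> is the free abelian group on the pairs modulo the subgroup
  generated by the usual relations, so that a tensor is a coset of formal \<open>\<int>\<close>-linear
  combinations of pairs.\<close>

type_synonym ('m, 'n) tensor = "('m \<times> 'n \<Rightarrow>\<^sub>0 int) set"

definition pairs_group :: "('m, 'x) partial_object_scheme \<Rightarrow> ('n, 'y) partial_object_scheme \<Rightarrow>
  ('m \<times> 'n \<Rightarrow>\<^sub>0 int) monoid"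
where
  "pairs_group M N = free_Abelian_group (carrier M \<times> carrier N)"

definition tensor_relations ::
  "'k ring \<Rightarrow> ('k, 'm, 'x) module_scheme \<Rightarrow> ('k, 'n, 'y) module_scheme \<Rightarrow> ('m \<times> 'n \<Rightarrow>\<^sub>0 int) set"
where
  "tensor_relations K M N =
     {frag_of (x \<oplus>\<^bsub>M\<^esub> x', y) - frag_of (x, y) - frag_of (x', y) | x x' y.
        x \<in> carrier M \<and> x' \<in> carrier M \<and> y \<in> carrier N} \<union>
     {frag_of (x, y \<oplus>\<^bsub>N\<^esub> y') - frag_of (x, y) - frag_of (x, y') | x y y'.
        x \<in> carrier M \<and> y \<in> carrier N \<and> y' \<in> carrier N} \<union>
     {frag_of (a \<odot>\<^bsub>M\<^esub> x, y) - frag_of (x, a \<odot>\<^bsub>N\<^esub> y) | a x y.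
        a \<in> carrier K \<and> x \<in> carrier M \<and> y \<in> carrier N}"

definition tensor_null ::
  "'k ring \<Rightarrow> ('k, 'm, 'x) module_scheme \<Rightarrow> ('k, 'n, 'y) module_scheme \<Rightarrow> ('m \<times> 'n \<Rightarrow>\<^sub>0 int) set"
where
  "tensor_null K M N = generate (pairs_group M N) (tensor_relations K M N)"

definition tensor_product ::
  "'k ring \<Rightarrow> ('k, 'm, 'x) module_scheme \<Rightarrow> ('k, 'n, 'y) module_scheme \<Rightarrow>
   ('k, ('m, 'n) tensor) module"
where
  "tensor_product K M N =
     \<lparr>carrier = rcosets\<^bsub>pairs_group M N\<^esub> tensor_null K M N,
      monoid.mult = undefined, one = undefined,
      ring.zero = tensor_null K M N,
      ring.add = (\<lambda>X Y. X <#>\<^bsub>pairs_group M N\<^esub> Y),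
      smult = (\<lambda>a X. \<Union>c\<in>X. tensor_null K M N #>\<^bsub>pairs_group M N\<^esub>
                 frag_extend (\<lambda>(x, y). frag_of (a \<odot>\<^bsub>M\<^esub> x, y)) c)\<rparr>"

definition tens ::
  "'k ring \<Rightarrow> ('k, 'm, 'x) module_scheme \<Rightarrow> ('k, 'n, 'y) module_scheme \<Rightarrow>
   'm \<Rightarrow> 'n \<Rightarrow> ('m, 'n) tensor"
where
  "tens K M N x y = tensor_null K M N #>\<^bsub>pairs_group M N\<^esub> frag_of (x, y)"

text \<open>\<open>tensor_lift P f t\<close> is the value at \<open>t = \<Sum> x\<^sub>i \<otimes> y\<^sub>i\<close> of the linear map into \<open>P\<close> induced by a
  bilinear \<open>f\<close>, that is \<open>\<Sum> f x\<^sub>i y\<^sub>i\<close>; for bilinear \<open>f\<close> (the only use) the representative chosen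
  in the coset does not matter.  It is what renders Sweedler notation below: an expression
  \<open>\<Sum> \<Phi>(t\<^sup>1, t\<^sup>2)\<close> is written \<open>tensor_lift P (\<lambda>t1 t2. \<Phi> t1 t2) t\<close>.\<close>

definition tensor_lift ::
  "('p, 'x) ring_scheme \<Rightarrow> ('m \<Rightarrow> 'n \<Rightarrow> 'p) \<Rightarrow> ('m, 'n) tensor \<Rightarrow> 'p"
where
  "tensor_lift P f t =
     (let c = (SOME c. c \<in> t)
      in \<Oplus>\<^bsub>P\<^esub>z\<in>Poly_Mapping.keys c. [Poly_Mapping.lookup c z] \<cdot>\<^bsub>P\<^esub> f (fst z) (snd z))"


section \<open>Hopf algebras\<close>

record ('k, 'l) hopf = "('k, 'l) module" +
  comult :: "'l \<Rightarrow> ('l, 'l) tensor"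
  counit :: "'l \<Rightarrow> 'k"
  antipode :: "'l \<Rightarrow> 'l"

text \<open>\<open>sweedler2\<close> is \<open>f(h\<^sub>(\<^sub>1\<^sub>), h\<^sub>(\<^sub>2\<^sub>))\<close> and \<open>sweedler3\<close> is \<open>f(h\<^sub>(\<^sub>1\<^sub>), h\<^sub>(\<^sub>2\<^sub>), h\<^sub>(\<^sub>3\<^sub>))\<close>, the latter
  computed from \<open>(\<Delta> \<otimes> id) \<circ> \<Delta>\<close>, for multilinear \<open>f\<close> with values in \<open>P\<close>.\<close>

definition sweedler2 ::
  "('k, 'l) hopf \<Rightarrow> ('p, 'x) ring_scheme \<Rightarrow> ('l \<Rightarrow> 'l \<Rightarrow> 'p) \<Rightarrow> 'l \<Rightarrow> 'p"
where
  "sweedler2 L P f h = tensor_lift P f (comult L h)"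

definition sweedler3 ::
  "('k, 'l) hopf \<Rightarrow> ('p, 'x) ring_scheme \<Rightarrow> ('l \<Rightarrow> 'l \<Rightarrow> 'l \<Rightarrow> 'p) \<Rightarrow> 'l \<Rightarrow> 'p"
where
  "sweedler3 L P f h = sweedler2 L P (\<lambda>u h3. sweedler2 L P (\<lambda>h1 h2. f h1 h2 h3) u) h"

text \<open>Coassociativity, here and for comodules, is stated in the triple tensor product bracketed
  to the left.\<close>

locale hopf_algebra = K_mod: module K L + L_ring: ring L
  for K :: "'k ring" and L :: "('k, 'l) hopf" +
  assumes smult_mult_left:
      "\<lbrakk>a \<in> carrier K; x \<in> carrier L; y \<in> carrier L\<rbrakk> \<Longrightarrow>
         (a \<odot>\<^bsub>L\<^esub> x) \<otimes>\<^bsub>L\<^esub> y = a \<odot>\<^bsub>L\<^esub> (x \<otimes>\<^bsub>L\<^esub> y)"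
    and smult_mult_right:
      "\<lbrakk>a \<in> carrier K; x \<in> carrier L; y \<in> carrier L\<rbrakk> \<Longrightarrow>
         x \<otimes>\<^bsub>L\<^esub> (a \<odot>\<^bsub>L\<^esub> y) = a \<odot>\<^bsub>L\<^esub> (x \<otimes>\<^bsub>L\<^esub> y)"
    and comult_linear: "k_linear K L (tensor_product K L L) (comult L)"
    and counit_closed: "x \<in> carrier L \<Longrightarrow> counit L x \<in> carrier K"
    and counit_add:
      "\<lbrakk>x \<in> carrier L; y \<in> carrier L\<rbrakk> \<Longrightarrow> counit L (x \<oplus>\<^bsub>L\<^esub> y) = counit L x \<oplus>\<^bsub>K\<^esub> counit L y"
    and counit_smult:
      "\<lbrakk>a \<in> carrier K; x \<in> carrier L\<rbrakk> \<Longrightarrow> counit L (a \<odot>\<^bsub>L\<^esub> x) = a \<otimes>\<^bsub>K\<^esub> counit L x"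
    and coassoc:
      "h \<in> carrier L \<Longrightarrow>
         sweedler2 L (tensor_product K (tensor_product K L L) L)
           (\<lambda>h1 h2. tens K (tensor_product K L L) L (comult L h1) h2) h =
         sweedler2 L (tensor_product K (tensor_product K L L) L)
           (\<lambda>h1 h2. sweedler2 L (tensor_product K (tensor_product K L L) L)
              (\<lambda>h21 h22. tens K (tensor_product K L L) L (tens K L L h1 h21) h22) h2) h"
    and counit_left: "h \<in> carrier L \<Longrightarrow> sweedler2 L L (\<lambda>h1 h2. counit L h1 \<odot>\<^bsub>L\<^esub> h2) h = h"
    and counit_right: "h \<in> carrier L \<Longrightarrow> sweedler2 L L (\<lambda>h1 h2. counit L h2 \<odot>\<^bsub>L\<^esub> h1) h = h"
    and comult_one: "comult L \<one>\<^bsub>L\<^esub> = tens K L L \<one>\<^bsub>L\<^esub> \<one>\<^bsub>L\<^esub>"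
    and comult_mult:
      "\<lbrakk>g \<in> carrier L; h \<in> carrier L\<rbrakk> \<Longrightarrow>
         comult L (g \<otimes>\<^bsub>L\<^esub> h) =
         sweedler2 L (tensor_product K L L)
           (\<lambda>g1 g2. sweedler2 L (tensor_product K L L)
              (\<lambda>h1 h2. tens K L L (g1 \<otimes>\<^bsub>L\<^esub> h1) (g2 \<otimes>\<^bsub>L\<^esub> h2)) h) g"
    and counit_one: "counit L \<one>\<^bsub>L\<^esub> = \<one>\<^bsub>K\<^esub>"
    and counit_mult:
      "\<lbrakk>g \<in> carrier L; h \<in> carrier L\<rbrakk> \<Longrightarrow>
         counit L (g \<otimes>\<^bsub>L\<^esub> h) = counit L g \<otimes>\<^bsub>K\<^esub> counit L h"
    and antipode_linear: "k_linear K L L (antipode L)"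
    and antipode_left:
      "h \<in> carrier L \<Longrightarrow>
         sweedler2 L L (\<lambda>h1 h2. antipode L h1 \<otimes>\<^bsub>L\<^esub> h2) h = counit L h \<odot>\<^bsub>L\<^esub> \<one>\<^bsub>L\<^esub>"
    and antipode_right:
      "h \<in> carrier L \<Longrightarrow>
         sweedler2 L L (\<lambda>h1 h2. h1 \<otimes>\<^bsub>L\<^esub> antipode L h2) h = counit L h \<odot>\<^bsub>L\<^esub> \<one>\<^bsub>L\<^esub>"


section \<open>Modules, comodules and Yetter-Drinfeld modules\<close>

record ('k, 'm, 'l) rmod = "('k, 'm) module" +
  ract :: "'m \<Rightarrow> 'l \<Rightarrow> 'm"

record ('k, 'm, 'l) comod = "('k, 'm) module" +
  coact :: "'m \<Rightarrow> ('m, 'l) tensor"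

record ('k, 'm, 'l) ydmod = "('k, 'm, 'l) rmod" +
  yd_coact :: "'m \<Rightarrow> ('m, 'l) tensor"

definition forget_coaction :: "('k, 'm, 'l) ydmod \<Rightarrow> ('k, 'm, 'l) rmod"
  where "forget_coaction M = rmod.truncate M"

definition forget_action :: "('k, 'm, 'l) ydmod \<Rightarrow> ('k, 'm, 'l) comod"
  where "forget_action M =
    \<lparr>carrier = carrier M, monoid.mult = monoid.mult M, one = one M,
     ring.zero = ring.zero M, ring.add = ring.add M, smult = smult M, coact = yd_coact M\<rparr>"

definition right_module :: "'k ring \<Rightarrow> ('k, 'l) hopf \<Rightarrow> ('k, 'm, 'l) rmod \<Rightarrow> bool"
where
  "right_module K L M \<longleftrightarrow>
     module K M \<and>
     (\<forall>m\<in>carrier M. \<forall>h\<in>carrier L. ract M m h \<in> carrier M) \<and>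
     (\<forall>m\<in>carrier M. \<forall>m'\<in>carrier M. \<forall>h\<in>carrier L.
        ract M (m \<oplus>\<^bsub>M\<^esub> m') h = ract M m h \<oplus>\<^bsub>M\<^esub> ract M m' h) \<and>
     (\<forall>m\<in>carrier M. \<forall>h\<in>carrier L. \<forall>h'\<in>carrier L.
        ract M m (h \<oplus>\<^bsub>L\<^esub> h') = ract M m h \<oplus>\<^bsub>M\<^esub> ract M m h') \<and>
     (\<forall>a\<in>carrier K. \<forall>m\<in>carrier M. \<forall>h\<in>carrier L.
        ract M (a \<odot>\<^bsub>M\<^esub> m) h = a \<odot>\<^bsub>M\<^esub> ract M m h \<and>
        ract M m (a \<odot>\<^bsub>L\<^esub> h) = a \<odot>\<^bsub>M\<^esub> ract M m h) \<and>
     (\<forall>m\<in>carrier M. \<forall>g\<in>carrier L. \<forall>h\<in>carrier L.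
        ract M (ract M m g) h = ract M m (g \<otimes>\<^bsub>L\<^esub> h)) \<and>
     (\<forall>m\<in>carrier M. ract M m \<one>\<^bsub>L\<^esub> = m)"

definition right_comodule :: "'k ring \<Rightarrow> ('k, 'l) hopf \<Rightarrow> ('k, 'm, 'l) comod \<Rightarrow> bool"
where
  "right_comodule K L M \<longleftrightarrow>
     module K M \<and>
     k_linear K M (tensor_product K M L) (coact M) \<and>
     (\<forall>m\<in>carrier M.
        tensor_lift (tensor_product K (tensor_product K M L) L)
          (\<lambda>m0 m1. tens K (tensor_product K M L) L (coact M m0) m1) (coact M m) =
        tensor_lift (tensor_product K (tensor_product K M L) L)
          (\<lambda>m0 m1. sweedler2 L (tensor_product K (tensor_product K M L) L)
             (\<lambda>h1 h2. tens K (tensor_product K M L) L (tens K M L m0 h1) h2) m1) (coact M m)) \<and>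
     (\<forall>m\<in>carrier M. tensor_lift M (\<lambda>m0 m1. counit L m1 \<odot>\<^bsub>M\<^esub> m0) (coact M m) = m)"

definition yetter_drinfeld :: "'k ring \<Rightarrow> ('k, 'l) hopf \<Rightarrow> ('k, 'm, 'l) ydmod \<Rightarrow> bool"
where
  "yetter_drinfeld K L M \<longleftrightarrow>
     right_module K L (forget_coaction M) \<and>
     right_comodule K L (forget_action M) \<and>
     (\<forall>m\<in>carrier M. \<forall>h\<in>carrier L.
        yd_coact M (ract M m h) =
        tensor_lift (tensor_product K M L)
          (\<lambda>m0 m1. sweedler3 L (tensor_product K M L)
             (\<lambda>h1 h2 h3. tens K M L (ract M m0 h2) (antipode L h1 \<otimes>\<^bsub>L\<^esub> m1 \<otimes>\<^bsub>L\<^esub> h3)) h)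
          (yd_coact M m))"

definition L_linear ::
  "'k ring \<Rightarrow> ('k, 'l) hopf \<Rightarrow> ('k, 'm, 'l) rmod \<Rightarrow> ('k, 'n, 'l) rmod \<Rightarrow> ('m \<Rightarrow> 'n) \<Rightarrow> bool"
where
  "L_linear K L M N f \<longleftrightarrow>
     k_linear K M N f \<and>
     (\<forall>m\<in>carrier M. \<forall>h\<in>carrier L. f (ract M m h) = ract N (f m) h)"

definition colinear ::
  "'k ring \<Rightarrow> ('k, 'l) hopf \<Rightarrow> ('k, 'm, 'l) comod \<Rightarrow> ('k, 'n, 'l) comod \<Rightarrow> ('m \<Rightarrow> 'n) \<Rightarrow> bool"
where
  "colinear K L M N f \<longleftrightarrow>
     k_linear K M N f \<and>
     (\<forall>m\<in>carrier M.
        coact N (f m) =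
        tensor_lift (tensor_product K N L) (\<lambda>m0 m1. tens K N L (f m0) m1) (coact M m))"

definition relative_injective :: "'k ring \<Rightarrow> ('k, 'l) hopf \<Rightarrow> ('k, 'u, 'l) comod \<Rightarrow> bool"
where
  "relative_injective K L M \<longleftrightarrow>
     (\<forall>(U :: ('k, 'u, 'l) comod) (V :: ('k, 'u, 'l) comod) i f.
        right_comodule K L U \<and> right_comodule K L V \<and> colinear K L U V i \<and>
        (\<exists>r. k_linear K V U r \<and> (\<forall>x\<in>carrier U. r (i x) = x)) \<and>
        colinear K L U M f \<longrightarrow>
        (\<exists>g. colinear K L V M g \<and> (\<forall>x\<in>carrier U. g (i x) = f x)))"

definition relative_projective :: "'k ring \<Rightarrow> ('k, 'l) hopf \<Rightarrow> ('k, 'u, 'l) rmod \<Rightarrow> bool"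
where
  "relative_projective K L M \<longleftrightarrow>
     (\<forall>(U :: ('k, 'u, 'l) rmod) (V :: ('k, 'u, 'l) rmod) p f.
        right_module K L U \<and> right_module K L V \<and> L_linear K L U V p \<and>
        (\<exists>s. k_linear K V U s \<and> (\<forall>y\<in>carrier V. p (s y) = y)) \<and>
        L_linear K L M V f \<longrightarrow>
        (\<exists>g. L_linear K L M U g \<and> (\<forall>x\<in>carrier M. p (g x) = f x)))"


section \<open>Categories, functors and relative separability\<close>

record ('o, 'a) category =
  Obj :: "'o set"
  Hom :: "'o \<Rightarrow> 'o \<Rightarrow> 'a set"
  Ident :: "'o \<Rightarrow> 'a"
  Comp :: "'o \<Rightarrow> 'o \<Rightarrow> 'o \<Rightarrow> 'a \<Rightarrow> 'a \<Rightarrow> 'a"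
    \<comment> \<open>\<open>Comp C X Y Z g f\<close> is \<open>g \<circ> f\<close> for \<open>f : X \<rightarrow> Y\<close> and \<open>g : Y \<rightarrow> Z\<close>\<close>

record ('o, 'a, 'p, 'b) cat_functor =
  fobj :: "'o \<Rightarrow> 'p"
  fmap :: "'o \<Rightarrow> 'o \<Rightarrow> 'a \<Rightarrow> 'b"

text \<open>\<open>relatively_separable C D E U V\<close> says that \<open>U : C \<rightarrow> D\<close> is \<open>V\<close>-separable for \<open>V : C \<rightarrow> E\<close>.\<close>

definition relatively_separable ::
  "('o, 'a) category \<Rightarrow> ('p, 'b) category \<Rightarrow> ('q, 'c) category \<Rightarrow>
   ('o, 'a, 'p, 'b) cat_functor \<Rightarrow> ('o, 'a, 'q, 'c) cat_functor \<Rightarrow> bool"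
where
  "relatively_separable C D E U V \<longleftrightarrow>
     (\<exists>P :: 'o \<Rightarrow> 'o \<Rightarrow> 'b \<Rightarrow> 'c.
        (\<forall>X\<in>Obj C. \<forall>Y\<in>Obj C.
           P X Y \<in> Hom D (fobj U X) (fobj U Y) \<rightarrow> Hom E (fobj V X) (fobj V Y)) \<and>
        (\<forall>X\<in>Obj C. \<forall>Y\<in>Obj C. \<forall>Z\<in>Obj C. \<forall>T\<in>Obj C.
           \<forall>u\<in>Hom C X Y. \<forall>v\<in>Hom C Z T. \<forall>h\<in>Hom D (fobj U Y) (fobj U Z).
             P X T (Comp D (fobj U X) (fobj U Z) (fobj U T) (fmap U Z T v)
                      (Comp D (fobj U X) (fobj U Y) (fobj U Z) h (fmap U X Y u))) =
             Comp E (fobj V X) (fobj V Z) (fobj V T) (fmap V Z T v)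
               (Comp E (fobj V X) (fobj V Y) (fobj V Z) (P Y Z h) (fmap V X Y u))) \<and>
        (\<forall>X\<in>Obj C. \<forall>Y\<in>Obj C. \<forall>f\<in>Hom C X Y. P X Y (fmap U X Y f) = fmap V X Y f))"

text \<open>The objects of the three categories have their carrier in the type \<open>'u\<close>, which is the
  universe in which the categories are formed; it should be infinite and at least as large as \<open>L\<close>,
  so that it contains copies of all tensor powers of \<open>L\<close>.  Morphisms are functions taking the value
  \<^const>\<open>undefined\<close> off the carrier, so that equality of morphisms is equality as maps.\<close>

definition Mod_cat :: "'k ring \<Rightarrow> ('k, 'l) hopf \<Rightarrow> (('k, 'u, 'l) rmod, 'u \<Rightarrow> 'u) category"
where
  "Mod_cat K L =
     \<lparr>Obj = {M. right_module K L M},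
      Hom = (\<lambda>M N. {f \<in> extensional (carrier M). L_linear K L M N f}),
      Ident = (\<lambda>M. \<lambda>x\<in>carrier M. x),
      Comp = (\<lambda>M N Q g f. compose (carrier M) g f)\<rparr>"

definition Comod_cat :: "'k ring \<Rightarrow> ('k, 'l) hopf \<Rightarrow> (('k, 'u, 'l) comod, 'u \<Rightarrow> 'u) category"
where
  "Comod_cat K L =
     \<lparr>Obj = {M. right_comodule K L M},
      Hom = (\<lambda>M N. {f \<in> extensional (carrier M). colinear K L M N f}),
      Ident = (\<lambda>M. \<lambda>x\<in>carrier M. x),
      Comp = (\<lambda>M N Q g f. compose (carrier M) g f)\<rparr>"

definition YD_cat :: "'k ring \<Rightarrow> ('k, 'l) hopf \<Rightarrow> (('k, 'u, 'l) ydmod, 'u \<Rightarrow> 'u) category"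
where
  "YD_cat K L =
     \<lparr>Obj = {M. yetter_drinfeld K L M},
      Hom = (\<lambda>M N. {f \<in> extensional (carrier M).
               L_linear K L (forget_coaction M) (forget_coaction N) f \<and>
               colinear K L (forget_action M) (forget_action N) f}),
      Ident = (\<lambda>M. \<lambda>x\<in>carrier M. x),
      Comp = (\<lambda>M N Q g f. compose (carrier M) g f)\<rparr>"

definition F_functor ::
  "(('k, 'u, 'l) ydmod, 'u \<Rightarrow> 'u, ('k, 'u, 'l) rmod, 'u \<Rightarrow> 'u) cat_functor"
  where "F_functor = \<lparr>fobj = forget_coaction, fmap = (\<lambda>M N f. f)\<rparr>"

definition H_functor ::
  "(('k, 'u, 'l) ydmod, 'u \<Rightarrow> 'u, ('k, 'u, 'l) comod, 'u \<Rightarrow> 'u) cat_functor"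
  where "H_functor = \<lparr>fobj = forget_action, fmap = (\<lambda>M N f. f)\<rparr>"

end

theory Submission
  imports Defs
begin

text \<open>The antipode enters only through the entwining map \<open>g \<otimes> h \<mapsto> h\<^sub>2 \<otimes> S(h\<^sub>1) g h\<^sub>3\<close>, called \<open>twist\<close> below. A
  Yetter-Drinfeld module is a module and comodule with \<open>\<rho>(m h) = \<Sum> m\<^sub>0 p \<otimes> q\<close>, where \<open>p \<otimes> q\<close> is the entwining of
  \<open>m\<^sub>1\<close> and \<open>h\<close>; the conditions on \<open>\<theta>\<close> and \<open>e\<close> are statements about it; and it is compatible with
  multiplication, unit, comultiplication and counit because \<open>S\<close> is an antihomomorphism of algebras and of
  coalgebras (\<open>twist_mult\<close>, \<open>twist_one\<close>, \<open>sw_twist\<close>, \<open>twist_counit\<close>).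

  Given \<open>\<theta>\<close>, the map \<open>m \<otimes> l \<mapsto> m\<^sub>0 \<theta>(m\<^sub>1 \<otimes> l)\<close> is a natural colinear retraction of the coaction
  \<open>M \<rightarrow> M \<otimes> L\<close>. Therefore \<open>h \<mapsto> (v \<mapsto> h(v\<^sub>0)\<^sub>0 \<theta>(h(v\<^sub>0)\<^sub>1 \<otimes> v\<^sub>1))\<close> turns every \<open>K\<close>-linear map into a colinear one and
  fixes the colinear ones (\<open>colift_colinear\<close>, \<open>colift_fix\<close>). On \<open>L\<close>-linear maps this is a separating family,
  and applied to \<open>f \<circ> r\<close> with a linear retraction \<open>r\<close> it gives relative injectivity. Dually, \<open>e\<close> gives the
  operator \<open>h \<mapsto> (x \<mapsto> \<Sum> h(x\<^sub>0 e\<^sup>1(x\<^sub>1)) e\<^sup>2(x\<^sub>1))\<close>, which makes maps \<open>L\<close>-linear (\<open>linlift_act\<close>, \<open>linlift_fix\<close>).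

  Conversely, a separating family is evaluated on one endomorphism, called \<open>probe\<close>, of one object. For \<open>e\<close>
  this object is \<open>L \<otimes> L \<otimes> L\<close>, cofree over the last factor, and for \<open>\<theta>\<close> it is \<open>(L \<otimes> L) \<otimes> L \<otimes> L\<close>, free over the
  last factor. Naturality with respect to a few Yetter-Drinfeld endomorphisms determines the image of
  \<open>probe\<close> so far that its linearity, respectively colinearity, becomes the first condition
  (\<open>casimir_exists\<close>, \<open>theta_exists\<close>). The objects have to live in the universe \<open>'u\<close>; since it is infinite and
  at least as large as \<open>L\<close>, it contains copies of them (\<open>tensor_product_lepoll\<close>, \<open>module_copy\<close>).

  The remaining forms of the conditions are linear algebra: \<open>\<gamma>(h)(g) = \<theta>(g \<otimes> h)\<close>, and for finitely generated
  projective \<open>L\<close> a dual basis shows that every linear map \<open>L \<rightarrow> L \<otimes> L\<close> comes from an element of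
  \<open>End(L) \<otimes> L\<close> (\<open>casimir_map_surj\<close>).\<close>

section \<open>Linear maps\<close>

lemma k_linearI:
  assumes "\<And>x. x \<in> carrier M \<Longrightarrow> f x \<in> carrier N"
    and "\<And>x y. \<lbrakk>x \<in> carrier M; y \<in> carrier M\<rbrakk> \<Longrightarrow> f (x \<oplus>\<^bsub>M\<^esub> y) = f x \<oplus>\<^bsub>N\<^esub> f y"
    and "\<And>a x. \<lbrakk>a \<in> carrier K; x \<in> carrier M\<rbrakk> \<Longrightarrow> f (a \<odot>\<^bsub>M\<^esub> x) = a \<odot>\<^bsub>N\<^esub> f x"
  shows "k_linear K M N f"
  using assms by (auto simp: k_linear_def)

lemma k_linear_closed: "\<lbrakk>k_linear K M N f; x \<in> carrier M\<rbrakk> \<Longrightarrow> f x \<in> carrier N"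
  and k_linear_add: "\<lbrakk>k_linear K M N f; x \<in> carrier M; y \<in> carrier M\<rbrakk>
        \<Longrightarrow> f (x \<oplus>\<^bsub>M\<^esub> y) = f x \<oplus>\<^bsub>N\<^esub> f y"
  and k_linear_smult: "\<lbrakk>k_linear K M N f; a \<in> carrier K; x \<in> carrier M\<rbrakk>
        \<Longrightarrow> f (a \<odot>\<^bsub>M\<^esub> x) = a \<odot>\<^bsub>N\<^esub> f x"
  by (auto simp: k_linear_def)

definition bilin where
  "bilin K M N P f \<longleftrightarrow> (\<forall>x\<in>carrier M. k_linear K N P (f x)) \<and> (\<forall>y\<in>carrier N. k_linear K M P (\<lambda>x. f x y))"

section \<open>Tensor products\<close>

lemma pairs_group_comm: "comm_group (pairs_group M N)"
  unfolding pairs_group_def by (rule abelian_free_Abelian_group)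

lemma tensor_relations_subset:
  assumes "module K M" "module K N"
  shows "tensor_relations K M N \<subseteq> carrier (pairs_group M N)"
proof -
  interpret M: module K M by fact
  interpret N: module K N by fact
  show ?thesis
    unfolding tensor_relations_def pairs_group_def
    by (auto dest!: subsetD[OF keys_diff])
qed

text \<open>The extension of \<open>f\<close> to formal combinations, that is, \<^const>\<open>tensor_lift\<close> before passing to classes.\<close>

definition frag_eval :: "('p, 'x) ring_scheme \<Rightarrow> ('m \<Rightarrow> 'n \<Rightarrow> 'p) \<Rightarrow> ('m \<times> 'n \<Rightarrow>\<^sub>0 int) \<Rightarrow> 'p" where
  "frag_eval P f c = (\<Oplus>\<^bsub>P\<^esub>z\<in>Poly_Mapping.keys c. [Poly_Mapping.lookup c z] \<cdot>\<^bsub>P\<^esub> f (fst z) (snd z))"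

text \<open>The sum may run over any finite set containing the keys. Additivity of \<^const>\<open>frag_eval\<close> follows,
  since two combinations can then be summed over the same set.\<close>

lemma frag_eval_superset:
  assumes "abelian_group P" "\<And>x y. \<lbrakk>x \<in> carrier M; y \<in> carrier N\<rbrakk> \<Longrightarrow> f x y \<in> carrier P"
    and "finite A" "Poly_Mapping.keys c \<subseteq> A" "A \<subseteq> carrier M \<times> carrier N"
  shows "frag_eval P f c = (\<Oplus>\<^bsub>P\<^esub>z\<in>A. [Poly_Mapping.lookup c z] \<cdot>\<^bsub>P\<^esub> f (fst z) (snd z))"
proof -
  interpret P: abelian_group P by fact
  have "[Poly_Mapping.lookup c z] \<cdot>\<^bsub>P\<^esub> f (fst z) (snd z) = \<zero>\<^bsub>P\<^esub>" if "z \<in> A - Poly_Mapping.keys c" for z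
    using that by (simp add: in_keys_iff add_pow_def)
  then show ?thesis
    unfolding frag_eval_def
    by (intro P.add.finprod_mono_neutral_cong_left)
      (use assms in \<open>auto intro!: P.add.int_pow_closed simp: Pi_def\<close>)
qed

lemma frag_eval_hom:
  assumes "abelian_group P" "\<And>x y. \<lbrakk>x \<in> carrier M; y \<in> carrier N\<rbrakk> \<Longrightarrow> f x y \<in> carrier P"
  shows "frag_eval P f \<in> hom (pairs_group M N) (add_monoid P)"
proof -
  interpret P: abelian_group P by fact
  show ?thesis
  proof (rule homI)
    fix c assume "c \<in> carrier (pairs_group M N)"
    then show "frag_eval P f c \<in> carrier (add_monoid P)"
      unfolding frag_eval_def pairs_group_def using assms(2)
      by (auto intro!: P.finsum_closed P.add.int_pow_closed)
  next
    fix c d assume c: "c \<in> carrier (pairs_group M N)" "d \<in> carrier (pairs_group M N)"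
    let ?A = "Poly_Mapping.keys c \<union> Poly_Mapping.keys d"
    let ?S = "\<lambda>c. (\<Oplus>\<^bsub>P\<^esub>z\<in>?A. [Poly_Mapping.lookup c z] \<cdot>\<^bsub>P\<^esub> f (fst z) (snd z))"
    have A: "finite ?A" "?A \<subseteq> carrier M \<times> carrier N" using c by (auto simp: pairs_group_def)
    have fc: "f (fst z) (snd z) \<in> carrier P" if "z \<in> ?A" for z
      using that A(2) assms(2) by auto
    note ev = frag_eval_superset[OF assms(1), of M N f, OF assms(2) A(1) _ A(2)]
    have "frag_eval P f (c + d) = ?S (c + d)"
      by (rule ev) (auto dest!: subsetD[OF keys_add])
    also have "\<dots> = ?S c \<oplus>\<^bsub>P\<^esub> ?S d"
    proof -
      have m: "[(Poly_Mapping.lookup e z :: int)] \<cdot>\<^bsub>P\<^esub> f (fst z) (snd z) \<in> carrier P" if "z \<in> ?A" for e z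
        using fc[OF that] by (rule P.add.int_pow_closed)
      have "?S (c + d) = (\<Oplus>\<^bsub>P\<^esub>z\<in>?A. [Poly_Mapping.lookup c z] \<cdot>\<^bsub>P\<^esub> f (fst z) (snd z)
          \<oplus>\<^bsub>P\<^esub> [Poly_Mapping.lookup d z] \<cdot>\<^bsub>P\<^esub> f (fst z) (snd z))"
        using m fc by (intro P.finsum_cong') (auto simp: lookup_add P.add.int_pow_mult)
      also have "\<dots> = ?S c \<oplus>\<^bsub>P\<^esub> ?S d" using m by (intro P.finsum_addf) auto
      finally show ?thesis .
    qed
    also have "\<dots> = frag_eval P f c \<oplus>\<^bsub>P\<^esub> frag_eval P f d"
      using ev[of c] ev[of d] by auto
    finally show "frag_eval P f (c \<otimes>\<^bsub>pairs_group M N\<^esub> d)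
        = frag_eval P f c \<otimes>\<^bsub>add_monoid P\<^esub> frag_eval P f d"
      by (simp add: pairs_group_def)
  qed
qed

lemma frag_eval_frag_of:
  assumes "abelian_group P" "f x y \<in> carrier P"
  shows "frag_eval P f (frag_of (x, y)) = f x y"
proof -
  interpret P: abelian_group P by fact
  show ?thesis
    unfolding frag_eval_def using assms(2) by (simp add: P.finsum_insert P.add.int_pow_1)
qed

definition tensor_class where
  "tensor_class K M N c = tensor_null K M N #>\<^bsub>pairs_group M N\<^esub> c"

locale module_pair = M: module K M + N: module K N
  for K :: "'k ring" and M :: "('k, 'm, 'x) module_scheme" and N :: "('k, 'n, 'y) module_scheme"
begin

abbreviation "G \<equiv> pairs_group M N"
abbreviation "Z \<equiv> tensor_null K M N"
abbreviation "T \<equiv> tensor_product K M N"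
abbreviation "cls \<equiv> tensor_class K M N"

sublocale G: comm_group G by (rule pairs_group_comm)

lemma relations: "tensor_relations K M N \<subseteq> carrier G"
  by (rule tensor_relations_subset) unfold_locales

lemma null_subgroup: "subgroup Z G"
  unfolding tensor_null_def by (rule G.generate_is_subgroup[OF relations])

sublocale Z: normal Z G
  by (rule G.subgroup_imp_normal[OF null_subgroup])

lemma tensor_as_quotient:
  "carrier T = carrier (G Mod Z)" "x \<oplus>\<^bsub>T\<^esub> y = x \<otimes>\<^bsub>G Mod Z\<^esub> y" "\<zero>\<^bsub>T\<^esub> = \<one>\<^bsub>G Mod Z\<^esub>"
  by (simp_all add: tensor_product_def FactGroup_def)

lemma abelian_group_tensor: "abelian_group T"
proof -
  interpret Q: comm_group "G Mod Z" by (rule G.abelian_FactGroup[OF null_subgroup])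
  show ?thesis
    by (rule abelian_groupI)
      (unfold tensor_as_quotient, auto simp del: mult_FactGroup one_FactGroup simp: Q.m_ac intro: Q.l_inv_ex)
qed

lemma cls_hom: "cls \<in> hom G (add_monoid T)"
  using Z.r_coset_hom_Mod
  unfolding hom_def tensor_class_def by (simp add: tensor_as_quotient)

lemma cls_closed: "c \<in> carrier G \<Longrightarrow> cls c \<in> carrier T"
  and cls_add: "\<lbrakk>c \<in> carrier G; d \<in> carrier G\<rbrakk> \<Longrightarrow> cls (c + d) = cls c \<oplus>\<^bsub>T\<^esub> cls d"
  using cls_hom by (auto simp: hom_def pairs_group_def)

lemma cls_surj: "t \<in> carrier T \<Longrightarrow> \<exists>c\<in>carrier G. t = cls c"
  by (auto simp: tensor_product_def tensor_class_def RCOSETS_def)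

lemma mem_cls: "c \<in> carrier G \<Longrightarrow> c \<in> cls c"
  unfolding tensor_class_def by (rule G.rcos_self[OF _ null_subgroup])

lemma hom_null:
  assumes "group H" "h \<in> hom G H" "\<And>r. r \<in> tensor_relations K M N \<Longrightarrow> h r = \<one>\<^bsub>H\<^esub>" "c \<in> Z"
  shows "h c = \<one>\<^bsub>H\<^esub>"
proof -
  interpret h: group_hom G H h
    using assms by (auto simp: group_hom_def group_hom_axioms_def)
  have "tensor_relations K M N \<subseteq> kernel G H h"
    using relations assms(3) by (auto simp: kernel_def)
  then have "Z \<subseteq> kernel G H h"
    unfolding tensor_null_def by (rule G.generate_subgroup_incl[OF _ h.subgroup_kernel])
  then show ?thesis using assms(4) by (auto simp: kernel_def)
qed

text \<open>This is why the representative chosen in \<^const>\<open>tensor_lift\<close> is irrelevant: a homomorphism that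
  kills the relations is constant on classes.\<close>

lemma hom_cls:
  assumes "group H" "h \<in> hom G H" "\<And>r. r \<in> tensor_relations K M N \<Longrightarrow> h r = \<one>\<^bsub>H\<^esub>"
    and "c \<in> carrier G" "d \<in> cls c"
  shows "h d = h c"
proof -
  interpret h: group_hom G H h
    using assms by (auto simp: group_hom_def group_hom_axioms_def)
  obtain z where z: "z \<in> Z" "d = z \<otimes>\<^bsub>G\<^esub> c"
    using assms(5) unfolding tensor_class_def r_coset_def by auto
  have "z \<in> carrier G" using Z.mem_carrier[OF z(1)] .
  then have "h d = h z \<otimes>\<^bsub>H\<^esub> h c" using assms(4) z(2) by simp
  also have "\<dots> = h c"
    using hom_null[OF assms(1-3) z(1)] assms(4) by simp
  finally show ?thesis .
qed

lemma cls_relation: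
  assumes "r \<in> tensor_relations K M N" shows "cls r = \<zero>\<^bsub>T\<^esub>"
proof -
  have "r \<in> Z" using assms unfolding tensor_null_def by (rule generate.incl)
  then show ?thesis
    using G.coset_join2[OF Z.mem_carrier null_subgroup] by (simp add: tensor_class_def tensor_product_def)
qed

lemma cls_diff: "\<lbrakk>c \<in> carrier G; d \<in> carrier G; cls (c - d) = \<zero>\<^bsub>T\<^esub>\<rbrakk> \<Longrightarrow> cls c = cls d"
proof -
  assume a: "c \<in> carrier G" "d \<in> carrier G" "cls (c - d) = \<zero>\<^bsub>T\<^esub>"
  interpret T: abelian_group T by (rule abelian_group_tensor)
  have "c - d \<in> carrier G" using a by (auto simp: pairs_group_def dest: subsetD[OF keys_diff])
  from cls_add[OF this a(2)] show ?thesis using a by (simp add: cls_closed)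
qed

lemma in_pairs: "\<lbrakk>x \<in> carrier M; y \<in> carrier N\<rbrakk> \<Longrightarrow> frag_of (x, y) \<in> carrier G"
  by (simp add: pairs_group_def)

lemma pairs_add: "\<lbrakk>c \<in> carrier G; d \<in> carrier G\<rbrakk> \<Longrightarrow> c + d \<in> carrier G"
  and pairs_diff: "\<lbrakk>c \<in> carrier G; d \<in> carrier G\<rbrakk> \<Longrightarrow> c - d \<in> carrier G"
  and pairs_minus: "c \<in> carrier G \<Longrightarrow> - c \<in> carrier G"
  by (auto simp: pairs_group_def dest: subsetD[OF keys_diff] subsetD[OF keys_add])

lemma tens_eq_cls: "tens K M N x y = cls (frag_of (x, y))"
  by (simp add: tens_def tensor_class_def)

lemma tens_closed: "\<lbrakk>x \<in> carrier M; y \<in> carrier N\<rbrakk> \<Longrightarrow> tens K M N x y \<in> carrier T"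
  by (simp add: tens_eq_cls cls_closed in_pairs)

lemma tens_add_left:
  "\<lbrakk>x \<in> carrier M; x' \<in> carrier M; y \<in> carrier N\<rbrakk> \<Longrightarrow>
     tens K M N (x \<oplus>\<^bsub>M\<^esub> x') y = tens K M N x y \<oplus>\<^bsub>T\<^esub> tens K M N x' y"
  unfolding tens_eq_cls cls_add[OF in_pairs in_pairs, symmetric]
  by (rule cls_diff, simp_all only: in_pairs pairs_add M.a_closed diff_diff_eq[symmetric],
      rule cls_relation) (unfold tensor_relations_def, blast)

lemma tens_add_right:
  "\<lbrakk>x \<in> carrier M; y \<in> carrier N; y' \<in> carrier N\<rbrakk> \<Longrightarrow>
     tens K M N x (y \<oplus>\<^bsub>N\<^esub> y') = tens K M N x y \<oplus>\<^bsub>T\<^esub> tens K M N x y'"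
  unfolding tens_eq_cls cls_add[OF in_pairs in_pairs, symmetric]
  by (rule cls_diff, simp_all only: in_pairs pairs_add N.a_closed diff_diff_eq[symmetric],
      rule cls_relation) (unfold tensor_relations_def, blast)

lemma tens_balanced:
  "\<lbrakk>a \<in> carrier K; x \<in> carrier M; y \<in> carrier N\<rbrakk> \<Longrightarrow>
     tens K M N (a \<odot>\<^bsub>M\<^esub> x) y = tens K M N x (a \<odot>\<^bsub>N\<^esub> y)"
  unfolding tens_eq_cls
  by (rule cls_diff, simp_all only: in_pairs M.smult_closed N.smult_closed,
      rule cls_relation) (unfold tensor_relations_def, blast)

lemma cls_uminus: 
  assumes "x \<in> carrier M" "y \<in> carrier N"
  shows "cls (- frag_of (x, y)) = tens K M N (\<ominus>\<^bsub>M\<^esub> x) y"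
proof -
  interpret T: abelian_group T by (rule abelian_group_tensor)
  have c: "frag_of (x, y) \<in> carrier G" using assms by (rule in_pairs)
  have z: "cls 0 = \<zero>\<^bsub>T\<^esub>"
    using T.add.l_cancel_one'[of "cls 0" "cls 0"] cls_add[of 0 0] cls_closed[of 0]
    by (simp add: pairs_group_def)
  have z2: "tens K M N \<zero>\<^bsub>M\<^esub> y = \<zero>\<^bsub>T\<^esub>"
    using tens_add_left[of "\<zero>\<^bsub>M\<^esub>" "\<zero>\<^bsub>M\<^esub>" y] assms tens_closed[of "\<zero>\<^bsub>M\<^esub>" y]
    by (simp add: T.add.l_cancel_one')
  have "cls (- frag_of (x, y)) \<oplus>\<^bsub>T\<^esub> tens K M N x y = \<zero>\<^bsub>T\<^esub>"
    using cls_add[of "- frag_of (x, y)" "frag_of (x, y)"] c pairs_minus[OF c] z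
    by (simp add: tens_eq_cls)
  moreover have "tens K M N (\<ominus>\<^bsub>M\<^esub> x) y \<oplus>\<^bsub>T\<^esub> tens K M N x y = \<zero>\<^bsub>T\<^esub>"
    using tens_add_left[of "\<ominus>\<^bsub>M\<^esub> x" x y] assms z2 by (simp add: M.l_neg)
  ultimately show ?thesis
    using assms c by (metis T.add.right_cancel cls_closed pairs_minus tens_closed M.a_inv_closed)
qed

text \<open>Closure under addition suffices, because \<open>- (x \<otimes> y) = (- x) \<otimes> y\<close> is again a pure tensor.\<close>

lemma tensor_induct [consumes 1, case_names tens add]:
  assumes t: "t \<in> carrier T"
    and tens: "\<And>x y. \<lbrakk>x \<in> carrier M; y \<in> carrier N\<rbrakk> \<Longrightarrow> Q (tens K M N x y)"
    and add: "\<And>s t. \<lbrakk>s \<in> carrier T; t \<in> carrier T; Q s; Q t\<rbrakk> \<Longrightarrow> Q (s \<oplus>\<^bsub>T\<^esub> t)"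
  shows "Q t"
proof -
  interpret T: abelian_group T by (rule abelian_group_tensor)
  have z2: "tens K M N \<zero>\<^bsub>M\<^esub> \<zero>\<^bsub>N\<^esub> = \<zero>\<^bsub>T\<^esub>"
    using tens_add_left[of "\<zero>\<^bsub>M\<^esub>" "\<zero>\<^bsub>M\<^esub>" "\<zero>\<^bsub>N\<^esub>"] tens_closed[of "\<zero>\<^bsub>M\<^esub>" "\<zero>\<^bsub>N\<^esub>"]
    by (simp add: T.add.l_cancel_one')
  have z: "cls 0 = \<zero>\<^bsub>T\<^esub>"
    using T.add.l_cancel_one'[of "cls 0" "cls 0"] cls_add[of 0 0] cls_closed[of 0]
    by (simp add: pairs_group_def)
  have Q0: "Q (cls 0)" unfolding z z2[symmetric] by (rule tens) simp_all
  obtain c where c: "c \<in> carrier G" "t = cls c" using cls_surj[OF t] by auto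
  \<comment> \<open>The negative has to be carried along: the induction on formal combinations subtracts.\<close>
  have "Poly_Mapping.keys c \<subseteq> carrier M \<times> carrier N" using c by (simp add: pairs_group_def)
  then have "Q (cls c) \<and> Q (cls (- c))"
  proof (induction rule: free_Abelian_group_induct[consumes 1, case_names zero diff one])
    case (diff c d)
    then have "c \<in> carrier G" "d \<in> carrier G" by (simp_all add: pairs_group_def)
    then show ?case
      using add[OF cls_closed cls_closed, of c "- d"] add[OF cls_closed cls_closed, of d "- c"]
        diff cls_add[of c "-d"] cls_add[of d "-c"] by (simp add: pairs_minus)
  next
    case (one z)
    then show ?case
      using tens[of "fst z" "snd z"] tens[of "\<ominus>\<^bsub>M\<^esub> fst z" "snd z"] cls_uminus[of "fst z" "snd z"]
      by (auto simp: tens_eq_cls)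
  qed (use Q0 in simp)
  then show ?thesis using c by simp
qed

lemma scale_hom:
  assumes a: "a \<in> carrier K"
  shows "frag_extend (\<lambda>(x, y). frag_of (a \<odot>\<^bsub>M\<^esub> x, y)) \<in> hom G G"
proof (rule homI)
  fix c assume "c \<in> carrier G"
  then have "Poly_Mapping.keys c \<subseteq> carrier M \<times> carrier N" by (simp add: pairs_group_def)
  then show "frag_extend (\<lambda>(x, y). frag_of (a \<odot>\<^bsub>M\<^esub> x, y)) c \<in> carrier G"
  proof (induction rule: free_Abelian_group_induct[consumes 1, case_names zero diff one])
    case (diff x y)
    then show ?case by (simp only: frag_extend_diff pairs_diff)
  next
    case (one z)
    then show ?case using a by (auto simp: pairs_group_def)
  qed (simp add: pairs_group_def)
qed (simp add: pairs_group_def frag_extend_add)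

text \<open>Acting on the first component maps relations to relations, so all the classes in the union that
  defines the scalar multiplication coincide.\<close>

lemma smult_cls:
  assumes a: "a \<in> carrier K" and c: "c \<in> carrier G"
  shows "a \<odot>\<^bsub>T\<^esub> cls c = cls (frag_extend (\<lambda>(x, y). frag_of (a \<odot>\<^bsub>M\<^esub> x, y)) c)"
proof -
  interpret T: abelian_group T by (rule abelian_group_tensor)
  let ?s = "frag_extend (\<lambda>(x, y). frag_of (a \<odot>\<^bsub>M\<^esub> x, y))"
  have h: "cls \<circ> ?s \<in> hom G (add_monoid T)"
    by (rule hom_compose[OF scale_hom[OF a] cls_hom])
  have g: "group (add_monoid T)" by (rule T.a_group)
  have r: "(cls \<circ> ?s) r = \<one>\<^bsub>add_monoid T\<^esub>" if "r \<in> tensor_relations K M N" for r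
  proof -
    have "?s r \<in> tensor_relations K M N"
      using that a unfolding tensor_relations_def
    proof (elim UnE CollectE exE conjE, goal_cases)
      case (1 x x' y)
      then show ?case using a M.smult_r_distr[OF a, of x x'] M.smult_closed[OF a]
        by (intro UnI1 CollectI exI[of _ "a \<odot>\<^bsub>M\<^esub> x"] exI[of _ "a \<odot>\<^bsub>M\<^esub> x'"] exI[of _ y]) (simp add: frag_extend_diff)
    next
      case (2 x y y')
      then show ?case using M.smult_closed[OF a]
        by (intro UnI1 UnI2 CollectI exI[of _ "a \<odot>\<^bsub>M\<^esub> x"] exI[of _ y] exI[of _ y']) (simp add: frag_extend_diff)
    next
      case (3 b x y)
      have "a \<odot>\<^bsub>M\<^esub> (b \<odot>\<^bsub>M\<^esub> x) = b \<odot>\<^bsub>M\<^esub> (a \<odot>\<^bsub>M\<^esub> x)"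
        using 3 a M.smult_assoc1 M.R.m_comm by metis
      then show ?case using 3 M.smult_closed[OF a]
        by (intro UnI2 CollectI exI[of _ b] exI[of _ "a \<odot>\<^bsub>M\<^esub> x"] exI[of _ y]) (simp add: frag_extend_diff)
    qed
    then show ?thesis using cls_relation by simp
  qed
  have "(\<Union>d\<in>cls c. cls (?s d)) = (\<Union>d\<in>cls c. cls (?s c))"
    using hom_cls[OF g h r c] by auto
  also have "\<dots> = cls (?s c)" using mem_cls[OF c] by auto
  finally show ?thesis by (simp add: tensor_product_def tensor_class_def)
qed

lemma smult_tens:
  "\<lbrakk>a \<in> carrier K; x \<in> carrier M; y \<in> carrier N\<rbrakk> \<Longrightarrow>
     a \<odot>\<^bsub>T\<^esub> tens K M N x y = tens K M N (a \<odot>\<^bsub>M\<^esub> x) y"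
  by (simp add: tens_eq_cls smult_cls in_pairs)

lemma smult_add_tensor:
  assumes "a \<in> carrier K" "s \<in> carrier T" "t \<in> carrier T"
  shows "a \<odot>\<^bsub>T\<^esub> (s \<oplus>\<^bsub>T\<^esub> t) = a \<odot>\<^bsub>T\<^esub> s \<oplus>\<^bsub>T\<^esub> a \<odot>\<^bsub>T\<^esub> t"
proof -
  obtain c d where c: "c \<in> carrier G" "s = cls c" "d \<in> carrier G" "t = cls d"
    using cls_surj[OF assms(2)] cls_surj[OF assms(3)] by blast
  then show ?thesis
    using scale_hom[OF assms(1)] 
    by (simp add: smult_cls assms cls_add[symmetric] pairs_add frag_extend_add hom_in_carrier)
qed

lemma smult_tensor_closed:
  assumes "a \<in> carrier K" "t \<in> carrier T"
  shows "a \<odot>\<^bsub>T\<^esub> t \<in> carrier T"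
proof -
  obtain c where "c \<in> carrier G" "t = cls c" using cls_surj assms by metis
  then show ?thesis using scale_hom[OF assms(1)] assms
    by (simp add: smult_cls cls_closed hom_in_carrier)
qed

lemma module_tensor: "module K T"
proof -
  interpret T: abelian_group T by (rule abelian_group_tensor)
  show ?thesis
  proof (rule moduleI)
    show "cring K" by unfold_locales
    show "abelian_group T" by (rule abelian_group_tensor)
  next
    fix a b t assume a: "a \<in> carrier K" "b \<in> carrier K" and "t \<in> carrier T"
    from this(3) show "(a \<oplus>\<^bsub>K\<^esub> b) \<odot>\<^bsub>T\<^esub> t = a \<odot>\<^bsub>T\<^esub> t \<oplus>\<^bsub>T\<^esub> b \<odot>\<^bsub>T\<^esub> t"
    proof (induction rule: tensor_induct)
      case (tens x y)
      then show ?case using a by (simp add: smult_tens M.smult_l_distr tens_add_left)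
    next
      case (add s t)
      then show ?case using a
        by (simp add: smult_add_tensor smult_tensor_closed T.a_ac)
    qed
  next
    fix a b t assume a: "a \<in> carrier K" "b \<in> carrier K" and "t \<in> carrier T"
    from this(3) show "(a \<otimes>\<^bsub>K\<^esub> b) \<odot>\<^bsub>T\<^esub> t = a \<odot>\<^bsub>T\<^esub> (b \<odot>\<^bsub>T\<^esub> t)"
    proof (induction rule: tensor_induct)
      case (tens x y)
      then show ?case using a by (simp add: smult_tens M.smult_assoc1)
    next
      case (add s t)
      then show ?case using a by (simp add: smult_add_tensor smult_tensor_closed)
    qed
  next
    fix t assume "t \<in> carrier T"
    then show "\<one>\<^bsub>K\<^esub> \<odot>\<^bsub>T\<^esub> t = t"
      by (induction rule: tensor_induct) (simp_all add: smult_tens smult_add_tensor)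
  qed (simp_all add: smult_tensor_closed smult_add_tensor)
qed

lemma tensor_lift_cls:
  assumes P: "module K P" and f: "bilin K M N P f" and c: "c \<in> carrier G"
  shows "tensor_lift P f (cls c) = frag_eval P f c"
proof -
  interpret P: module K P by fact
  have fc: "f x y \<in> carrier P" if "x \<in> carrier M" "y \<in> carrier N" for x y
    using f that by (auto simp: bilin_def k_linear_def)
  have g: "group (add_monoid P)" by (rule P.a_group)
  note h = frag_eval_hom[of P M N f, OF P.abelian_group_axioms fc, simplified]
  have ev: "frag_eval P f (c - d) = frag_eval P f c \<ominus>\<^bsub>P\<^esub> frag_eval P f d"
    if "c \<in> carrier G" "d \<in> carrier G" for c d
  proof -
    interpret h: group_hom G "add_monoid P" "frag_eval P f"
      using h g by (auto simp: group_hom_def group_hom_axioms_def)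
    have "frag_eval P f (c + (- d)) = frag_eval P f c \<oplus>\<^bsub>P\<^esub> frag_eval P f (- d)"
      using h.hom_mult[of c "- d"] that pairs_minus by (simp add: pairs_group_def)
    also have "frag_eval P f (- d) = \<ominus>\<^bsub>P\<^esub> frag_eval P f d"
      using h.hom_inv[of d] that by (simp add: pairs_group_def a_inv_def)
    finally show ?thesis by (simp add: a_minus_def)
  qed
  have r: "frag_eval P f r = \<one>\<^bsub>add_monoid P\<^esub>" if "r \<in> tensor_relations K M N" for r
    using that unfolding tensor_relations_def
  proof (elim UnE CollectE exE conjE, goal_cases)
    case (1 x x' y)
    then have "f (x \<oplus>\<^bsub>M\<^esub> x') y = f x y \<oplus>\<^bsub>P\<^esub> f x' y"
      using f by (auto simp: bilin_def k_linear_def)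
    then show ?case using 1 fc
      by (simp add: ev in_pairs pairs_diff frag_eval_frag_of P.abelian_group_axioms P.minus_eq P.a_ac P.minus_add P.r_neg)
  next
    case (2 x y y')
    then have "f x (y \<oplus>\<^bsub>N\<^esub> y') = f x y \<oplus>\<^bsub>P\<^esub> f x y'"
      using f by (auto simp: bilin_def k_linear_def)
    then show ?case using 2 fc
      by (simp add: ev in_pairs pairs_diff frag_eval_frag_of P.abelian_group_axioms P.minus_eq P.a_ac P.minus_add P.r_neg)
  next
    case (3 a x y)
    then have "f (a \<odot>\<^bsub>M\<^esub> x) y = f x (a \<odot>\<^bsub>N\<^esub> y)"
      using f by (auto simp: bilin_def k_linear_def)
    then show ?case using 3 fc
      by (simp add: ev in_pairs pairs_diff frag_eval_frag_of P.abelian_group_axioms P.minus_eq P.r_neg)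
  qed
  have "(SOME d. d \<in> cls c) \<in> cls c" using mem_cls[OF c] by (rule someI)
  from hom_cls[OF g h r c this] show ?thesis
    by (simp add: tensor_lift_def frag_eval_def Let_def)
qed

lemma tensor_lift_tens:
  assumes "module K P" "bilin K M N P f" "x \<in> carrier M" "y \<in> carrier N"
  shows "tensor_lift P f (tens K M N x y) = f x y"
proof -
  interpret P: module K P by fact
  show ?thesis
    unfolding tens_eq_cls using assms(2-)
    by (subst tensor_lift_cls[OF assms(1,2) in_pairs])
      (auto intro!: frag_eval_frag_of P.abelian_group_axioms simp: bilin_def k_linear_def)
qed

lemma tensor_lift_linear:
  assumes P: "module K P" and f: "bilin K M N P f"
  shows "k_linear K T P (tensor_lift P f)"
proof -
  interpret P: module K P by fact
  have fc: "f x y \<in> carrier P" if "x \<in> carrier M" "y \<in> carrier N" for x y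
    using f that by (auto simp: bilin_def k_linear_def)
  note h = frag_eval_hom[of P M N f, OF P.abelian_group_axioms fc, simplified]
  have add_lift: "tensor_lift P f (s \<oplus>\<^bsub>T\<^esub> t) = tensor_lift P f s \<oplus>\<^bsub>P\<^esub> tensor_lift P f t"
    if "s \<in> carrier T" "t \<in> carrier T" for s t
  proof -
    obtain c d where c: "c \<in> carrier G" "s = cls c" "d \<in> carrier G" "t = cls d"
      using cls_surj \<open>s \<in> carrier T\<close> \<open>t \<in> carrier T\<close> by blast
    then show ?thesis
      using h by (simp add: cls_add[symmetric] tensor_lift_cls[OF P f] pairs_add)
        (simp add: hom_def pairs_group_def)
  qed
  have closed: "tensor_lift P f t \<in> carrier P" if "t \<in> carrier T" for t
    using that by (induction rule: tensor_induct) (simp_all add: tensor_lift_tens[OF P f] fc add_lift)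
  interpret T: module K T by (rule module_tensor)
  show ?thesis
  proof (rule k_linearI)
    fix a t assume a: "a \<in> carrier K" and "t \<in> carrier T"
    from this(2) show "tensor_lift P f (a \<odot>\<^bsub>T\<^esub> t) = a \<odot>\<^bsub>P\<^esub> tensor_lift P f t"
    proof (induction rule: tensor_induct)
      case (tens x y)
      then have "f (a \<odot>\<^bsub>M\<^esub> x) y = a \<odot>\<^bsub>P\<^esub> f x y"
        using f a by (auto simp: bilin_def k_linear_def)
      then show ?case using tens a by (simp add: smult_tens tensor_lift_tens[OF P f])
    next
      case (add s t)
      then show ?case using a
        by (simp add: smult_add_tensor add_lift closed smult_tensor_closed P.smult_r_distr)
    qed
  qed (simp_all add: closed add_lift)
qed

end

section \<open>Calculus of sums over tensors\<close>

lemma foldSetD_cong: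
  "(A, x) \<in> foldSetD D f e \<Longrightarrow> (\<And>a. a \<in> A \<Longrightarrow> f a = g a) \<Longrightarrow> (A, x) \<in> foldSetD D g e"
proof (induction A x rule: foldSetD.induct)
  case (insertI x A y)
  then show ?case by (metis foldSetD.insertI insert_iff)
qed (rule foldSetD.emptyI)

text \<open>The values need not lie in the group: a sum whose terms are only known to agree can be rewritten
  before its terms are known to be in the carrier.\<close>

lemma finprod_cong_on:
  assumes "\<And>a. a \<in> A \<Longrightarrow> f a = g a" shows "finprod G f A = finprod G g A"
proof -
  have "(A, x) \<in> foldSetD D (monoid.mult G \<circ> f) e \<longleftrightarrow> (A, x) \<in> foldSetD D (monoid.mult G \<circ> g) e" for x D e
    using foldSetD_cong[of A x D "monoid.mult G \<circ> f" e "monoid.mult G \<circ> g"]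
      foldSetD_cong[of A x D "monoid.mult G \<circ> g" e "monoid.mult G \<circ> f"] assms by auto
  then show ?thesis by (simp add: finprod_def foldD_def)
qed

text \<open>The sum \<open>\<Sum> f x\<^sub>i y\<^sub>i\<close> over \<open>t = \<Sum> x\<^sub>i \<otimes> y\<^sub>i\<close>. Cutting \<open>f\<close> off outside the carriers makes the congruence
  rule below unconditional, so that the simplifier knows the membership of the bound variables. The
  arguments \<open>M\<close> and \<open>N\<close> let the side conditions of the rules be found by matching.\<close>

definition tsum where
  "tsum M N P f t = tensor_lift P (\<lambda>x\<in>carrier M. \<lambda>y\<in>carrier N. f x y) t"

lemma tsum_cong [cong]:
  "\<lbrakk>t = t'; \<And>x y. \<lbrakk>x \<in> carrier M; y \<in> carrier N\<rbrakk> \<Longrightarrow> f x y = g x y\<rbrakk> \<Longrightarrow> tsum M N P f t = tsum M N P g t'"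
proof -
  assume a: "t = t'" "\<And>x y. \<lbrakk>x \<in> carrier M; y \<in> carrier N\<rbrakk> \<Longrightarrow> f x y = g x y"
  have "(\<lambda>x\<in>carrier M. \<lambda>y\<in>carrier N. f x y) = (\<lambda>x\<in>carrier M. \<lambda>y\<in>carrier N. g x y)"
    by (intro restrict_ext a(2))
  then show ?thesis using a(1) by (simp only: tsum_def)
qed

lemma tensor_lift_eq_tsum:
  assumes "module K M" "module K N" "t \<in> carrier (tensor_product K M N)"
  shows "tensor_lift P f t = tsum M N P f t"
proof -
  interpret module_pair K M N using assms by (simp add: module_pair_def)
  have "t \<noteq> {}" "t \<subseteq> carrier G"
    using cls_surj[OF assms(3)] mem_cls Z.rcosets_carrier[of t] assms(3)
    by (auto simp: tensor_product_def)
  then have "(SOME c. c \<in> t) \<in> carrier G" by (metis someI_ex ex_in_conv subsetD)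
  then have "Poly_Mapping.keys (SOME c. c \<in> t) \<subseteq> carrier M \<times> carrier N"
    by (simp add: pairs_group_def)
  then show ?thesis
    unfolding tsum_def tensor_lift_def Let_def finsum_def
    by (intro finprod_cong_on) auto
qed

lemma bilin_cong:
  "(\<And>x y. \<lbrakk>x \<in> carrier M; y \<in> carrier N\<rbrakk> \<Longrightarrow> f x y = g x y) \<Longrightarrow> module K M \<Longrightarrow> module K N \<Longrightarrow>
    bilin K M N P f = bilin K M N P g"
proof -
  assume a: "\<And>x y. \<lbrakk>x \<in> carrier M; y \<in> carrier N\<rbrakk> \<Longrightarrow> f x y = g x y" "module K M" "module K N"
  interpret M: module K M by fact
  interpret N: module K N by fact
  show ?thesis using a(1) by (auto simp: bilin_def k_linear_def Pi_def)
qed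

lemma module_tensor_product [simp]:
  "\<lbrakk>module K M; module K N\<rbrakk> \<Longrightarrow> module K (tensor_product K M N)"
  by (rule module_pair.module_tensor) (simp add: module_pair_def)

lemma tens_in [simp]:
  "\<lbrakk>module K M; module K N; x \<in> carrier M; y \<in> carrier N\<rbrakk> \<Longrightarrow> tens K M N x y \<in> carrier (tensor_product K M N)"
  by (rule module_pair.tens_closed) (simp_all add: module_pair_def)

lemma bilin_tens: 
  assumes "module K M" "module K N"
  shows "bilin K M N (tensor_product K M N) (tens K M N)"
proof -
  interpret module_pair K M N using assms by (simp add: module_pair_def)
  show ?thesis
    by (auto simp: bilin_def k_linear_def tens_closed tens_add_left tens_add_right smult_tens tens_balanced[symmetric])
qed

lemma bilin_restrict:
  assumes "module K M" "module K N" 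
  shows "bilin K M N P (\<lambda>x\<in>carrier M. \<lambda>y\<in>carrier N. f x y) = bilin K M N P f"
  using assms by (intro bilin_cong) auto

lemma tsum_tens [simp]:
  assumes "module K M" "module K N" "module K P" "bilin K M N P f" "x \<in> carrier M" "y \<in> carrier N"
  shows "tsum M N P f (tens K M N x y) = f x y"
  using module_pair.tensor_lift_tens[of K M N P "\<lambda>x\<in>carrier M. \<lambda>y\<in>carrier N. f x y" x y] assms
  by (simp add: tsum_def module_pair_def bilin_restrict)

lemma tsum_linear:
  assumes "module K M" "module K N" "module K P" "bilin K M N P f"
  shows "k_linear K (tensor_product K M N) P (tsum M N P f)"
  using module_pair.tensor_lift_linear[of K M N P "\<lambda>x\<in>carrier M. \<lambda>y\<in>carrier N. f x y"] assms
  by (simp add: tsum_def[abs_def] module_pair_def bilin_restrict)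

lemma k_linear_id: "k_linear K M M (\<lambda>x. x)"
  by (simp add: k_linear_def)

lemma k_linear_comp:
  "\<lbrakk>k_linear K M N f; k_linear K Q M g\<rbrakk> \<Longrightarrow> k_linear K Q N (\<lambda>z. f (g z))"
  by (auto simp: k_linear_def Pi_def)

lemma k_linear_tens_left:
  "\<lbrakk>module K M; module K N; k_linear K Q M f; y \<in> carrier N\<rbrakk>
     \<Longrightarrow> k_linear K Q (tensor_product K M N) (\<lambda>z. tens K M N (f z) y)"
  by (rule k_linear_comp[of _ M _ "\<lambda>x. tens K M N x y"]) (use bilin_tens[of K M N] in \<open>simp_all add: bilin_def\<close>)

lemma k_linear_tens_right:
  "\<lbrakk>module K M; module K N; k_linear K Q N f; x \<in> carrier M\<rbrakk>
     \<Longrightarrow> k_linear K Q (tensor_product K M N) (\<lambda>z. tens K M N x (f z))"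
  by (rule k_linear_comp[of _ N _ "tens K M N x"]) (use bilin_tens[of K M N] in \<open>simp_all add: bilin_def\<close>)

lemma k_linear_tsum_arg:
  "\<lbrakk>module K M; module K N; module K P; bilin K M N P f; k_linear K Q (tensor_product K M N) t\<rbrakk>
     \<Longrightarrow> k_linear K Q P (\<lambda>z. tsum M N P f (t z))"
  by (rule k_linear_comp[OF tsum_linear])

lemma tsum_closed [simp]:
  "\<lbrakk>module K M; module K N; module K P; bilin K M N P f; t \<in> carrier (tensor_product K M N)\<rbrakk>
     \<Longrightarrow> tsum M N P f t \<in> carrier P"
  using tsum_linear[of K M N P f] by (auto simp: k_linear_def)

lemma tensor_induct [consumes 3, case_names tens add]:
  assumes t: "t \<in> carrier (tensor_product K M N)" "module K M" "module K N"
    and tens: "\<And>x y. \<lbrakk>x \<in> carrier M; y \<in> carrier N\<rbrakk> \<Longrightarrow> Q (tens K M N x y)"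
    and add: "\<And>s t. \<lbrakk>s \<in> carrier (tensor_product K M N); t \<in> carrier (tensor_product K M N); Q s; Q t\<rbrakk>
      \<Longrightarrow> Q (s \<oplus>\<^bsub>tensor_product K M N\<^esub> t)"
  shows "Q t"
  using module_pair.tensor_induct[of K M N t Q] assms by (simp add: module_pair_def)

lemma tensor_ext:
  assumes "module K M" "module K N" "module K P"
    and "k_linear K (tensor_product K M N) P f" "k_linear K (tensor_product K M N) P g"
    and "\<And>x y. \<lbrakk>x \<in> carrier M; y \<in> carrier N\<rbrakk> \<Longrightarrow> f (tens K M N x y) = g (tens K M N x y)"
    and "t \<in> carrier (tensor_product K M N)"
  shows "f t = g t"
  using assms(7,1,2) by (induction rule: tensor_induct) (use assms in \<open>auto simp: k_linear_add\<close>)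

text \<open>The rule that pushes linear maps into Sweedler sums; both sides are linear in \<open>t\<close> and agree on pure
  tensors.\<close>

lemma linear_tsum:
  assumes "module K M" "module K N" "module K P" "module K P'" "bilin K M N P f"
    and "k_linear K P P' \<phi>" "t \<in> carrier (tensor_product K M N)"
  shows "\<phi> (tsum M N P f t) = tsum M N P' (\<lambda>x y. \<phi> (f x y)) t"
proof -
  have b: "bilin K M N P' (\<lambda>x y. \<phi> (f x y))"
    using assms(5,6) by (auto simp: bilin_def intro: k_linear_comp)
  show ?thesis
    by (rule tensor_ext[of K M N P' "\<lambda>t. \<phi> (tsum M N P f t)"])
      (use assms b in \<open>auto intro: k_linear_comp tsum_linear\<close>)
qed

lemma tsum_tsum:
  assumes "module K A" "module K B" "module K M" "module K N" "module K P" 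
    and "bilin K A B P g" "bilin K M N (tensor_product K A B) f" "t \<in> carrier (tensor_product K M N)"
  shows "tsum A B P g (tsum M N (tensor_product K A B) f t) = tsum M N P (\<lambda>x y. tsum A B P g (f x y)) t"
  by (rule linear_tsum) (use assms in \<open>auto intro: tsum_linear\<close>)

lemma tsum_id [simp]:
  assumes "module K M" "module K N" "t \<in> carrier (tensor_product K M N)"
  shows "tsum M N (tensor_product K M N) (tens K M N) t = t"
  by (rule tensor_ext[of K M N "tensor_product K M N" _ "\<lambda>t. t"])
    (use assms in \<open>simp_all add: k_linear_id tsum_linear bilin_tens\<close>)

lemma tsum_add:
  assumes "module K M" "module K N" "module K P" "bilin K M N P f"
    "s \<in> carrier (tensor_product K M N)" "t \<in> carrier (tensor_product K M N)"
  shows "tsum M N P f (s \<oplus>\<^bsub>tensor_product K M N\<^esub> t) = tsum M N P f s \<oplus>\<^bsub>P\<^esub> tsum M N P f t"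
  by (rule k_linear_add[OF tsum_linear[OF assms(1-4)] assms(5,6)])

lemma module_smult: "\<lbrakk>module K M; a \<in> carrier K; x \<in> carrier M\<rbrakk> \<Longrightarrow> a \<odot>\<^bsub>M\<^esub> x \<in> carrier M"
  by (rule module.smult_closed)

lemma k_linear_plus:
  assumes "module K P" "k_linear K Q P f" "k_linear K Q P g"
  shows "k_linear K Q P (\<lambda>z. f z \<oplus>\<^bsub>P\<^esub> g z)"
proof -
  interpret P: module K P by fact
  show ?thesis
    using assms(2,3) by (auto simp: k_linear_def Pi_def P.M.a_ac P.smult_r_distr)
qed

lemma k_linear_smult_right:
  assumes "module K P" "k_linear K Q P f" "a \<in> carrier K"
  shows "k_linear K Q P (\<lambda>z. a \<odot>\<^bsub>P\<^esub> f z)"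
proof -
  interpret P: module K P by fact
  show ?thesis
    using assms(2,3)
    by (auto simp: k_linear_def Pi_def P.smult_r_distr P.smult_assoc1[symmetric] P.R.m_comm)
qed

lemma k_linear_cong:
  assumes "k_linear K Q P f" "module K Q" "\<And>x. x \<in> carrier Q \<Longrightarrow> f x = g x"
  shows "k_linear K Q P g"
proof -
  interpret Q: module K Q by fact
  show ?thesis using assms(1,3) by (auto simp: k_linear_def Pi_def)
qed

lemma k_linear_tsum_fun:
  assumes m: "module K M" "module K N" "module K P" "module K Q"
    and t: "t \<in> carrier (tensor_product K M N)"
    and f: "\<And>z. z \<in> carrier Q \<Longrightarrow> bilin K M N P (f z)"
      "\<And>x y. \<lbrakk>x \<in> carrier M; y \<in> carrier N\<rbrakk> \<Longrightarrow> k_linear K Q P (\<lambda>z. f z x y)"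
  shows "k_linear K Q P (\<lambda>z. tsum M N P (f z) t)"
  using t m(1,2)
proof (induction rule: tensor_induct)
  case (tens x y)
  show ?case
    by (rule k_linear_cong[OF f(2)[OF tens(1,2)]]) (use m f(1) tens in auto)
next
  case (add s t)
  show ?case
    by (rule k_linear_cong[OF k_linear_plus[OF m(3) add(3,4)]]) (use m f(1) add in \<open>auto simp: tsum_add\<close>)
qed

lemma tsum_swap:
  assumes m: "module K M" "module K N" "module K A" "module K B" "module K P"
    and t: "t \<in> carrier (tensor_product K M N)" "s \<in> carrier (tensor_product K A B)"
    and f: "\<And>a b. \<lbrakk>a \<in> carrier A; b \<in> carrier B\<rbrakk> \<Longrightarrow> bilin K M N P (\<lambda>x y. f x y a b)"
      "\<And>x y. \<lbrakk>x \<in> carrier M; y \<in> carrier N\<rbrakk> \<Longrightarrow> bilin K A B P (f x y)"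
  shows "tsum M N P (\<lambda>x y. tsum A B P (f x y) s) t = tsum A B P (\<lambda>a b. tsum M N P (\<lambda>x y. f x y a b) t) s"
proof -
  have b: "bilin K M N P (\<lambda>x y. tsum A B P (f x y) s)"
    using f m t by (auto simp: bilin_def intro!: k_linear_tsum_fun)
  have b': "bilin K A B P (\<lambda>a b. tsum M N P (\<lambda>x y. f x y a b) t)" if "t \<in> carrier (tensor_product K M N)" for t
    using f m that by (auto simp: bilin_def intro!: k_linear_tsum_fun)
  have l: "k_linear K (tensor_product K M N) P (\<lambda>t. tsum A B P (\<lambda>a b. tsum M N P (\<lambda>x y. f x y a b) t) s)"
    using f m t b' by (auto intro!: k_linear_tsum_fun tsum_linear)
  show ?thesis
    by (rule tensor_ext[OF m(1,2,5) tsum_linear[OF m(1,2,5) b] l _ t(1)]) (use b m f t in simp)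
qed

definition trilin where
  "trilin K A B C P f \<longleftrightarrow>
    (\<forall>a\<in>carrier A. bilin K B C P (f a)) \<and> (\<forall>c\<in>carrier C. bilin K A B P (\<lambda>a b. f a b c))"

text \<open>Sweedler expressions are linear in each variable. There is one rule for each position in which the
  variable can stand, and rewriting with these rules settles the linearity side conditions.\<close>

lemmas lin = k_linear_id k_linear_tens_left k_linear_tens_right k_linear_tsum_arg k_linear_tsum_fun
  k_linear_smult_right bilin_def trilin_def module_smult

section \<open>Hopf algebras\<close>

lemma sweedler2_eq_tsum:
  assumes "module K L" "comult L h \<in> carrier (tensor_product K L L)"
  shows "sweedler2 L P f h = tsum L L P f (comult L h)"
  using assms unfolding sweedler2_def by (intro tensor_lift_eq_tsum)

lemma tsum_smult:
  assumes "module K M" "module K N" "module K P" "bilin K M N P f"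
    "a \<in> carrier K" "t \<in> carrier (tensor_product K M N)"
  shows "tsum M N P (\<lambda>x y. a \<odot>\<^bsub>P\<^esub> f x y) t = a \<odot>\<^bsub>P\<^esub> tsum M N P f t"
  by (rule linear_tsum[where K=K, symmetric]) (use assms in \<open>simp_all add: lin\<close>)

context hopf_algebra
begin

abbreviation "LL \<equiv> tensor_product K L L"
abbreviation "\<Delta> \<equiv> comult L"
abbreviation "\<epsilon> \<equiv> counit L"
abbreviation "S \<equiv> antipode L"
abbreviation tensL (infixl \<open>\<otimes>\<otimes>\<close> 65) where "x \<otimes>\<otimes> y \<equiv> tens K L L x y"
abbreviation "sw P f h \<equiv> tsum L L P f (\<Delta> h)"

lemma module_L [simp]: "module K L"
  by (rule K_mod.module_axioms)

lemmas tsum_K = tsum_tsum[where K=K] tsum_smult[where K=K]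
lemmas tsum_in [simp] = tsum_closed[where K=K]

lemma \<Delta>_closed [simp]: "h \<in> carrier L \<Longrightarrow> \<Delta> h \<in> carrier LL"
  by (rule k_linear_closed[OF comult_linear])

lemma S_closed [simp]: "h \<in> carrier L \<Longrightarrow> S h \<in> carrier L"
  by (rule k_linear_closed[OF antipode_linear])

lemmas \<epsilon>_closed [simp] = counit_closed

lemma sweedler2_tsum: "h \<in> carrier L \<Longrightarrow> sweedler2 L P f h = sw P f h"
  by (rule sweedler2_eq_tsum[of K]) simp_all

lemma sweedler3_tsum:
  "h \<in> carrier L \<Longrightarrow> sweedler3 L P f h = sw P (\<lambda>u h3. sw P (\<lambda>h1 h2. f h1 h2 h3) u) h"
  unfolding sweedler3_def by (simp add: sweedler2_tsum)

lemma k_linear_mult_left: "\<lbrakk>k_linear K Q L f; c \<in> carrier L\<rbrakk> \<Longrightarrow> k_linear K Q L (\<lambda>z. f z \<otimes>\<^bsub>L\<^esub> c)"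
  by (auto simp: k_linear_def Pi_def L_ring.l_distr smult_mult_left)

lemma k_linear_mult_right: "\<lbrakk>k_linear K Q L f; c \<in> carrier L\<rbrakk> \<Longrightarrow> k_linear K Q L (\<lambda>z. c \<otimes>\<^bsub>L\<^esub> f z)"
  by (auto simp: k_linear_def Pi_def L_ring.r_distr smult_mult_right)

lemma k_linear_counit:
  assumes "module K P" "k_linear K Q L f" "x \<in> carrier P" 
  shows "k_linear K Q P (\<lambda>z. \<epsilon> (f z) \<odot>\<^bsub>P\<^esub> x)"
proof -
  interpret P: module K P by fact
  show ?thesis
    using assms(2,3) by (auto simp: k_linear_def Pi_def P.smult_l_distr P.smult_assoc1 counit_add counit_smult)
qed

lemmas hlin = lin k_linear_mult_left k_linear_mult_right k_linear_counit
  k_linear_comp[OF comult_linear] k_linear_comp[OF antipode_linear] comult_linear antipode_linear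

text \<open>Coassociativity is given for the universal trilinear expression \<open>h\<^sub>1 \<otimes> h\<^sub>2 \<otimes> h\<^sub>3\<close>; applying the linear
  map induced by \<open>f\<close> gives it for every trilinear \<open>f\<close>.\<close>

lemma sw_coassoc:
  assumes P: "module K P" and f: "trilin K L L L P f" and h: "h \<in> carrier L"
  shows "sw P (\<lambda>u c. sw P (\<lambda>a b. f a b c) u) h = sw P (\<lambda>a u. sw P (\<lambda>b c. f a b c) u) h"
proof -
  let ?T = "tensor_product K LL L"
  let ?\<phi> = "tsum LL L P (\<lambda>s c. tsum L L P (\<lambda>a b. f a b c) s)"
  have f': "bilin K LL L P (\<lambda>s c. tsum L L P (\<lambda>a b. f a b c) s)"
    using f P by (simp add: hlin)
  have \<phi>: "k_linear K ?T P ?\<phi>" using P f' by (intro tsum_linear) simp_all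
  have "?\<phi> (sw ?T (\<lambda>h1 h2. tens K LL L (\<Delta> h1) h2) h)
      = ?\<phi> (sw ?T (\<lambda>h1 h2. sw ?T (\<lambda>h21 h22. tens K LL L (h1 \<otimes>\<otimes> h21) h22) h2) h)"
    using coassoc[OF h] h by (simp add: sweedler2_tsum)
  moreover have "?\<phi> (sw ?T (\<lambda>h1 h2. tens K LL L (\<Delta> h1) h2) h) = sw P (\<lambda>u c. sw P (\<lambda>a b. f a b c) u) h"
    by (subst tsum_tsum) (use P f f' h in \<open>simp_all add: hlin\<close>)
  moreover have "?\<phi> (sw ?T (\<lambda>h1 h2. sw ?T (\<lambda>h21 h22. tens K LL L (h1 \<otimes>\<otimes> h21) h22) h2) h)
      = sw P (\<lambda>a u. sw P (\<lambda>b c. f a b c) u) h"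
    by (subst tsum_tsum)
      (use P f f' h in \<open>simp_all add: hlin tsum_tsum[where P=P]\<close>)
  ultimately show ?thesis by simp
qed

lemma sw_counit_left [simp]:
  assumes "module K P" "k_linear K L P f" "h \<in> carrier L"
  shows "sw P (\<lambda>a b. \<epsilon> a \<odot>\<^bsub>P\<^esub> f b) h = f h"
proof -
  have "f (sw L (\<lambda>a b. \<epsilon> a \<odot>\<^bsub>L\<^esub> b) h) = sw P (\<lambda>a b. f (\<epsilon> a \<odot>\<^bsub>L\<^esub> b)) h"
    by (rule linear_tsum[where K=K]) (use assms in \<open>simp_all add: hlin\<close>)
  also have "\<dots> = sw P (\<lambda>a b. \<epsilon> a \<odot>\<^bsub>P\<^esub> f b) h"
    using assms by (simp add: k_linear_smult)
  finally show ?thesis using counit_left assms by (simp add: sweedler2_tsum)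
qed

lemma sw_counit_right [simp]:
  assumes "module K P" "k_linear K L P f" "h \<in> carrier L"
  shows "sw P (\<lambda>a b. \<epsilon> b \<odot>\<^bsub>P\<^esub> f a) h = f h"
proof -
  have "f (sw L (\<lambda>a b. \<epsilon> b \<odot>\<^bsub>L\<^esub> a) h) = sw P (\<lambda>a b. f (\<epsilon> b \<odot>\<^bsub>L\<^esub> a)) h"
    by (rule linear_tsum[where K=K]) (use assms in \<open>simp_all add: hlin\<close>)
  also have "\<dots> = sw P (\<lambda>a b. \<epsilon> b \<odot>\<^bsub>P\<^esub> f a) h"
    using assms by (simp add: k_linear_smult)
  finally show ?thesis using counit_right assms by (simp add: sweedler2_tsum)
qed

lemma sw_antipode_left:
  assumes "module K P" "k_linear K L P f" "h \<in> carrier L"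
  shows "sw P (\<lambda>a b. f (S a \<otimes>\<^bsub>L\<^esub> b)) h = \<epsilon> h \<odot>\<^bsub>P\<^esub> f \<one>\<^bsub>L\<^esub>"
proof -
  have "f (sw L (\<lambda>a b. S a \<otimes>\<^bsub>L\<^esub> b) h) = sw P (\<lambda>a b. f (S a \<otimes>\<^bsub>L\<^esub> b)) h"
    by (rule linear_tsum[where K=K]) (use assms in \<open>simp_all add: hlin\<close>)
  then show ?thesis using antipode_left assms by (simp add: sweedler2_tsum k_linear_smult)
qed

lemma sw_antipode_right:
  assumes "module K P" "k_linear K L P f" "h \<in> carrier L"
  shows "sw P (\<lambda>a b. f (a \<otimes>\<^bsub>L\<^esub> S b)) h = \<epsilon> h \<odot>\<^bsub>P\<^esub> f \<one>\<^bsub>L\<^esub>"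
proof -
  have "f (sw L (\<lambda>a b. a \<otimes>\<^bsub>L\<^esub> S b) h) = sw P (\<lambda>a b. f (a \<otimes>\<^bsub>L\<^esub> S b)) h"
    by (rule linear_tsum[where K=K]) (use assms in \<open>simp_all add: hlin\<close>)
  then show ?thesis using antipode_right assms by (simp add: sweedler2_tsum k_linear_smult)
qed

lemma \<Delta>_mult:
  "\<lbrakk>g \<in> carrier L; h \<in> carrier L\<rbrakk> \<Longrightarrow>
     \<Delta> (g \<otimes>\<^bsub>L\<^esub> h) = sw LL (\<lambda>g1 g2. sw LL (\<lambda>h1 h2. (g1 \<otimes>\<^bsub>L\<^esub> h1) \<otimes>\<otimes> (g2 \<otimes>\<^bsub>L\<^esub> h2)) h) g"
  using comult_mult by (simp add: sweedler2_tsum)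

lemma sw_mult:
  assumes "module K P" "bilin K L L P f" "g \<in> carrier L" "h \<in> carrier L"
  shows "sw P f (g \<otimes>\<^bsub>L\<^esub> h) = sw P (\<lambda>g1 g2. sw P (\<lambda>h1 h2. f (g1 \<otimes>\<^bsub>L\<^esub> h1) (g2 \<otimes>\<^bsub>L\<^esub> h2)) h) g"
  unfolding \<Delta>_mult[OF assms(3,4)]
  by (subst tsum_tsum) (use assms in \<open>simp_all add: hlin tsum_tsum[where P=P]\<close>)

lemma sw_one:
  assumes "module K P" "bilin K L L P f"
  shows "sw P f \<one>\<^bsub>L\<^esub> = f \<one>\<^bsub>L\<^esub> \<one>\<^bsub>L\<^esub>"
  using assms by (simp add: comult_one)

lemma smult_one_L: "module K P \<Longrightarrow> x \<in> carrier P \<Longrightarrow> \<one>\<^bsub>K\<^esub> \<odot>\<^bsub>P\<^esub> x = x"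
  by (rule module.smult_one)

lemma S_one: "S \<one>\<^bsub>L\<^esub> = \<one>\<^bsub>L\<^esub>"
  using sw_antipode_left[of L "\<lambda>x. x" "\<one>\<^bsub>L\<^esub>"] 
  by (simp add: hlin comult_one counit_one smult_one_L)

text \<open>The two sides are two ways of contracting \<open>S(g\<^sub>1 h\<^sub>1) g\<^sub>2 h\<^sub>2 S(h\<^sub>3) S(g\<^sub>3)\<close>. Contracting \<open>h\<^sub>2 S(h\<^sub>3)\<close> and
  then \<open>g\<^sub>2 S(g\<^sub>3)\<close> leaves \<open>S(g h)\<close>; contracting \<open>S(g\<^sub>1 h\<^sub>1) g\<^sub>2 h\<^sub>2\<close> leaves \<open>S(h) S(g)\<close>.\<close>

lemma S_mult:
  assumes g: "g \<in> carrier L" and h: "h \<in> carrier L"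
  shows "S (g \<otimes>\<^bsub>L\<^esub> h) = S h \<otimes>\<^bsub>L\<^esub> S g"
proof -
  let ?X = "sw L (\<lambda>g1 u. sw L (\<lambda>g2 g3. sw L (\<lambda>h1 v. sw L (\<lambda>h2 h3.
      S (g1 \<otimes>\<^bsub>L\<^esub> h1) \<otimes>\<^bsub>L\<^esub> (g2 \<otimes>\<^bsub>L\<^esub> ((h2 \<otimes>\<^bsub>L\<^esub> S h3) \<otimes>\<^bsub>L\<^esub> S g3))) v) h) u) g"
  have A: "sw L (\<lambda>h2 h3. S (g1 \<otimes>\<^bsub>L\<^esub> h1) \<otimes>\<^bsub>L\<^esub> (g2 \<otimes>\<^bsub>L\<^esub> ((h2 \<otimes>\<^bsub>L\<^esub> S h3) \<otimes>\<^bsub>L\<^esub> S g3))) v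
      = \<epsilon> v \<odot>\<^bsub>L\<^esub> (S (g1 \<otimes>\<^bsub>L\<^esub> h1) \<otimes>\<^bsub>L\<^esub> (g2 \<otimes>\<^bsub>L\<^esub> S g3))"
    if "g1 \<in> carrier L" "g2 \<in> carrier L" "g3 \<in> carrier L" "h1 \<in> carrier L" "v \<in> carrier L" for g1 g2 g3 h1 v
    using that by (subst sw_antipode_right) (simp_all add: hlin)
  have A': "sw L (\<lambda>g2 g3. S (g1 \<otimes>\<^bsub>L\<^esub> h) \<otimes>\<^bsub>L\<^esub> (g2 \<otimes>\<^bsub>L\<^esub> S g3)) u = \<epsilon> u \<odot>\<^bsub>L\<^esub> S (g1 \<otimes>\<^bsub>L\<^esub> h)"
    if "g1 \<in> carrier L" "u \<in> carrier L" for g1 u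
    using that h by (subst sw_antipode_right[where f="\<lambda>x. S (g1 \<otimes>\<^bsub>L\<^esub> h) \<otimes>\<^bsub>L\<^esub> x"]) (simp_all add: hlin)
  have "?X = S (g \<otimes>\<^bsub>L\<^esub> h)"
    using g h by (simp add: A A' hlin)
  have B: "sw L (\<lambda>g1 g2. sw L (\<lambda>h1 h2. (S (g1 \<otimes>\<^bsub>L\<^esub> h1) \<otimes>\<^bsub>L\<^esub> (g2 \<otimes>\<^bsub>L\<^esub> h2)) \<otimes>\<^bsub>L\<^esub> c) v) u
      = \<epsilon> u \<odot>\<^bsub>L\<^esub> (\<epsilon> v \<odot>\<^bsub>L\<^esub> c)"
    if "u \<in> carrier L" "v \<in> carrier L" "c \<in> carrier L" for u v c
  proof -
    have "sw L (\<lambda>a b. (S a \<otimes>\<^bsub>L\<^esub> b) \<otimes>\<^bsub>L\<^esub> c) (u \<otimes>\<^bsub>L\<^esub> v) = \<epsilon> (u \<otimes>\<^bsub>L\<^esub> v) \<odot>\<^bsub>L\<^esub> c"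
      using that by (subst sw_antipode_left[where f="\<lambda>x. x \<otimes>\<^bsub>L\<^esub> c"]) (simp_all add: hlin)
    then show ?thesis
      using that by (simp add: sw_mult hlin counit_mult K_mod.smult_assoc1)
  qed
  have "?X = sw L (\<lambda>u g3. sw L (\<lambda>g1 g2. sw L (\<lambda>h1 v. sw L (\<lambda>h2 h3.
      S (g1 \<otimes>\<^bsub>L\<^esub> h1) \<otimes>\<^bsub>L\<^esub> (g2 \<otimes>\<^bsub>L\<^esub> ((h2 \<otimes>\<^bsub>L\<^esub> S h3) \<otimes>\<^bsub>L\<^esub> S g3))) v) h) u) g"
    by (rule sw_coassoc[symmetric]) (use g h in \<open>simp_all add: hlin\<close>)
  also have "\<dots> = sw L (\<lambda>u g3. sw L (\<lambda>g1 g2. sw L (\<lambda>v h3. sw L (\<lambda>h1 h2.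
      S (g1 \<otimes>\<^bsub>L\<^esub> h1) \<otimes>\<^bsub>L\<^esub> (g2 \<otimes>\<^bsub>L\<^esub> ((h2 \<otimes>\<^bsub>L\<^esub> S h3) \<otimes>\<^bsub>L\<^esub> S g3))) v) h) u) g"
    by (intro tsum_cong refl sw_coassoc[symmetric]) (use g h in \<open>simp_all add: hlin\<close>)
  also have "\<dots> = sw L (\<lambda>u g3. sw L (\<lambda>v h3. sw L (\<lambda>g1 g2. sw L (\<lambda>h1 h2.
      S (g1 \<otimes>\<^bsub>L\<^esub> h1) \<otimes>\<^bsub>L\<^esub> (g2 \<otimes>\<^bsub>L\<^esub> ((h2 \<otimes>\<^bsub>L\<^esub> S h3) \<otimes>\<^bsub>L\<^esub> S g3))) v) u) h) g"
    by (rule tsum_cong[OF refl], rule tsum_swap[where K=K]) (use g h in \<open>simp_all add: hlin\<close>)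
  also have "\<dots> = sw L (\<lambda>u g3. sw L (\<lambda>v h3. sw L (\<lambda>g1 g2. sw L (\<lambda>h1 h2.
      (S (g1 \<otimes>\<^bsub>L\<^esub> h1) \<otimes>\<^bsub>L\<^esub> (g2 \<otimes>\<^bsub>L\<^esub> h2)) \<otimes>\<^bsub>L\<^esub> (S h3 \<otimes>\<^bsub>L\<^esub> S g3)) v) u) h) g"
    using g h by (simp add: L_ring.m_assoc)
  also have "\<dots> = S h \<otimes>\<^bsub>L\<^esub> S g"
    using g h by (simp add: B hlin tsum_smult[where K=K])
  finally show ?thesis using \<open>?X = S (g \<otimes>\<^bsub>L\<^esub> h)\<close> by simp
qed


text \<open>The dual argument: the two sides are two ways of contracting
  \<open>\<Delta>(S h\<^sub>1) (h\<^sub>2 \<otimes> h\<^sub>3) (S h\<^sub>5 \<otimes> S h\<^sub>4)\<close> in the algebra \<open>L \<otimes> L\<close>: the product of the last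
  two factors contracts from the inside, and that of the first two through \<open>\<Delta>(S h\<^sub>1) \<Delta>(h\<^sub>2) = \<Delta>(S(h\<^sub>1) h\<^sub>2)\<close>.\<close>

lemma \<Delta>_S:
  assumes h: "h \<in> carrier L"
  shows "\<Delta> (S h) = sw LL (\<lambda>a b. S b \<otimes>\<otimes> S a) h"
proof -
  let ?E = "\<lambda>a b c d e. tsum L L LL (\<lambda>p q. (p \<otimes>\<^bsub>L\<^esub> (b \<otimes>\<^bsub>L\<^esub> S e)) \<otimes>\<otimes> (q \<otimes>\<^bsub>L\<^esub> (c \<otimes>\<^bsub>L\<^esub> S d))) (\<Delta> (S a))"
  let ?X = "sw LL (\<lambda>a u. sw LL (\<lambda>b v. sw LL (\<lambda>c w. sw LL (\<lambda>d e. ?E a b c d e) w) v) u) h"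
  have A1: "sw LL (\<lambda>c d. ?E a b c d e) w = \<epsilon> w \<odot>\<^bsub>LL\<^esub> tsum L L LL (\<lambda>p q. (p \<otimes>\<^bsub>L\<^esub> (b \<otimes>\<^bsub>L\<^esub> S e)) \<otimes>\<otimes> q) (\<Delta> (S a))"
    if "a \<in> carrier L" "b \<in> carrier L" "e \<in> carrier L" "w \<in> carrier L" for a b e w
    using that
    by (subst sw_antipode_right[where f="\<lambda>x. tsum L L LL (\<lambda>p q. (p \<otimes>\<^bsub>L\<^esub> (b \<otimes>\<^bsub>L\<^esub> S e)) \<otimes>\<otimes> (q \<otimes>\<^bsub>L\<^esub> x)) (\<Delta> (S a))"])
      (simp_all add: hlin)
  have A2: "sw LL (\<lambda>b e. tsum L L LL (\<lambda>p q. (p \<otimes>\<^bsub>L\<^esub> (b \<otimes>\<^bsub>L\<^esub> S e)) \<otimes>\<otimes> q) (\<Delta> (S a))) u = \<epsilon> u \<odot>\<^bsub>LL\<^esub> \<Delta> (S a)"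
    if "a \<in> carrier L" "u \<in> carrier L" for a u
    using that
    by (subst sw_antipode_right[where f="\<lambda>x. tsum L L LL (\<lambda>p q. (p \<otimes>\<^bsub>L\<^esub> x) \<otimes>\<otimes> q) (\<Delta> (S a))"])
      (simp_all add: hlin)
  have "?X = sw LL (\<lambda>a u. sw LL (\<lambda>b v. sw LL (\<lambda>w e. sw LL (\<lambda>c d. ?E a b c d e) w) v) u) h"
    by (rule tsum_cong[OF refl], rule tsum_cong[OF refl], rule sw_coassoc[symmetric]) (use h in \<open>simp_all add: hlin\<close>)
  also have "\<dots> = \<Delta> (S h)"
    using h by (simp add: A1 A2 hlin)
  finally have X: "?X = \<Delta> (S h)" .
  have B1: "sw LL (\<lambda>b c. ?E a b c d e) x = tsum L L LL (\<lambda>r s. (r \<otimes>\<^bsub>L\<^esub> S e) \<otimes>\<otimes> (s \<otimes>\<^bsub>L\<^esub> S d)) (\<Delta> (S a \<otimes>\<^bsub>L\<^esub> x))"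
    if "a \<in> carrier L" "d \<in> carrier L" "e \<in> carrier L" "x \<in> carrier L" for a d e x
    using that by (simp add: sw_mult hlin L_ring.m_assoc) (rule tsum_swap[where K=K], simp_all add: hlin)
  have B2: "sw LL (\<lambda>a x. sw LL (\<lambda>b c. sw LL (\<lambda>d e. ?E a b c d e) w) x) y = \<epsilon> y \<odot>\<^bsub>LL\<^esub> sw LL (\<lambda>d e. S e \<otimes>\<otimes> S d) w"
    if "w \<in> carrier L" "y \<in> carrier L" for w y
  proof -
    have "sw LL (\<lambda>a x. sw LL (\<lambda>b c. sw LL (\<lambda>d e. ?E a b c d e) w) x) y = 
      sw LL (\<lambda>a x. sw LL (\<lambda>d e. sw LL (\<lambda>b c. ?E a b c d e) x) w) y"
      by (rule tsum_cong[OF refl], rule tsum_swap[where K=K]) (use that in \<open>simp_all add: hlin\<close>)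
    also have "\<dots> = sw LL (\<lambda>a x. sw LL (\<lambda>d e. tsum L L LL (\<lambda>r s. (r \<otimes>\<^bsub>L\<^esub> S e) \<otimes>\<otimes> (s \<otimes>\<^bsub>L\<^esub> S d)) (\<Delta> (S a \<otimes>\<^bsub>L\<^esub> x))) w) y"
      using that by (simp add: B1)
    also have "\<dots> = \<epsilon> y \<odot>\<^bsub>LL\<^esub> sw LL (\<lambda>d e. S e \<otimes>\<otimes> S d) w"
      using that
      by (subst sw_antipode_left[where f="\<lambda>z. sw LL (\<lambda>d e. tsum L L LL (\<lambda>r s. (r \<otimes>\<^bsub>L\<^esub> S e) \<otimes>\<otimes> (s \<otimes>\<^bsub>L\<^esub> S d)) (\<Delta> z)) w"])
       (simp_all add: hlin comult_one)
    finally show ?thesis .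
  qed
  have "?X = sw LL (\<lambda>a u. sw LL (\<lambda>x w. sw LL (\<lambda>b c. sw LL (\<lambda>d e. ?E a b c d e) w) x) u) h"
    by (rule tsum_cong[OF refl], rule sw_coassoc[symmetric]) (use h in \<open>simp_all add: hlin\<close>)
  also have "\<dots> = sw LL (\<lambda>y w. sw LL (\<lambda>a x. sw LL (\<lambda>b c. sw LL (\<lambda>d e. ?E a b c d e) w) x) y) h"
    by (rule sw_coassoc[symmetric]) (use h in \<open>simp_all add: hlin\<close>)
  also have "\<dots> = sw LL (\<lambda>a b. S b \<otimes>\<otimes> S a) h"
    using h by (simp add: B2 hlin)
  finally show ?thesis using X by simp
qed

lemma counit_S:
  assumes h: "h \<in> carrier L" shows "\<epsilon> (S h) = \<epsilon> h"
proof -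
  \<comment> \<open>Sums over tensors take values in modules, so the computation is done for \<open>\<epsilon>(x) 1 \<in> L\<close>, from which
    \<open>\<epsilon>\<close> recovers the scalar.\<close>
  have inv: "\<epsilon> (\<epsilon> x \<odot>\<^bsub>L\<^esub> \<one>\<^bsub>L\<^esub>) = \<epsilon> x" if "x \<in> carrier L" for x
    using that by (simp add: counit_smult counit_one)
  have "\<epsilon> (S h) \<odot>\<^bsub>L\<^esub> \<one>\<^bsub>L\<^esub> = sw L (\<lambda>a b. \<epsilon> b \<odot>\<^bsub>L\<^esub> (\<epsilon> (S a) \<odot>\<^bsub>L\<^esub> \<one>\<^bsub>L\<^esub>)) h"
    using h by (simp add: hlin)
  also have "\<dots> = sw L (\<lambda>a b. \<epsilon> (S a \<otimes>\<^bsub>L\<^esub> b) \<odot>\<^bsub>L\<^esub> \<one>\<^bsub>L\<^esub>) h"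
    using h by (simp add: counit_mult K_mod.smult_assoc1[symmetric] K_mod.R.m_comm)
  also have "\<dots> = \<epsilon> h \<odot>\<^bsub>L\<^esub> \<one>\<^bsub>L\<^esub>"
    using h by (subst sw_antipode_left[where f="\<lambda>x. \<epsilon> x \<odot>\<^bsub>L\<^esub> \<one>\<^bsub>L\<^esub>"]) (simp_all add: hlin counit_one smult_one_L)
  finally show ?thesis using inv h by (metis S_closed)
qed

section \<open>The entwining map\<close>

text \<open>The entwining \<open>g \<otimes> h \<mapsto> h\<^sub>2 \<otimes> S(h\<^sub>1) g h\<^sub>3\<close>. In terms of it a Yetter-Drinfeld module is a module and
  comodule with \<open>\<rho>(m h) = \<Sum> m\<^sub>0 p \<otimes> q\<close>, where \<open>p \<otimes> q\<close> is the value at \<open>m\<^sub>1 \<otimes> h\<close>. The lemmas of this section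
  say that it is compatible with unit, counit, comultiplication and multiplication; they are all that
  the rest of the proof uses about the antipode.\<close>

definition twist where
  "twist g h = sw LL (\<lambda>u h3. sw LL (\<lambda>h1 h2. h2 \<otimes>\<otimes> (S h1 \<otimes>\<^bsub>L\<^esub> g \<otimes>\<^bsub>L\<^esub> h3)) u) h"

lemma bilin_twist: "bilin K L L LL twist"
  unfolding twist_def[abs_def] by (simp add: hlin)

lemma k_linear_twist:
  "\<lbrakk>k_linear K Q L f; h \<in> carrier L\<rbrakk> \<Longrightarrow> k_linear K Q LL (\<lambda>z. twist (f z) h)"
  "\<lbrakk>k_linear K Q L f; g \<in> carrier L\<rbrakk> \<Longrightarrow> k_linear K Q LL (\<lambda>z. twist g (f z))"
  using bilin_twist by (auto simp: bilin_def intro: k_linear_comp[of K L])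

lemma twist_closed [simp]: "\<lbrakk>g \<in> carrier L; h \<in> carrier L\<rbrakk> \<Longrightarrow> twist g h \<in> carrier LL"
  by (simp add: twist_def hlin)

lemma twist_one: "g \<in> carrier L \<Longrightarrow> twist g \<one>\<^bsub>L\<^esub> = \<one>\<^bsub>L\<^esub> \<otimes>\<otimes> g"
  by (simp add: twist_def sw_one S_one hlin)

lemma tsum_twist:
  assumes "module K P" "bilin K L L P f" "g \<in> carrier L" "h \<in> carrier L"
  shows "tsum L L P f (twist g h) = sw P (\<lambda>u h3. sw P (\<lambda>h1 h2. f h2 (S h1 \<otimes>\<^bsub>L\<^esub> g \<otimes>\<^bsub>L\<^esub> h3)) u) h"
  unfolding twist_def
  by (subst tsum_tsum[where K=K]) (use assms in \<open>simp_all add: hlin tsum_tsum[where K=K]\<close>)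

lemma twist_counit:
  assumes "module K P" "k_linear K L P f" "g \<in> carrier L" "h \<in> carrier L"
  shows "tsum L L P (\<lambda>p q. \<epsilon> q \<odot>\<^bsub>P\<^esub> f p) (twist g h) = \<epsilon> g \<odot>\<^bsub>P\<^esub> f h"
proof -
  have r: "\<epsilon> (S a \<otimes>\<^bsub>L\<^esub> g \<otimes>\<^bsub>L\<^esub> c) \<odot>\<^bsub>P\<^esub> f b = \<epsilon> c \<odot>\<^bsub>P\<^esub> (\<epsilon> g \<odot>\<^bsub>P\<^esub> (\<epsilon> a \<odot>\<^bsub>P\<^esub> f b))"
    if "a \<in> carrier L" "b \<in> carrier L" "c \<in> carrier L" for a b c
  proof -
    interpret P: module K P by fact
    show ?thesis using that assms k_linear_closed[OF assms(2)]
      by (simp add: counit_mult counit_S P.smult_assoc1[symmetric] K_mod.R.m_ac)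
  qed
  show ?thesis
    using assms
    by (simp add: tsum_twist hlin k_linear_comp[OF assms(2)] k_linear_closed[OF assms(2)] r tsum_smult[where K=K])
qed


text \<open>Compatibility with the comultiplication of the first argument. Both sides are
  \<open>h\<^sub>3 \<otimes> S(h\<^sub>2) g\<^sub>1 h\<^sub>4 \<otimes> S(h\<^sub>1) g\<^sub>2 h\<^sub>5\<close>, on the left because \<open>\<Delta>(S h) = S h\<^sub>2 \<otimes> S h\<^sub>1\<close>; what remains is to
  bring two bracketings of the fivefold comultiplication together.\<close>

lemma sw_twist:
  assumes "module K P" "trilin K L L L P f" "g \<in> carrier L" "h \<in> carrier L"
  shows "tsum L L P (\<lambda>p q. sw P (\<lambda>q1 q2. f p q1 q2) q) (twist g h) =
    sw P (\<lambda>g1 g2. tsum L L P (\<lambda>p q. tsum L L P (\<lambda>p' q'. f p' q' q) (twist g1 p)) (twist g2 h)) g"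
proof -
  note P = assms(1)
  have f: "\<And>x y. \<lbrakk>x \<in> carrier L; y \<in> carrier L\<rbrakk> \<Longrightarrow> k_linear K L P (\<lambda>z. f x y z)"
    "\<And>x y. \<lbrakk>x \<in> carrier L; y \<in> carrier L\<rbrakk> \<Longrightarrow> k_linear K L P (\<lambda>z. f x z y)"
    "\<And>x y. \<lbrakk>x \<in> carrier L; y \<in> carrier L\<rbrakk> \<Longrightarrow> k_linear K L P (\<lambda>z. f z x y)"
    using assms(2) by (auto simp: trilin_def bilin_def)
  note f' = f[THEN k_linear_comp]
  let ?G = "\<lambda>g1 g2 d e b c c'. f b (S e \<otimes>\<^bsub>L\<^esub> g1 \<otimes>\<^bsub>L\<^esub> c) (S d \<otimes>\<^bsub>L\<^esub> g2 \<otimes>\<^bsub>L\<^esub> c')"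
  have "tsum L L P (\<lambda>p q. sw P (\<lambda>q1 q2. f p q1 q2) q) (twist g h) =
     sw P (\<lambda>u c. sw P (\<lambda>a b. sw P (\<lambda>q1 q2. f b q1 q2) (S a \<otimes>\<^bsub>L\<^esub> g \<otimes>\<^bsub>L\<^esub> c)) u) h"
    using assms by (simp add: tsum_twist hlin f f')
  also have "\<dots> = sw P (\<lambda>u c. sw P (\<lambda>a b. sw P (\<lambda>d e. sw P (\<lambda>g1 g2. sw P (\<lambda>c1 c2.
      ?G g1 g2 d e b c1 c2) c) g) a) u) h"
    using assms by (simp add: sw_mult \<Delta>_S tsum_K hlin f f')
  also have "\<dots> = sw P (\<lambda>u c. sw P (\<lambda>d w. sw P (\<lambda>e b. sw P (\<lambda>g1 g2. sw P (\<lambda>c1 c2.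
      ?G g1 g2 d e b c1 c2) c) g) w) u) h"
    by (rule tsum_cong[OF refl], rule sw_coassoc) (use assms in \<open>simp_all add: hlin f f'\<close>)
  also have "\<dots> = sw P (\<lambda>u c. sw P (\<lambda>d w. sw P (\<lambda>g1 g2. sw P (\<lambda>e b. sw P (\<lambda>c1 c2.
      ?G g1 g2 d e b c1 c2) c) w) g) u) h"
    by (rule tsum_cong[OF refl], rule tsum_cong[OF refl], rule tsum_swap[where K=K]) (use assms in \<open>simp_all add: hlin f f'\<close>)
  also have "\<dots> = sw P (\<lambda>u c. sw P (\<lambda>g1 g2. sw P (\<lambda>d w. sw P (\<lambda>e b. sw P (\<lambda>c1 c2.
      ?G g1 g2 d e b c1 c2) c) w) u) g) h"
    by (rule tsum_cong[OF refl], rule tsum_swap[where K=K]) (use assms in \<open>simp_all add: hlin f f'\<close>)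
  also have "\<dots> = sw P (\<lambda>g1 g2. sw P (\<lambda>u c. sw P (\<lambda>d w. sw P (\<lambda>e b. sw P (\<lambda>c1 c2.
      ?G g1 g2 d e b c1 c2) c) w) u) h) g"
    by (rule tsum_swap[where K=K]) (use assms in \<open>simp_all add: hlin f f'\<close>)
  also have "\<dots> = sw P (\<lambda>g1 g2. sw P (\<lambda>u z. sw P (\<lambda>d w. sw P (\<lambda>v c1. sw P (\<lambda>e b.
      ?G g1 g2 d e b c1 z) v) w) u) h) g"
  proof (rule tsum_cong[OF refl])
    fix g1 g2 assume g12: "g1 \<in> carrier L" "g2 \<in> carrier L"
    have "sw P (\<lambda>u c. sw P (\<lambda>d w. sw P (\<lambda>e b. sw P (\<lambda>c1 c2. ?G g1 g2 d e b c1 c2) c) w) u) h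
      = sw P (\<lambda>u c. sw P (\<lambda>d w. sw P (\<lambda>c1 c2. sw P (\<lambda>e b. ?G g1 g2 d e b c1 c2) w) c) u) h"
      by (rule tsum_cong[OF refl], rule tsum_cong[OF refl], rule tsum_swap[where K=K]) (use assms g12 in \<open>simp_all add: hlin f f'\<close>)
    also have "\<dots> = sw P (\<lambda>u c. sw P (\<lambda>c1 c2. sw P (\<lambda>d w. sw P (\<lambda>e b. ?G g1 g2 d e b c1 c2) w) u) c) h"
      by (rule tsum_cong[OF refl], rule tsum_swap[where K=K]) (use assms g12 in \<open>simp_all add: hlin f f'\<close>)
    also have "\<dots> = sw P (\<lambda>v c2. sw P (\<lambda>u c1. sw P (\<lambda>d w. sw P (\<lambda>e b. ?G g1 g2 d e b c1 c2) w) u) v) h"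
      by (rule sw_coassoc[symmetric]) (use assms g12 in \<open>simp_all add: hlin f f'\<close>)
    also have "\<dots> = sw P (\<lambda>v c2. sw P (\<lambda>d w. sw P (\<lambda>w' c1. sw P (\<lambda>e b. ?G g1 g2 d e b c1 c2) w') w) v) h"
      by (rule tsum_cong[OF refl], rule sw_coassoc) (use assms g12 in \<open>simp_all add: hlin f f'\<close>)
    finally show "sw P (\<lambda>u c. sw P (\<lambda>d w. sw P (\<lambda>e b. sw P (\<lambda>c1 c2. ?G g1 g2 d e b c1 c2) c) w) u) h
      = sw P (\<lambda>u z. sw P (\<lambda>d w. sw P (\<lambda>v c1. sw P (\<lambda>e b. ?G g1 g2 d e b c1 z) v) w) u) h" .
  qed
  also have "\<dots> = sw P (\<lambda>g1 g2. tsum L L P (\<lambda>p q. tsum L L P (\<lambda>p' q'. f p' q' q) (twist g1 p)) (twist g2 h)) g"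
    using assms by (simp add: tsum_twist hlin f f' k_linear_twist)
  finally show ?thesis .
qed

text \<open>Compatibility with the multiplication of the second argument: both sides are
  \<open>h\<^sub>2 h'\<^sub>2 \<otimes> S(h'\<^sub>1) S(h\<^sub>1) g h\<^sub>3 h'\<^sub>3\<close>.\<close>

lemma twist_mult:
  assumes "g \<in> carrier L" "h \<in> carrier L" "h' \<in> carrier L"
  shows "twist g (h \<otimes>\<^bsub>L\<^esub> h') =
    tsum L L LL (\<lambda>p q. tsum L L LL (\<lambda>p' q'. (p \<otimes>\<^bsub>L\<^esub> p') \<otimes>\<otimes> q') (twist q h')) (twist g h)"
proof -
  let ?F = "\<lambda>a b c a' b' c'. (b \<otimes>\<^bsub>L\<^esub> b') \<otimes>\<otimes> (S a' \<otimes>\<^bsub>L\<^esub> (S a \<otimes>\<^bsub>L\<^esub> g \<otimes>\<^bsub>L\<^esub> c) \<otimes>\<^bsub>L\<^esub> c')"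
  have "twist g (h \<otimes>\<^bsub>L\<^esub> h') = sw LL (\<lambda>u c. sw LL (\<lambda>u' c'. sw LL (\<lambda>a b. sw LL (\<lambda>a' b'. ?F a b c a' b' c') u') u) h') h"
    unfolding twist_def using assms by (simp add: sw_mult hlin S_mult L_ring.m_assoc)
  also have "\<dots> = sw LL (\<lambda>u c. sw LL (\<lambda>a b. sw LL (\<lambda>u' c'. sw LL (\<lambda>a' b'. ?F a b c a' b' c') u') h') u) h"
    by (rule tsum_cong[OF refl], rule tsum_swap[where K=K]) (use assms in \<open>simp_all add: hlin\<close>)
  also have "\<dots> = tsum L L LL (\<lambda>p q. tsum L L LL (\<lambda>p' q'. (p \<otimes>\<^bsub>L\<^esub> p') \<otimes>\<otimes> q') (twist q h')) (twist g h)"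
    using assms by (simp add: tsum_twist hlin k_linear_twist)
  finally show ?thesis .
qed

end

section \<open>Modules, comodules and Yetter-Drinfeld modules through the entwining map\<close>

lemma bilin_left: "\<lbrakk>bilin K M N P f; k_linear K Q M g; y \<in> carrier N\<rbrakk> \<Longrightarrow> k_linear K Q P (\<lambda>z. f (g z) y)"
  by (auto simp: bilin_def intro: k_linear_comp[of K M])

lemma bilin_right: "\<lbrakk>bilin K M N P f; k_linear K Q N g; x \<in> carrier M\<rbrakk> \<Longrightarrow> k_linear K Q P (\<lambda>z. f x (g z))"
  by (auto simp: bilin_def intro: k_linear_comp[of K N])

lemma bilin_closed: "\<lbrakk>bilin K M N P f; x \<in> carrier M; y \<in> carrier N\<rbrakk> \<Longrightarrow> f x y \<in> carrier P"
  by (auto simp: bilin_def k_linear_def)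

lemma forget_simps [simp]:
  "carrier (forget_action M) = carrier M" "ring.add (forget_action M) = ring.add M"
  "ring.zero (forget_action M) = ring.zero M" "smult (forget_action M) = smult M"
  "coact (forget_action M) = yd_coact M"
  "carrier (forget_coaction M) = carrier M" "ring.add (forget_coaction M) = ring.add M"
  "ring.zero (forget_coaction M) = ring.zero M" "smult (forget_coaction M) = smult M"
  "ract (forget_coaction M) = ract M"
  by (simp_all add: forget_action_def forget_coaction_def rmod.defs)

text \<open>A Yetter-Drinfeld module and its images under the forgetful functors are records of different types
  with the same underlying \<open>K\<close>-module, and all linear notions can be exchanged between them.\<close>

definition same_module where
  "same_module M' M \<longleftrightarrow> carrier M' = carrier M \<and> ring.add M' = ring.add M \<and>
     ring.zero M' = ring.zero M \<and> smult M' = smult M"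

lemma same_module_forget [simp]:
  "same_module (forget_action M) M" "same_module (forget_coaction M) M"
  by (simp_all add: same_module_def)

lemma same_tensor:
  assumes "same_module M' M"
  shows "tensor_product K M' N = tensor_product K M N" "tens K M' N x y = tens K M N x y"
  using assms
  by (simp_all add: same_module_def tensor_product_def tens_def tensor_null_def tensor_relations_def pairs_group_def)

lemma same_k_linear:
  assumes "same_module M' M"
  shows "k_linear K M' N f = k_linear K M N f" "k_linear K Q M' g = k_linear K Q M g"
  using assms by (simp_all add: k_linear_def same_module_def)

lemma same_module_module:
  assumes "same_module M' M"
  shows "module K M' = module K M"
proof -
  have "abelian_group M' = abelian_group M"
    using assms
    unfolding same_module_def abelian_group_def abelian_group_axioms_def abelian_monoid_def comm_group_def
      comm_monoid_def comm_monoid_axioms_def group_def group_axioms_def Units_def monoid_def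
    by simp
  then show ?thesis
    using assms by (simp add: module_def module_axioms_def same_module_def)
qed

lemma same_tsum:
  assumes "same_module M' M"
  shows "tsum A B M' f s = tsum A B M f s" "tsum M' C N g t = tsum M C N g t"
proof -
  note assms = assms[unfolded same_module_def]
  have f: "finsum M' = finsum M"
    by (simp add: fun_eq_iff finsum_def finprod_def assms)
  have p: "add_pow M' (k::int) x = add_pow M k x" for k x
    unfolding add_pow_def int_pow_def nat_pow_def m_inv_def Let_def by (simp add: assms)
  show "tsum A B M' f s = tsum A B M f s"
    unfolding tsum_def tensor_lift_def Let_def f by (simp add: p)
  show "tsum M' C N g t = tsum M C N g t" by (simp add: tsum_def assms)
qed

lemmas same_simps = same_tensor same_k_linear same_module_module same_tsum

context hopf_algebra
begin

text \<open>Action and coaction are taken as separate arguments, so that the three kinds of records are treated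
  alike.\<close>

definition rmodule where
  "rmodule M act \<longleftrightarrow> module K M \<and> bilin K M L M act \<and>
    (\<forall>m\<in>carrier M. \<forall>g\<in>carrier L. \<forall>h\<in>carrier L. act (act m g) h = act m (g \<otimes>\<^bsub>L\<^esub> h)) \<and>
    (\<forall>m\<in>carrier M. act m \<one>\<^bsub>L\<^esub> = m)"

definition comodule where
  "comodule M \<rho> \<longleftrightarrow> module K M \<and> k_linear K M (tensor_product K M L) \<rho> \<and>
    (\<forall>m\<in>carrier M.
      tsum M L (tensor_product K (tensor_product K M L) L)
        (\<lambda>x y. tens K (tensor_product K M L) L (\<rho> x) y) (\<rho> m) =
      tsum M L (tensor_product K (tensor_product K M L) L)
        (\<lambda>x y. sw (tensor_product K (tensor_product K M L) L)
          (\<lambda>a b. tens K (tensor_product K M L) L (tens K M L x a) b) y) (\<rho> m)) \<and>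
    (\<forall>m\<in>carrier M. tsum M L M (\<lambda>x y. \<epsilon> y \<odot>\<^bsub>M\<^esub> x) (\<rho> m) = m)"

definition yd where
  "yd M act \<rho> \<longleftrightarrow> rmodule M act \<and> comodule M \<rho> \<and>
    (\<forall>m\<in>carrier M. \<forall>h\<in>carrier L.
      \<rho> (act m h) = tsum M L (tensor_product K M L)
        (\<lambda>x y. tsum L L (tensor_product K M L) (\<lambda>p q. tens K M L (act x p) q) (twist y h)) (\<rho> m))"

definition act_map where
  "act_map M a N b f \<longleftrightarrow> k_linear K M N f \<and> (\<forall>m\<in>carrier M. \<forall>h\<in>carrier L. f (a m h) = b (f m) h)"

definition coact_map where
  "coact_map M \<rho> N \<sigma> f \<longleftrightarrow> k_linear K M N f \<and>
    (\<forall>m\<in>carrier M. \<sigma> (f m) = tsum M L (tensor_product K N L) (\<lambda>x y. tens K N L (f x) y) (\<rho> m))"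

lemma right_module_iff: "right_module K L M \<longleftrightarrow> rmodule M (ract M)"
  by (auto simp: right_module_def rmodule_def bilin_def k_linear_def)

lemma right_comodule_iff: "right_comodule K L M \<longleftrightarrow> comodule M (coact M)"
proof -
  have "coact M m \<in> carrier (tensor_product K M L)"
    if "k_linear K M (tensor_product K M L) (coact M)" "m \<in> carrier M" for m
    using that by (rule k_linear_closed)
  then show ?thesis
    unfolding right_comodule_def comodule_def
    by (auto simp: tensor_lift_eq_tsum[of K M L] sweedler2_tsum)
qed

lemma same_comodule:
  assumes "same_module M' M" shows "comodule M' \<rho> \<longleftrightarrow> comodule M \<rho>"
proof -
  have "carrier M' = carrier M" "smult M' = smult M" using assms by (simp_all add: same_module_def)
  then show ?thesis unfolding comodule_def same_simps[OF assms] by simp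
qed

lemma same_rmodule:
  assumes "same_module M' M" shows "rmodule M' a \<longleftrightarrow> rmodule M a"
proof -
  have "carrier M' = carrier M" using assms by (simp add: same_module_def)
  then show ?thesis unfolding rmodule_def bilin_def same_simps[OF assms] by simp
qed

lemma same_yd:
  assumes "same_module M' M" shows "yd M' a \<rho> \<longleftrightarrow> yd M a \<rho>"
proof -
  have "carrier M' = carrier M" using assms by (simp add: same_module_def)
  then show ?thesis
    unfolding yd_def same_simps[OF assms] same_comodule[OF assms] same_rmodule[OF assms] by simp
qed

lemma same_coact_map:
  assumes "same_module M' M" "same_module N' N"
  shows "coact_map M' \<rho> N' \<sigma> f \<longleftrightarrow> coact_map M \<rho> N \<sigma> f"
proof -
  have "carrier M' = carrier M" using assms by (simp add: same_module_def)
  then show ?thesis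
    unfolding coact_map_def same_simps[OF assms(1)] same_simps[OF assms(2)] by simp
qed

lemma same_act_map:
  assumes "same_module M' M" "same_module N' N"
  shows "act_map M' a N' b f \<longleftrightarrow> act_map M a N b f"
proof -
  have "carrier M' = carrier M" using assms by (simp add: same_module_def)
  then show ?thesis
    unfolding act_map_def same_simps[OF assms(1)] same_simps[OF assms(2)] by simp
qed

lemmas same_iff = same_comodule same_rmodule same_yd same_coact_map same_act_map

lemma L_linear_iff: "L_linear K L M N f \<longleftrightarrow> act_map M (ract M) N (ract N) f"
  by (auto simp: L_linear_def act_map_def)

lemma colinear_iff: "right_comodule K L M \<Longrightarrow> colinear K L M N f \<longleftrightarrow> coact_map M (coact M) N (coact N) f"
proof -
  assume "right_comodule K L M"
  then have "module K M" "\<And>m. m \<in> carrier M \<Longrightarrow> coact M m \<in> carrier (tensor_product K M L)"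
    by (auto simp: right_comodule_def k_linear_closed)
  then show ?thesis
    unfolding colinear_def coact_map_def
    by (auto simp: tensor_lift_eq_tsum[of K M L])
qed

lemma yetter_drinfeld_iff: "yetter_drinfeld K L M \<longleftrightarrow> yd M (ract M) (yd_coact M)"
proof (cases "right_module K L (forget_coaction M) \<and> right_comodule K L (forget_action M)")
  case True
  then have 1: "rmodule M (ract M)" "comodule M (yd_coact M)"
    by (simp_all add: right_module_iff right_comodule_iff same_iff[OF same_module_forget(1)] same_iff[OF same_module_forget(2)])
  then have m: "module K M" and \<rho>: "\<And>m. m \<in> carrier M \<Longrightarrow> yd_coact M m \<in> carrier (tensor_product K M L)"
    and a: "bilin K M L M (ract M)"
    by (auto simp: rmodule_def comodule_def k_linear_closed)
  show ?thesis
    unfolding yetter_drinfeld_def yd_def using True 1 m \<rho>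
    by (simp add: tensor_lift_eq_tsum[of K M L] sweedler3_tsum tsum_twist hlin bilin_left[OF a] bilin_right[OF a] bilin_closed[OF a])
next
  case False
  then show ?thesis
    by (auto simp: yetter_drinfeld_def yd_def right_module_iff right_comodule_iff
        same_iff[OF same_module_forget(1)] same_iff[OF same_module_forget(2)])
qed

lemma rmoduleD:
  assumes "rmodule M act"
  shows "module K M" "bilin K M L M act" "\<And>m h. \<lbrakk>m \<in> carrier M; h \<in> carrier L\<rbrakk> \<Longrightarrow> act m h \<in> carrier M"
    "\<And>m g h. \<lbrakk>m \<in> carrier M; g \<in> carrier L; h \<in> carrier L\<rbrakk> \<Longrightarrow> act (act m g) h = act m (g \<otimes>\<^bsub>L\<^esub> h)"
    "\<And>m. m \<in> carrier M \<Longrightarrow> act m \<one>\<^bsub>L\<^esub> = m"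
    "\<And>Q f h. \<lbrakk>k_linear K Q M f; h \<in> carrier L\<rbrakk> \<Longrightarrow> k_linear K Q M (\<lambda>z. act (f z) h)"
    "\<And>Q f m. \<lbrakk>k_linear K Q L f; m \<in> carrier M\<rbrakk> \<Longrightarrow> k_linear K Q M (\<lambda>z. act m (f z))"
  using assms by (auto simp: rmodule_def bilin_closed intro: bilin_left bilin_right)

lemma comoduleD:
  assumes "comodule M \<rho>"
  shows "module K M" "k_linear K M (tensor_product K M L) \<rho>"
    "\<And>m. m \<in> carrier M \<Longrightarrow> \<rho> m \<in> carrier (tensor_product K M L)"
    "\<And>Q f. k_linear K Q M f \<Longrightarrow> k_linear K Q (tensor_product K M L) (\<lambda>z. \<rho> (f z))"
  using assms by (auto simp: comodule_def intro: k_linear_closed k_linear_comp)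

lemma coact_coassoc:
  assumes c: "comodule M \<rho>" and P: "module K P" and f: "trilin K M L L P f" and m: "m \<in> carrier M"
  shows "tsum M L P (\<lambda>x c. tsum M L P (\<lambda>a b. f a b c) (\<rho> x)) (\<rho> m) =
    tsum M L P (\<lambda>a u. sw P (\<lambda>b c. f a b c) u) (\<rho> m)"
proof -
  note M = comoduleD[OF c]
  let ?W = "tensor_product K M L"
  let ?T = "tensor_product K ?W L"
  let ?\<phi> = "tsum ?W L P (\<lambda>s c. tsum M L P (\<lambda>a b. f a b c) s)"
  have f': "bilin K ?W L P (\<lambda>s c. tsum M L P (\<lambda>a b. f a b c) s)"
    using f P by (simp add: hlin M)
  have "?\<phi> (tsum M L ?T (\<lambda>x y. tens K ?W L (\<rho> x) y) (\<rho> m))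
      = ?\<phi> (tsum M L ?T (\<lambda>x y. sw ?T (\<lambda>a b. tens K ?W L (tens K M L x a) b) y) (\<rho> m))"
    using c m by (simp add: comodule_def)
  moreover have "?\<phi> (tsum M L ?T (\<lambda>x y. tens K ?W L (\<rho> x) y) (\<rho> m)) =
     tsum M L P (\<lambda>x c. tsum M L P (\<lambda>a b. f a b c) (\<rho> x)) (\<rho> m)"
    by (subst tsum_tsum[where K=K]) (use P f f' m in \<open>simp_all add: hlin M\<close>)
  moreover have "?\<phi> (tsum M L ?T (\<lambda>x y. sw ?T (\<lambda>a b. tens K ?W L (tens K M L x a) b) y) (\<rho> m))
      = tsum M L P (\<lambda>a u. sw P (\<lambda>b c. f a b c) u) (\<rho> m)"
    by (subst tsum_tsum[where K=K]) (use P f f' m in \<open>simp_all add: hlin tsum_K M\<close>)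
  ultimately show ?thesis by simp
qed

lemma coact_counit:
  assumes c: "comodule M \<rho>" and "module K P" "k_linear K M P f" "m \<in> carrier M"
  shows "tsum M L P (\<lambda>x y. \<epsilon> y \<odot>\<^bsub>P\<^esub> f x) (\<rho> m) = f m"
proof -
  note M = comoduleD[OF c]
  have "f (tsum M L M (\<lambda>x y. \<epsilon> y \<odot>\<^bsub>M\<^esub> x) (\<rho> m)) = tsum M L P (\<lambda>x y. f (\<epsilon> y \<odot>\<^bsub>M\<^esub> x)) (\<rho> m)"
    by (rule linear_tsum[where K=K]) (use assms in \<open>simp_all add: hlin M\<close>)
  then show ?thesis using assms by (simp add: comodule_def k_linear_smult)
qed

lemma coact_mapD:
  assumes "coact_map M \<rho> N \<sigma> f"
  shows "k_linear K M N f" "\<And>m. m \<in> carrier M \<Longrightarrow> f m \<in> carrier N"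
    "\<And>Q g. k_linear K Q M g \<Longrightarrow> k_linear K Q N (\<lambda>z. f (g z))"
  using assms by (auto simp: coact_map_def intro: k_linear_closed k_linear_comp)

text \<open>How Sweedler sums see a colinear map: \<open>f(m)\<^sub>0 \<otimes> f(m)\<^sub>1\<close> may be replaced by \<open>f(m\<^sub>0) \<otimes> m\<^sub>1\<close>.\<close>

lemma tsum_coact_map:
  assumes "coact_map M \<rho> N \<sigma> f" "comodule M \<rho>" "module K N" "module K P" "bilin K N L P g" "m \<in> carrier M"
  shows "tsum N L P g (\<sigma> (f m)) = tsum M L P (\<lambda>x y. g (f x) y) (\<rho> m)"
proof -
  note M = comoduleD[OF assms(2)] and f = coact_mapD[OF assms(1)]
  have "\<sigma> (f m) = tsum M L (tensor_product K N L) (\<lambda>x y. tens K N L (f x) y) (\<rho> m)"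
    using assms by (simp add: coact_map_def)
  then show ?thesis
    using assms by (simp add: tsum_K hlin M f)
qed

lemma ydD:
  assumes "yd M act \<rho>"
  shows "rmodule M act" "comodule M \<rho>"
  using assms by (auto simp: yd_def)

lemma yd_compat:
  assumes "yd M act \<rho>" "m \<in> carrier M" "h \<in> carrier L" "module K P" "bilin K M L P f"
  shows "tsum M L P f (\<rho> (act m h)) = tsum M L P (\<lambda>x y. tsum L L P (\<lambda>p q. f (act x p) q) (twist y h)) (\<rho> m)"
proof -
  note M = rmoduleD[OF ydD(1)[OF assms(1)]] comoduleD[OF ydD(2)[OF assms(1)]]
  have "\<rho> (act m h) = tsum M L (tensor_product K M L)
        (\<lambda>x y. tsum L L (tensor_product K M L) (\<lambda>p q. tens K M L (act x p) q) (twist y h)) (\<rho> m)"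
    using assms by (simp add: yd_def)
  then show ?thesis using assms by (simp add: tsum_K hlin k_linear_twist bilin_left bilin_right M)
qed

end

section \<open>From the map \<open>\<theta>\<close> to separability\<close>

locale theta = hopf_algebra K L for K :: "'k ring" and L :: "('k, 'l) hopf" +
  fixes \<theta> :: "('l, 'l) tensor \<Rightarrow> 'l"
  assumes theta_linear: "k_linear K LL L \<theta>"
    and theta_twist: "\<lbrakk>g \<in> carrier L; h \<in> carrier L\<rbrakk> \<Longrightarrow>
      sw LL (\<lambda>h1 h2. \<theta> (g \<otimes>\<otimes> h1) \<otimes>\<otimes> h2) h = sw LL (\<lambda>g1 g2. twist g1 (\<theta> (g2 \<otimes>\<otimes> h))) g"
    and theta_comult: "h \<in> carrier L \<Longrightarrow> \<theta> (\<Delta> h) = \<epsilon> h \<odot>\<^bsub>L\<^esub> \<one>\<^bsub>L\<^esub>"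
begin

lemma theta_closed [simp]: "t \<in> carrier LL \<Longrightarrow> \<theta> t \<in> carrier L"
  by (rule k_linear_closed[OF theta_linear])

lemmas tlin = hlin k_linear_comp[OF theta_linear]

text \<open>The map \<open>m \<otimes> l \<mapsto> m\<^sub>0 \<theta>(m\<^sub>1 \<otimes> l)\<close>. For the coaction of \<open>M \<otimes> L\<close> on the last factor it is a colinear
  retraction of \<open>\<rho> : M \<rightarrow> M \<otimes> L\<close>; the two conditions on \<open>\<theta>\<close> are made for these two properties.\<close>

definition retraction where
  "retraction M act \<rho> m l = tsum M L M (\<lambda>x y. act x (\<theta> (y \<otimes>\<otimes> l))) (\<rho> m)"

lemma retraction_bilin: 
  assumes "yd M act \<rho>" shows "bilin K M L M (retraction M act \<rho>)"
proof -
  note M = rmoduleD[OF ydD(1)[OF assms(1)]] comoduleD[OF ydD(2)[OF assms(1)]]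
  show ?thesis unfolding retraction_def[abs_def]
    by (simp add: tlin M)
qed

text \<open>By compatibility \<open>\<rho>(m\<^sub>0 \<theta>(m\<^sub>1 \<otimes> l))\<close> involves the entwining of \<open>m\<^sub>1\<close> with \<open>\<theta>(m\<^sub>2 \<otimes> l)\<close>, which is the right
  side of the first condition on \<open>\<theta>\<close>; its left side moves the coaction to \<open>l\<close>.\<close>

lemma retraction_coact:
  assumes "yd M act \<rho>" "m \<in> carrier M" "l \<in> carrier L"
  shows "\<rho> (retraction M act \<rho> m l) =
    sw (tensor_product K M L) (\<lambda>l1 l2. tens K M L (retraction M act \<rho> m l1) l2) l"
proof -
  note M = rmoduleD[OF ydD(1)[OF assms(1)]] comoduleD[OF ydD(2)[OF assms(1)]]
  let ?W = "tensor_product K M L"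
  have "\<rho> (retraction M act \<rho> m l) = tsum M L ?W (\<lambda>x y. \<rho> (act x (\<theta> (y \<otimes>\<otimes> l)))) (\<rho> m)"
    unfolding retraction_def by (rule linear_tsum[where K=K]) (use assms in \<open>simp_all add: tlin M\<close>)
  also have "\<dots> = tsum M L ?W (\<lambda>x y. tsum M L ?W (\<lambda>x' y'.
      tsum L L ?W (\<lambda>p q. tens K M L (act x' p) q) (twist y' (\<theta> (y \<otimes>\<otimes> l)))) (\<rho> x)) (\<rho> m)"
    using assms by (intro tsum_cong refl) (simp add: yd_def)
  also have "\<dots> = tsum M L ?W (\<lambda>x y. sw ?W (\<lambda>y1 y2.
      tsum L L ?W (\<lambda>p q. tens K M L (act x p) q) (twist y1 (\<theta> (y2 \<otimes>\<otimes> l)))) y) (\<rho> m)"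
    by (rule coact_coassoc[OF ydD(2)[OF assms(1)]]) (use assms in \<open>simp_all add: tlin k_linear_twist M\<close>)
  also have "\<dots> = tsum M L ?W (\<lambda>x y. tsum L L ?W (\<lambda>p q. tens K M L (act x p) q)
      (sw LL (\<lambda>y1 y2. twist y1 (\<theta> (y2 \<otimes>\<otimes> l))) y)) (\<rho> m)"
    using assms by (simp add: tsum_K tlin k_linear_twist M)
  also have "\<dots> = tsum M L ?W (\<lambda>x y. tsum L L ?W (\<lambda>p q. tens K M L (act x p) q)
      (sw LL (\<lambda>l1 l2. \<theta> (y \<otimes>\<otimes> l1) \<otimes>\<otimes> l2) l)) (\<rho> m)"
    by (rule tsum_cong[OF refl]) (use assms in \<open>simp add: theta_twist\<close>)
  also have "\<dots> = tsum M L ?W (\<lambda>x y. sw ?W (\<lambda>l1 l2. tens K M L (act x (\<theta> (y \<otimes>\<otimes> l1))) l2) l) (\<rho> m)"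
    using assms by (simp add: tsum_K tlin M)
  also have "\<dots> = sw ?W (\<lambda>l1 l2. tsum M L ?W (\<lambda>x y. tens K M L (act x (\<theta> (y \<otimes>\<otimes> l1))) l2) (\<rho> m)) l"
    by (rule tsum_swap[where K=K]) (use assms in \<open>simp_all add: tlin M\<close>)
  also have "\<dots> = sw ?W (\<lambda>l1 l2. tens K M L (retraction M act \<rho> m l1) l2) l"
    unfolding retraction_def
    by (rule tsum_cong[OF refl], rule linear_tsum[where K=K, symmetric]) (use assms in \<open>simp_all add: tlin M\<close>)
  finally show ?thesis .
qed

lemma retraction_unit:
  assumes "yd M act \<rho>" "m \<in> carrier M"
  shows "tsum M L M (retraction M act \<rho>) (\<rho> m) = m"
proof -
  note M = rmoduleD[OF ydD(1)[OF assms(1)]] comoduleD[OF ydD(2)[OF assms(1)]]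
  have r: "sw M (\<lambda>y1 y2. act x (\<theta> (y1 \<otimes>\<otimes> y2))) y = \<epsilon> y \<odot>\<^bsub>M\<^esub> x"
    if "x \<in> carrier M" "y \<in> carrier L" for x y
  proof -
    have "sw M (\<lambda>y1 y2. act x (\<theta> (y1 \<otimes>\<otimes> y2))) y = act x (\<theta> (sw LL (tens K L L) y))"
      by (rule linear_tsum[where K=K, symmetric]) (use that in \<open>simp_all add: tlin M\<close>)
    also have "\<dots> = act x (\<epsilon> y \<odot>\<^bsub>L\<^esub> \<one>\<^bsub>L\<^esub>)" using that by (simp add: theta_comult)
    also have "\<dots> = \<epsilon> y \<odot>\<^bsub>M\<^esub> x"
      using M that by (simp add: k_linear_smult[OF bilin_def[THEN iffD1, OF M(2), THEN conjunct1, rule_format]])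
    finally show ?thesis .
  qed
  have "tsum M L M (retraction M act \<rho>) (\<rho> m) = tsum M L M (\<lambda>x l. tsum M L M (\<lambda>x y. act x (\<theta> (y \<otimes>\<otimes> l))) (\<rho> x)) (\<rho> m)"
    by (simp add: retraction_def)
  also have "\<dots> = tsum M L M (\<lambda>x y. sw M (\<lambda>y1 y2. act x (\<theta> (y1 \<otimes>\<otimes> y2))) y) (\<rho> m)"
    by (rule coact_coassoc[OF ydD(2)[OF assms(1)]]) (use assms in \<open>simp_all add: tlin M\<close>)
  also have "\<dots> = m"
    using coact_counit[OF ydD(2)[OF assms(1)], of M "\<lambda>x. x"] M assms by (simp add: r k_linear_id)
  finally show ?thesis .
qed

text \<open>The operator \<open>h \<mapsto> (v \<mapsto> h(v\<^sub>0)\<^sub>0 \<theta>(h(v\<^sub>0)\<^sub>1 \<otimes> v\<^sub>1))\<close>. It makes every \<open>K\<close>-linear map with values in a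
  Yetter-Drinfeld module colinear and fixes the maps that are colinear. Separability and relative
  injectivity are both read off from it.\<close>

definition colift where
  "colift V \<sigma> M act \<rho> h v = tsum V L M (\<lambda>x y. retraction M act \<rho> (h x) y) (\<sigma> v)"

lemma colift_colinear:
  assumes "yd M act \<rho>" "comodule V \<sigma>" "k_linear K V M h"
  shows "coact_map V \<sigma> M \<rho> (colift V \<sigma> M act \<rho> h)"
proof -
  note M = rmoduleD[OF ydD(1)[OF assms(1)]] comoduleD[OF ydD(2)[OF assms(1)]]
    and V = comoduleD[OF assms(2)] and n = retraction_bilin[OF assms(1)]
  note l = tlin k_linear_comp[OF assms(3)] k_linear_closed[OF assms(3)] 
    bilin_left[OF n] bilin_right[OF n] bilin_closed[OF n]
  let ?W = "tensor_product K M L"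
  have lin: "k_linear K V M (colift V \<sigma> M act \<rho> h)"
    unfolding colift_def[abs_def] by (simp add: l M V)
  show ?thesis unfolding coact_map_def
  proof (intro conjI ballI lin)
    fix v assume v: "v \<in> carrier V"
    have "\<rho> (colift V \<sigma> M act \<rho> h v) = tsum V L ?W (\<lambda>x y. \<rho> (retraction M act \<rho> (h x) y)) (\<sigma> v)"
      unfolding colift_def by (rule linear_tsum[where K=K]) (use v in \<open>simp_all add: l M V\<close>)
    also have "\<dots> = tsum V L ?W (\<lambda>x y. sw ?W (\<lambda>y1 y2. tens K M L (retraction M act \<rho> (h x) y1) y2) y) (\<sigma> v)"
      by (intro tsum_cong refl) (simp add: retraction_coact assms l)
    also have "\<dots> = tsum V L ?W (\<lambda>x y. tsum V L ?W (\<lambda>x' y'. tens K M L (retraction M act \<rho> (h x') y') y) (\<sigma> x)) (\<sigma> v)"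
      by (rule coact_coassoc[symmetric, OF assms(2)]) (use v in \<open>simp_all add: l M V\<close>)
    also have "\<dots> = tsum V L ?W (\<lambda>x y. tens K M L (colift V \<sigma> M act \<rho> h x) y) (\<sigma> v)"
      unfolding colift_def
      by (rule tsum_cong[OF refl], rule linear_tsum[where K=K, symmetric]) (use v in \<open>simp_all add: l M V\<close>)
    finally show "\<rho> (colift V \<sigma> M act \<rho> h v) =
      tsum V L ?W (\<lambda>x y. tens K M L (colift V \<sigma> M act \<rho> h x) y) (\<sigma> v)" .
  qed
qed

lemma colift_comp:
  assumes "yd M act \<rho>" "comodule V \<sigma>" "comodule U \<tau>" "k_linear K V M h" "coact_map U \<tau> V \<sigma> i" "u \<in> carrier U"
  shows "colift V \<sigma> M act \<rho> h (i u) = colift U \<tau> M act \<rho> (\<lambda>x. h (i x)) u"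
proof -
  note M = rmoduleD[OF ydD(1)[OF assms(1)]] comoduleD[OF ydD(2)[OF assms(1)]]
    and V = comoduleD[OF assms(2)] and n = retraction_bilin[OF assms(1)]
  note l = tlin k_linear_comp[OF assms(4)] k_linear_closed[OF assms(4)] 
    bilin_left[OF n] bilin_right[OF n] bilin_closed[OF n]
  show ?thesis unfolding colift_def
    by (rule tsum_coact_map[OF assms(5,3)]) (use assms in \<open>simp_all add: l V M\<close>)
qed

lemma colift_fix:
  assumes "yd M act \<rho>" "comodule V \<sigma>" "coact_map V \<sigma> M \<rho> h" "v \<in> carrier V"
  shows "colift V \<sigma> M act \<rho> h v = h v"
proof -
  note h = coact_mapD[OF assms(3)]
  have "colift V \<sigma> M act \<rho> h v = tsum M L M (retraction M act \<rho>) (\<rho> (h v))"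
    unfolding colift_def
    by (rule tsum_coact_map[symmetric, OF assms(3,2)])
      (use assms rmoduleD[OF ydD(1)[OF assms(1)]] in \<open>simp_all add: retraction_bilin\<close>)
  then show ?thesis using retraction_unit[OF assms(1)] h assms(4) by simp
qed

lemma colift_natural:
  assumes "yd M act \<rho>" "yd N act' \<rho>'" "comodule V \<sigma>" "k_linear K V M h"
    "act_map M act N act' f" "coact_map M \<rho> N \<rho>' f" "v \<in> carrier V"
  shows "f (colift V \<sigma> M act \<rho> h v) = colift V \<sigma> N act' \<rho>' (\<lambda>x. f (h x)) v"
proof -
  note M = rmoduleD[OF ydD(1)[OF assms(1)]] comoduleD[OF ydD(2)[OF assms(1)]]
    and N = rmoduleD[OF ydD(1)[OF assms(2)]] comoduleD[OF ydD(2)[OF assms(2)]]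
    and V = comoduleD[OF assms(3)] and n = retraction_bilin[OF assms(1)] and f = coact_mapD[OF assms(6)]
  note l = tlin k_linear_comp[OF assms(4)] k_linear_closed[OF assms(4)] 
    bilin_left[OF n] bilin_right[OF n] bilin_closed[OF n]
  have retraction: "f (retraction M act \<rho> m y) = retraction N act' \<rho>' (f m) y" if "m \<in> carrier M" "y \<in> carrier L" for m y
  proof -
    have "f (retraction M act \<rho> m y) = tsum M L N (\<lambda>x z. f (act x (\<theta> (z \<otimes>\<otimes> y)))) (\<rho> m)"
      unfolding retraction_def by (rule linear_tsum[where K=K]) (use that in \<open>simp_all add: l M N f\<close>)
    also have "\<dots> = tsum M L N (\<lambda>x z. act' (f x) (\<theta> (z \<otimes>\<otimes> y))) (\<rho> m)"
      using assms(5) that by (intro tsum_cong refl) (simp add: act_map_def)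
    also have "\<dots> = retraction N act' \<rho>' (f m) y"
      unfolding retraction_def
      by (rule tsum_coact_map[symmetric, OF assms(6) ydD(2)[OF assms(1)]]) (use that in \<open>simp_all add: l N f\<close>)
    finally show ?thesis .
  qed
  have "f (colift V \<sigma> M act \<rho> h v) = tsum V L N (\<lambda>x y. f (retraction M act \<rho> (h x) y)) (\<sigma> v)"
    unfolding colift_def by (rule linear_tsum[where K=K]) (use assms in \<open>simp_all add: l M N V f\<close>)
  also have "\<dots> = colift V \<sigma> N act' \<rho>' (\<lambda>x. f (h x)) v"
    unfolding colift_def by (intro tsum_cong refl) (simp add: retraction l)
  finally show ?thesis .
qed

end

section \<open>From the map \<open>e\<close> to separability\<close>

text \<open>The first condition says that \<open>e\<close> commutes with \<open>L\<close> up to the entwining, as a Casimir element does; the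
  second one is a normalisation.\<close>

locale casimir = hopf_algebra K L for K :: "'k ring" and L :: "('k, 'l) hopf" +
  fixes e :: "'l \<Rightarrow> ('l, 'l) tensor"
  assumes e_linear: "k_linear K L LL e"
    and e_twist: "\<lbrakk>g \<in> carrier L; h \<in> carrier L\<rbrakk> \<Longrightarrow>
      tsum L L LL (\<lambda>x y. x \<otimes>\<otimes> (y \<otimes>\<^bsub>L\<^esub> h)) (e g) =
      tsum L L LL (\<lambda>p q. tsum L L LL (\<lambda>x y. (p \<otimes>\<^bsub>L\<^esub> x) \<otimes>\<otimes> y) (e q)) (twist g h)"
    and e_mult: "g \<in> carrier L \<Longrightarrow> tsum L L L (\<lambda>x y. x \<otimes>\<^bsub>L\<^esub> y) (e g) = \<epsilon> g \<odot>\<^bsub>L\<^esub> \<one>\<^bsub>L\<^esub>"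
begin

lemma e_closed [simp]: "g \<in> carrier L \<Longrightarrow> e g \<in> carrier LL"
  by (rule k_linear_closed[OF e_linear])

lemmas elin = hlin k_linear_comp[OF e_linear] k_linear_twist

text \<open>The dual operator \<open>h \<mapsto> (x \<mapsto> \<Sum> h(x\<^sub>0 e\<^sup>1(x\<^sub>1)) e\<^sup>2(x\<^sub>1))\<close>. It makes every \<open>K\<close>-linear map on a Yetter-Drinfeld
  module \<open>L\<close>-linear and fixes the maps that are \<open>L\<close>-linear.\<close>

definition linlift where
  "linlift X a \<rho> Y b h x = tsum X L Y (\<lambda>x0 x1. tsum L L Y (\<lambda>p q. b (h (a x0 p)) q) (e x1)) (\<rho> x)"

text \<open>For \<open>x m\<close> in place of \<open>x\<close> the compatibility condition produces the right side of \<open>e_twist\<close>; the left side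
  lets \<open>m\<close> act at the very end.\<close>

lemma linlift_act:
  assumes "yd X a \<rho>" "rmodule Y b" "k_linear K X Y h"
  shows "act_map X a Y b (linlift X a \<rho> Y b h)"
proof -
  note X = rmoduleD[OF ydD(1)[OF assms(1)]] comoduleD[OF ydD(2)[OF assms(1)]] and Y = rmoduleD[OF assms(2)]
  note l = elin k_linear_comp[OF assms(3)] k_linear_closed[OF assms(3)] X Y
  have lin: "k_linear K X Y (linlift X a \<rho> Y b h)"
    unfolding linlift_def[abs_def] by (simp add: l)
  have e: "tsum L L Y (\<lambda>p q. tsum L L Y (\<lambda>s t. b (h (a (a x0 p) s)) t) (e q)) (twist x1 m)
      = b (tsum L L Y (\<lambda>s t. b (h (a x0 s)) t) (e x1)) m"
    if "x0 \<in> carrier X" "x1 \<in> carrier L" "m \<in> carrier L" for x0 x1 m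
  proof -
    have "tsum L L Y (\<lambda>p q. tsum L L Y (\<lambda>s t. b (h (a (a x0 p) s)) t) (e q)) (twist x1 m) =
       tsum L L Y (\<lambda>u t. b (h (a x0 u)) t)
        (tsum L L LL (\<lambda>p q. tsum L L LL (\<lambda>x y. (p \<otimes>\<^bsub>L\<^esub> x) \<otimes>\<otimes> y) (e q)) (twist x1 m))"
      using that by (simp add: tsum_K l)
    also have "\<dots> = tsum L L Y (\<lambda>u t. b (h (a x0 u)) t) (tsum L L LL (\<lambda>x y. x \<otimes>\<otimes> (y \<otimes>\<^bsub>L\<^esub> m)) (e x1))"
      using that by (simp only: e_twist)
    also have "\<dots> = tsum L L Y (\<lambda>s t. b (b (h (a x0 s)) t) m) (e x1)"
      using that by (simp add: tsum_K l)
    also have "\<dots> = b (tsum L L Y (\<lambda>s t. b (h (a x0 s)) t) (e x1)) m"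
      by (rule linear_tsum[where K=K, symmetric, where \<phi>="\<lambda>y. b y m"]) (use that in \<open>simp_all add: l\<close>)
    finally show ?thesis .
  qed
  show ?thesis unfolding act_map_def
  proof (intro conjI ballI lin)
    fix x m assume x: "x \<in> carrier X" "m \<in> carrier L"
    have "linlift X a \<rho> Y b h (a x m) = tsum X L Y (\<lambda>x0 x1. tsum L L Y (\<lambda>p q.
        tsum L L Y (\<lambda>s t. b (h (a (a x0 p) s)) t) (e q)) (twist x1 m)) (\<rho> x)"
      unfolding linlift_def by (rule yd_compat[OF assms(1)]) (use x in \<open>simp_all add: l\<close>)
    also have "\<dots> = tsum X L Y (\<lambda>x0 x1. b (tsum L L Y (\<lambda>s t. b (h (a x0 s)) t) (e x1)) m) (\<rho> x)"
      by (rule tsum_cong[OF refl], rule e) (use x in simp_all)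
    also have "\<dots> = b (linlift X a \<rho> Y b h x) m"
      unfolding linlift_def
      by (rule linear_tsum[where K=K, symmetric, where \<phi>="\<lambda>y. b y m"]) (use x in \<open>simp_all add: l\<close>)
    finally show "linlift X a \<rho> Y b h (a x m) = b (linlift X a \<rho> Y b h x) m" .
  qed
qed

lemma linlift_fix:
  assumes "yd X a \<rho>" "rmodule Y b" "act_map X a Y b h" "x \<in> carrier X"
  shows "linlift X a \<rho> Y b h x = h x"
proof -
  have h: "k_linear K X Y h" "\<And>x m. \<lbrakk>x \<in> carrier X; m \<in> carrier L\<rbrakk> \<Longrightarrow> h (a x m) = b (h x) m"
    using assms by (auto simp: act_map_def)
  note X = rmoduleD[OF ydD(1)[OF assms(1)]] comoduleD[OF ydD(2)[OF assms(1)]] and Y = rmoduleD[OF assms(2)]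
  note l = elin k_linear_comp[OF h(1)] k_linear_closed[OF h(1)] X Y
  have r: "tsum L L Y (\<lambda>p q. b (h (a x0 p)) q) (e x1) = \<epsilon> x1 \<odot>\<^bsub>Y\<^esub> h x0"
    if "x0 \<in> carrier X" "x1 \<in> carrier L" for x0 x1
  proof -
    have "tsum L L Y (\<lambda>p q. b (h (a x0 p)) q) (e x1) = tsum L L Y (\<lambda>p q. b (h x0) (p \<otimes>\<^bsub>L\<^esub> q)) (e x1)"
      by (rule tsum_cong[OF refl]) (use that in \<open>simp add: h(2) l\<close>)
    also have "\<dots> = b (h x0) (tsum L L L (\<lambda>p q. p \<otimes>\<^bsub>L\<^esub> q) (e x1))"
      by (rule linear_tsum[where K=K, symmetric]) (use that in \<open>simp_all add: l\<close>)
    also have "\<dots> = \<epsilon> x1 \<odot>\<^bsub>Y\<^esub> h x0"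
      using that Y(2) by (simp add: e_mult k_linear_smult[of K L Y "b (h x0)"] bilin_def l)
    finally show ?thesis .
  qed
  show ?thesis
    unfolding linlift_def
    using coact_counit[OF ydD(2)[OF assms(1)] Y(1) h(1) assms(4)] by (simp add: r)
qed

lemma linlift_comp:
  assumes "yd X a \<rho>" "yd X' a' \<rho>'" "rmodule Y b" "k_linear K X Y h"
    and "act_map X' a' X a u" "coact_map X' \<rho>' X \<rho> u" "x \<in> carrier X'"
  shows "linlift X a \<rho> Y b h (u x) = linlift X' a' \<rho>' Y b (\<lambda>x. h (u x)) x"
proof -
  note X = rmoduleD[OF ydD(1)[OF assms(1)]] comoduleD[OF ydD(2)[OF assms(1)]] and Y = rmoduleD[OF assms(3)]
  note u = coact_mapD[OF assms(6)]
  note l = elin k_linear_comp[OF assms(4)] k_linear_closed[OF assms(4)] X Y u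
  have "linlift X a \<rho> Y b h (u x) = tsum X' L Y (\<lambda>x0 x1. tsum L L Y (\<lambda>p q. b (h (a (u x0) p)) q) (e x1)) (\<rho>' x)"
    unfolding linlift_def
    by (rule tsum_coact_map[OF assms(6) ydD(2)[OF assms(2)]]) (use assms(7) in \<open>simp_all add: l\<close>)
  also have "\<dots> = linlift X' a' \<rho>' Y b (\<lambda>x. h (u x)) x"
    unfolding linlift_def using assms(5)
    by (intro tsum_cong refl) (simp add: act_map_def)
  finally show ?thesis .
qed

lemma linlift_natural:
  assumes "yd X a \<rho>" "rmodule Y b" "rmodule Y' b'" "k_linear K X Y h" "act_map Y b Y' b' v" "x \<in> carrier X"
  shows "v (linlift X a \<rho> Y b h x) = linlift X a \<rho> Y' b' (\<lambda>x. v (h x)) x"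
proof -
  note X = rmoduleD[OF ydD(1)[OF assms(1)]] comoduleD[OF ydD(2)[OF assms(1)]] and Y = rmoduleD[OF assms(2)]
    and Y' = rmoduleD[OF assms(3)]
  have v: "k_linear K Y Y' v" "\<And>y m. \<lbrakk>y \<in> carrier Y; m \<in> carrier L\<rbrakk> \<Longrightarrow> v (b y m) = b' (v y) m"
    using assms by (auto simp: act_map_def)
  note l = elin k_linear_comp[OF assms(4)] k_linear_closed[OF assms(4)] X Y Y' k_linear_comp[OF v(1)] k_linear_closed[OF v(1)]
  have "v (linlift X a \<rho> Y b h x) = tsum X L Y' (\<lambda>x0 x1. v (tsum L L Y (\<lambda>p q. b (h (a x0 p)) q) (e x1))) (\<rho> x)"
    unfolding linlift_def by (rule linear_tsum[where K=K]) (use assms(6) v in \<open>simp_all add: l\<close>)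
  also have "\<dots> = tsum X L Y' (\<lambda>x0 x1. tsum L L Y' (\<lambda>p q. v (b (h (a x0 p)) q)) (e x1)) (\<rho> x)"
    by (rule tsum_cong[OF refl], rule linear_tsum[where K=K]) (use v in \<open>simp_all add: l\<close>)
  also have "\<dots> = linlift X a \<rho> Y' b' (\<lambda>x. v (h x)) x"
    unfolding linlift_def by (intro tsum_cong refl) (simp add: v l)
  finally show ?thesis .
qed

end

section \<open>Tensor products in the universe\<close>

text \<open>The objects of the categories have their elements in a fixed type. The modules constructed from \<open>L\<close> are
  transported there.\<close>

lemma module_copy:
  assumes M: "module K M" and le: "carrier M \<lesssim> (UNIV :: 'u set)"
  obtains T :: "('k, 'u) module" and \<phi> \<psi> where "module K T" "k_linear K M T \<phi>" "k_linear K T M \<psi>"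
    "\<forall>x\<in>carrier M. \<psi> (\<phi> x) = x" "\<forall>y\<in>carrier T. \<phi> (\<psi> y) = y"
proof -
  interpret M: module K M by fact
  obtain \<phi> :: "_ \<Rightarrow> 'u" where \<phi>: "inj_on \<phi> (carrier M)" using le by (auto simp: lepoll_def)
  define \<psi> where "\<psi> = inv_into (carrier M) \<phi>"
  have [simp]: "\<psi> (\<phi> x) = x" if "x \<in> carrier M" for x
    using that \<phi> by (simp add: \<psi>_def)
  define T :: "('k, 'u) module" where "T = \<lparr>carrier = \<phi> ` carrier M, monoid.mult = undefined, one = undefined,
    ring.zero = \<phi> \<zero>\<^bsub>M\<^esub>, ring.add = (\<lambda>x y. \<phi> (\<psi> x \<oplus>\<^bsub>M\<^esub> \<psi> y)), smult = (\<lambda>a x. \<phi> (a \<odot>\<^bsub>M\<^esub> \<psi> x))\<rparr>"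
  have ag: "abelian_group T"
    by (rule abelian_groupI)
      (auto simp: T_def M.M.a_ac M.M.r_neg intro!: bexI[of _ "\<ominus>\<^bsub>M\<^esub> x" for x])
  have "module K T"
    by (rule moduleI[OF M.R.is_cring ag])
      (auto simp: T_def M.smult_l_distr M.smult_r_distr M.smult_assoc1)
  moreover have "k_linear K M T \<phi>" "k_linear K T M \<psi>"
    by (auto simp: k_linear_def T_def)
  ultimately show thesis
    by (rule that) (auto simp: T_def)
qed

lemma times_lepoll_universe:
  assumes "infinite (UNIV :: 'u set)" "A \<lesssim> (UNIV :: 'u set)" "B \<lesssim> (UNIV :: 'u set)"
  shows "A \<times> B \<lesssim> (UNIV :: 'u set)"
proof -
  have "A \<times> B \<lesssim> (UNIV :: 'u set) \<times> (UNIV :: 'u set)"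
    by (rule times_lepoll_mono) fact+
  also have "\<dots> \<lesssim> (UNIV :: 'u set)"
    using card_of_Times_same_infinite[OF assms(1)]
    by (intro eqpoll_imp_lepoll) (simp add: eqpoll_iff_card_of_ordIso)
  finally show ?thesis .
qed

text \<open>A formal combination is determined by its graph, a finite subset of \<open>A \<times> \<int>\<close>.\<close>

lemma free_Abelian_group_lepoll:
  assumes inf: "infinite (UNIV :: 'u set)" and le: "A \<lesssim> (UNIV :: 'u set)"
  shows "carrier (free_Abelian_group A) \<lesssim> (UNIV :: 'u set)"
proof -
  have int: "(UNIV :: int set) \<lesssim> (UNIV :: 'u set)"
  proof -
    have "(UNIV :: int set) \<lesssim> (UNIV :: nat set)"
      unfolding lepoll_def by (metis inj_int_encode subset_UNIV)
    then show ?thesis using inf unfolding infinite_le_lepoll by (rule lepoll_trans)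
  qed
  have AZ: "A \<times> (UNIV :: int set) \<lesssim> (UNIV :: 'u set)" by (rule times_lepoll_universe[OF inf le int])
  have "carrier (free_Abelian_group A) \<lesssim> {f::_\<Rightarrow>int. f ` A \<subseteq> UNIV \<and> {x. f x \<noteq> 0} \<subseteq> A \<and> finite {x. f x \<noteq> 0}}"
    unfolding lepoll_def
    by (rule exI[of _ Poly_Mapping.lookup]) (auto simp: poly_mapping_eqI lookup_not_eq_zero_eq_in_keys inj_onI)
  also have "\<dots> \<lesssim> Fpow (A \<times> (UNIV::int set))"
    by (rule lepoll_restricted_funspace)
  also have "\<dots> \<lesssim> Fpow (UNIV :: 'u set)"
  proof -
    obtain f :: "_ \<Rightarrow> 'u" where f: "inj_on f (A \<times> (UNIV::int set))" using AZ by (auto simp: lepoll_def)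
    have "inj_on ((`) f) (Fpow (A \<times> (UNIV::int set)))"
      by (rule inj_onI) (auto simp: Fpow_def dest: inj_on_image_eq_iff[OF f, THEN iffD1, rotated 2])
    then show ?thesis unfolding lepoll_def by (intro exI[of _ "(`) f"]) (auto simp: Fpow_def)
  qed
  also have "\<dots> \<lesssim> (UNIV :: 'u set)"
    using eqpoll_Fpow[OF inf] by (rule eqpoll_imp_lepoll)
  finally show ?thesis .
qed

lemma tensor_product_lepoll:
  assumes "infinite (UNIV :: 'u set)" "carrier M \<lesssim> (UNIV :: 'u set)" "carrier N \<lesssim> (UNIV :: 'u set)"
  shows "carrier (tensor_product K M N) \<lesssim> (UNIV :: 'u set)"
proof -
  have "carrier (tensor_product K M N) \<subseteq> (\<lambda>c. tensor_null K M N #>\<^bsub>pairs_group M N\<^esub> c) ` carrier (pairs_group M N)"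
    by (auto simp: tensor_product_def RCOSETS_def)
  then have "carrier (tensor_product K M N) \<lesssim> carrier (pairs_group M N)"
    by (rule subset_image_lepoll)
  also have "\<dots> \<lesssim> (UNIV :: 'u set)"
    unfolding pairs_group_def using times_lepoll_universe[OF assms] by (rule free_Abelian_group_lepoll[OF assms(1)])
  finally show ?thesis .
qed

text \<open>\<open>T\<close> is a copy of \<open>(B \<otimes> L) \<otimes> L\<close>, with \<open>tt b g l\<close> the pure tensor \<open>b \<otimes> g \<otimes> l\<close> and \<open>ts P f\<close> the linear map
  induced by a trilinear \<open>f\<close>. With these two and \<open>triple_ext\<close> nothing depends on how the copy is made.\<close>

locale triple = hopf_algebra K L for K :: "'k ring" and L :: "('k, 'l) hopf" +
  fixes B :: "('k, 'b, 'z) module_scheme" and T :: "('k, 'u) module"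
    and \<phi> :: "(('b, 'l) tensor, 'l) tensor \<Rightarrow> 'u" and \<psi> :: "'u \<Rightarrow> (('b, 'l) tensor, 'l) tensor"
  assumes B [simp]: "module K B" and T [simp]: "module K T"
    and phi: "k_linear K (tensor_product K (tensor_product K B L) L) T \<phi>"
    and psi: "k_linear K T (tensor_product K (tensor_product K B L) L) \<psi>"
    and psi_phi: "t \<in> carrier (tensor_product K (tensor_product K B L) L) \<Longrightarrow> \<psi> (\<phi> t) = t"
    and phi_psi: "x \<in> carrier T \<Longrightarrow> \<phi> (\<psi> x) = x"
begin

abbreviation "BL \<equiv> tensor_product K B L"
abbreviation "TL \<equiv> tensor_product K T L"

definition tt where "tt b g l = \<phi> (tens K BL L (tens K B L b g) l)"

definition ts where "ts P f x = tsum BL L P (\<lambda>y l. tsum B L P (\<lambda>b g. f b g l) y) (\<psi> x)"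

lemma psi_closed [simp]: "x \<in> carrier T \<Longrightarrow> \<psi> x \<in> carrier (tensor_product K BL L)"
  by (rule k_linear_closed[OF psi])

lemma tt_closed [simp]: "\<lbrakk>b \<in> carrier B; g \<in> carrier L; l \<in> carrier L\<rbrakk> \<Longrightarrow> tt b g l \<in> carrier T"
  unfolding tt_def by (rule k_linear_closed[OF phi]) simp

lemma k_linear_tt:
  "\<lbrakk>k_linear K Q B f; g \<in> carrier L; l \<in> carrier L\<rbrakk> \<Longrightarrow> k_linear K Q T (\<lambda>z. tt (f z) g l)"
  "\<lbrakk>k_linear K Q L f'; b \<in> carrier B; l \<in> carrier L\<rbrakk> \<Longrightarrow> k_linear K Q T (\<lambda>z. tt b (f' z) l)"
  "\<lbrakk>k_linear K Q L f'; b \<in> carrier B; g \<in> carrier L\<rbrakk> \<Longrightarrow> k_linear K Q T (\<lambda>z. tt b g (f' z))"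
  unfolding tt_def by (rule k_linear_comp[OF phi], simp add: hlin)+

lemma ts_bilin:
  assumes "module K P" "trilin K B L L P f"
  shows "bilin K BL L P (\<lambda>y l. tsum B L P (\<lambda>b g. f b g l) y)"
  using assms by (simp add: hlin)

lemma ts_linear:
  assumes "module K P" "trilin K B L L P f"
  shows "k_linear K T P (ts P f)"
  unfolding ts_def[abs_def]
  by (rule k_linear_comp[OF _ psi]) (rule tsum_linear, use assms ts_bilin in simp_all)

lemma k_linear_ts_arg:
  "\<lbrakk>module K P; trilin K B L L P f; k_linear K Q T x\<rbrakk> \<Longrightarrow> k_linear K Q P (\<lambda>z. ts P f (x z))"
  by (rule k_linear_comp[OF ts_linear])

lemma ts_tt [simp]:
  assumes "module K P" "trilin K B L L P f" "b \<in> carrier B" "g \<in> carrier L" "l \<in> carrier L"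
  shows "ts P f (tt b g l) = f b g l"
  unfolding ts_def tt_def using assms ts_bilin[OF assms(1,2)]
  by (simp add: psi_phi) (simp add: hlin)

lemma k_linear_ts_fun:
  assumes "module K P" "module K Q" "x \<in> carrier T" "\<And>z. z \<in> carrier Q \<Longrightarrow> trilin K B L L P (f z)"
    "\<And>b g l. \<lbrakk>b \<in> carrier B; g \<in> carrier L; l \<in> carrier L\<rbrakk> \<Longrightarrow> k_linear K Q P (\<lambda>z. f z b g l)"
  shows "k_linear K Q P (\<lambda>z. ts P (f z) x)"
  unfolding ts_def 
  by (rule k_linear_tsum_fun) (use assms in \<open>simp_all add: ts_bilin k_linear_tsum_fun trilin_def\<close>)

lemma triple_ext:
  assumes P: "module K P" and f: "k_linear K T P f" and f': "k_linear K T P f'"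
    and e: "\<And>b g l. \<lbrakk>b \<in> carrier B; g \<in> carrier L; l \<in> carrier L\<rbrakk> \<Longrightarrow> f (tt b g l) = f' (tt b g l)"
    and x: "x \<in> carrier T"
  shows "f x = f' x"
proof -
  have l: "k_linear K (tensor_product K BL L) P (\<lambda>t. f (\<phi> t))" "k_linear K (tensor_product K BL L) P (\<lambda>t. f' (\<phi> t))"
    by (rule k_linear_comp[OF _ phi], fact)+
  have "f (\<phi> t) = f' (\<phi> t)" if "t \<in> carrier (tensor_product K BL L)" for t
  proof (rule tensor_ext[OF _ _ P l _ that])
    fix y m assume m: "y \<in> carrier BL" "m \<in> carrier L"
    have l': "k_linear K BL P (\<lambda>y. f (\<phi> (tens K BL L y m)))" "k_linear K BL P (\<lambda>y. f' (\<phi> (tens K BL L y m)))"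
      using m by (auto intro!: k_linear_comp[OF l(1)] k_linear_comp[OF l(2)] simp: hlin)
    show "f (\<phi> (tens K BL L y m)) = f' (\<phi> (tens K BL L y m))"
      by (rule tensor_ext[OF _ _ P l' _ m(1)]) (use e m in \<open>simp_all add: tt_def\<close>)
  qed simp_all
  from this[of "\<psi> x"] show ?thesis using x by (simp add: phi_psi)
qed

lemmas tlin = hlin k_linear_tt k_linear_ts_arg k_linear_ts_fun k_linear_twist ts_linear

end

section \<open>A free and a cofree Yetter-Drinfeld module\<close>

context triple
begin

text \<open>\<open>B \<otimes> L \<otimes> L\<close>, free as a module over the last factor. On \<open>b \<otimes> g \<otimes> 1\<close> the coaction comultiplies \<open>g\<close>, and
  the compatibility condition then forces \<open>b \<otimes> g \<otimes> l \<mapsto> \<Sum> b \<otimes> g\<^sub>1 \<otimes> p \<otimes> q\<close> with \<open>p \<otimes> q\<close> the entwining of \<open>g\<^sub>2\<close>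
  and \<open>l\<close>. The comodule axioms and the compatibility condition then express the
  compatibilities of the entwining with \<open>\<Delta>\<close>, \<open>\<epsilon>\<close> and the product.\<close>

definition act_free where "act_free x h = ts T (\<lambda>b g l. tt b g (l \<otimes>\<^bsub>L\<^esub> h)) x"

definition coact_free where
  "coact_free x = ts TL (\<lambda>b g l. sw TL (\<lambda>g1 g2. tsum L L TL (\<lambda>p q. tens K T L (tt b g1 p) q) (twist g2 l)) g) x"

lemma act_free_tt: "\<lbrakk>b \<in> carrier B; g \<in> carrier L; l \<in> carrier L; h \<in> carrier L\<rbrakk> \<Longrightarrow>
    act_free (tt b g l) h = tt b g (l \<otimes>\<^bsub>L\<^esub> h)"
  by (simp add: act_free_def tlin)

lemma coact_free_tt: "\<lbrakk>b \<in> carrier B; g \<in> carrier L; l \<in> carrier L\<rbrakk> \<Longrightarrow>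
    coact_free (tt b g l) = sw TL (\<lambda>g1 g2. tsum L L TL (\<lambda>p q. tens K T L (tt b g1 p) q) (twist g2 l)) g"
  by (simp add: coact_free_def tlin)

lemma act_free_bilin: "bilin K T L T act_free"
  unfolding act_free_def[abs_def] by (simp add: tlin)

lemma coact_free_linear: "k_linear K T TL coact_free"
  unfolding coact_free_def[abs_def] by (simp add: tlin)

lemmas free_lin = tlin bilin_left[OF act_free_bilin] bilin_right[OF act_free_bilin] bilin_closed[OF act_free_bilin]
  k_linear_comp[OF coact_free_linear] k_linear_closed[OF coact_free_linear] coact_free_linear

lemma rmodule_free: "rmodule T act_free"
  unfolding rmodule_def
proof (intro conjI ballI)
  fix x g h assume x: "x \<in> carrier T" "g \<in> carrier L" "h \<in> carrier L"
  show "act_free (act_free x g) h = act_free x (g \<otimes>\<^bsub>L\<^esub> h)"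
    by (rule triple_ext[OF T _ _ _ x(1), where f="\<lambda>x. act_free (act_free x g) h"])
      (use x in \<open>simp_all add: free_lin act_free_tt L_ring.m_assoc\<close>)
next
  fix x assume x: "x \<in> carrier T"
  show "act_free x \<one>\<^bsub>L\<^esub> = x"
    by (rule triple_ext[OF T _ _ _ x(1), where f="\<lambda>x. act_free x \<one>\<^bsub>L\<^esub>"])
      (use x in \<open>simp_all add: free_lin act_free_tt\<close>)
qed (simp_all add: act_free_bilin)

lemma comodule_free: "comodule T coact_free"
  unfolding comodule_def
proof (intro conjI ballI)
  let ?T3 = "tensor_product K TL L"
  fix x assume x: "x \<in> carrier T"
  show "tsum T L ?T3 (\<lambda>x y. tens K TL L (coact_free x) y) (coact_free x) =
    tsum T L ?T3 (\<lambda>x y. sw ?T3 (\<lambda>a c. tens K TL L (tens K T L x a) c) y) (coact_free x)"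
  proof (rule triple_ext[OF _ _ _ _ x, where P="?T3"])
    fix b g l assume b: "b \<in> carrier B" and gl: "g \<in> carrier L" "l \<in> carrier L"
    have "tsum T L ?T3 (\<lambda>x y. tens K TL L (coact_free x) y) (coact_free (tt b g l)) =
      sw ?T3 (\<lambda>g1 g2. tsum L L ?T3 (\<lambda>p q. sw ?T3 (\<lambda>g11 g12.
        tsum L L ?T3 (\<lambda>p' q'. tens K TL L (tens K T L (tt b g11 p') q') q) (twist g12 p)) g1) (twist g2 l)) g"
    proof -
      have "tens K TL L (coact_free (tt b g1 p)) q = sw ?T3 (\<lambda>g11 g12.
        tsum L L ?T3 (\<lambda>p' q'. tens K TL L (tens K T L (tt b g11 p') q') q) (twist g12 p)) g1"
        if "g1 \<in> carrier L" "p \<in> carrier L" "q \<in> carrier L" for g1 p q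
      proof -
        have "tens K TL L (coact_free (tt b g1 p)) q = sw ?T3 (\<lambda>g11 g12.
          tens K TL L (tsum L L TL (\<lambda>p' q'. tens K T L (tt b g11 p') q') (twist g12 p)) q) g1"
          unfolding coact_free_tt[OF b that(1,2)]
          by (rule linear_tsum[where K=K, where \<phi>="\<lambda>x. tens K TL L x q"]) (use b that in \<open>simp_all add: tlin\<close>)
        also have "\<dots> = sw ?T3 (\<lambda>g11 g12.
          tsum L L ?T3 (\<lambda>p' q'. tens K TL L (tens K T L (tt b g11 p') q') q) (twist g12 p)) g1"
          by (rule tsum_cong[OF refl], rule linear_tsum[where K=K, where \<phi>="\<lambda>x. tens K TL L x q"])
            (use b that in \<open>simp_all add: tlin\<close>)
        finally show ?thesis .
      qed
      then show ?thesis using b gl by (simp add: coact_free_tt tsum_K free_lin)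
    qed
    also have "\<dots> = sw ?T3 (\<lambda>g1 g2. sw ?T3 (\<lambda>g11 g12. tsum L L ?T3 (\<lambda>p q.
        tsum L L ?T3 (\<lambda>p' q'. tens K TL L (tens K T L (tt b g11 p') q') q) (twist g12 p)) (twist g2 l)) g1) g"
      by (rule tsum_cong[OF refl], rule tsum_swap[where K=K]) (use b gl in \<open>simp_all add: free_lin\<close>)
    also have "\<dots> = sw ?T3 (\<lambda>g1 g2. sw ?T3 (\<lambda>g21 g22. tsum L L ?T3 (\<lambda>p q.
        tsum L L ?T3 (\<lambda>p' q'. tens K TL L (tens K T L (tt b g1 p') q') q) (twist g21 p)) (twist g22 l)) g2) g"
      by (rule sw_coassoc) (use b gl in \<open>simp_all add: free_lin\<close>)
    also have "\<dots> = sw ?T3 (\<lambda>g1 g2. tsum L L ?T3 (\<lambda>p q.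
        sw ?T3 (\<lambda>a c. tens K TL L (tens K T L (tt b g1 p) a) c) q) (twist g2 l)) g"
      by (rule tsum_cong[OF refl], rule sw_twist[symmetric]) (use b gl in \<open>simp_all add: free_lin\<close>)
    also have "\<dots> = tsum T L ?T3 (\<lambda>x y. sw ?T3 (\<lambda>a c. tens K TL L (tens K T L x a) c) y) (coact_free (tt b g l))"
      using b gl by (simp add: coact_free_tt tsum_K free_lin)
    finally show "tsum T L ?T3 (\<lambda>x y. tens K TL L (coact_free x) y) (coact_free (tt b g l)) =
      tsum T L ?T3 (\<lambda>x y. sw ?T3 (\<lambda>a c. tens K TL L (tens K T L x a) c) y) (coact_free (tt b g l))" .
  qed (simp_all add: free_lin)
next
  fix x assume x: "x \<in> carrier T"
  show "tsum T L T (\<lambda>x y. \<epsilon> y \<odot>\<^bsub>T\<^esub> x) (coact_free x) = x"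
    by (rule triple_ext[OF T _ _ _ x, where f="\<lambda>x. tsum T L T (\<lambda>x y. \<epsilon> y \<odot>\<^bsub>T\<^esub> x) (coact_free x)"])
      (simp_all add: free_lin coact_free_tt tsum_K twist_counit)
qed (simp_all add: free_lin)

lemma yd_free: "yd T act_free coact_free"
  unfolding yd_def
proof (intro conjI ballI rmodule_free comodule_free)
  fix x h assume x: "x \<in> carrier T" "h \<in> carrier L"
  show "coact_free (act_free x h) = tsum T L TL (\<lambda>x y. tsum L L TL (\<lambda>p q. tens K T L (act_free x p) q) (twist y h)) (coact_free x)"
    by (rule triple_ext[OF _ _ _ _ x(1), where P=TL and f="\<lambda>x. coact_free (act_free x h)"])
      (use x in \<open>simp_all add: free_lin coact_free_tt act_free_tt tsum_K twist_mult\<close>)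
qed

text \<open>\<open>B \<otimes> L \<otimes> L\<close>, cofree as a comodule over the last factor, with the action
  \<open>(b \<otimes> l \<otimes> g) h = \<Sum> b \<otimes> l p \<otimes> q\<close>, where \<open>p \<otimes> q\<close> is the entwining of \<open>g\<close> and \<open>h\<close>.\<close>

definition act_cofree where
  "act_cofree x h = ts T (\<lambda>b l g. tsum L L T (\<lambda>p q. tt b (l \<otimes>\<^bsub>L\<^esub> p) q) (twist g h)) x"

definition coact_cofree where
  "coact_cofree x = ts TL (\<lambda>b l g. sw TL (\<lambda>g1 g2. tens K T L (tt b l g1) g2) g) x"

lemma act_cofree_tt: "\<lbrakk>b \<in> carrier B; l \<in> carrier L; g \<in> carrier L; h \<in> carrier L\<rbrakk> \<Longrightarrow>
    act_cofree (tt b l g) h = tsum L L T (\<lambda>p q. tt b (l \<otimes>\<^bsub>L\<^esub> p) q) (twist g h)"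
  by (simp add: act_cofree_def tlin)

lemma coact_cofree_tt: "\<lbrakk>b \<in> carrier B; l \<in> carrier L; g \<in> carrier L\<rbrakk> \<Longrightarrow>
    coact_cofree (tt b l g) = sw TL (\<lambda>g1 g2. tens K T L (tt b l g1) g2) g"
  by (simp add: coact_cofree_def tlin)

lemma act_cofree_bilin: "bilin K T L T act_cofree"
  unfolding act_cofree_def[abs_def] by (simp add: tlin)

lemma coact_cofree_linear: "k_linear K T TL coact_cofree"
  unfolding coact_cofree_def[abs_def] by (simp add: tlin)

lemmas cofree_lin = tlin bilin_left[OF act_cofree_bilin] bilin_right[OF act_cofree_bilin] bilin_closed[OF act_cofree_bilin]
  k_linear_comp[OF coact_cofree_linear] k_linear_closed[OF coact_cofree_linear] coact_cofree_linear

lemma rmodule_cofree: "rmodule T act_cofree"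
  unfolding rmodule_def
proof (intro conjI ballI)
  fix x g h assume x: "x \<in> carrier T" and gh: "g \<in> carrier L" "h \<in> carrier L"
  show "act_cofree (act_cofree x g) h = act_cofree x (g \<otimes>\<^bsub>L\<^esub> h)"
  proof (rule triple_ext[OF T _ _ _ x, where f="\<lambda>x. act_cofree (act_cofree x g) h"])
    fix b l c assume b: "b \<in> carrier B" "l \<in> carrier L" "c \<in> carrier L"
    have "act_cofree (act_cofree (tt b l c) g) h =
      tsum L L T (\<lambda>p q. act_cofree (tt b (l \<otimes>\<^bsub>L\<^esub> p) q) h) (twist c g)"
      unfolding act_cofree_tt[OF b gh(1)]
      by (rule linear_tsum[where K=K, where \<phi>="\<lambda>x. act_cofree x h"]) (use b gh in \<open>simp_all add: cofree_lin\<close>)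
    then show "act_cofree (act_cofree (tt b l c) g) h = act_cofree (tt b l c) (g \<otimes>\<^bsub>L\<^esub> h)"
      using b gh by (simp add: act_cofree_tt twist_mult tsum_K cofree_lin L_ring.m_assoc)
  qed (use gh in \<open>simp_all add: cofree_lin\<close>)
next
  fix x assume x: "x \<in> carrier T"
  show "act_cofree x \<one>\<^bsub>L\<^esub> = x"
    by (rule triple_ext[OF T _ _ _ x(1), where f="\<lambda>x. act_cofree x \<one>\<^bsub>L\<^esub>"])
      (use x in \<open>simp_all add: cofree_lin act_cofree_tt twist_one\<close>)
qed (simp_all add: act_cofree_bilin)

lemma comodule_cofree: "comodule T coact_cofree"
  unfolding comodule_def
proof (intro conjI ballI)
  let ?T3 = "tensor_product K TL L"
  fix x assume x: "x \<in> carrier T"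
  show "tsum T L ?T3 (\<lambda>x y. tens K TL L (coact_cofree x) y) (coact_cofree x) =
    tsum T L ?T3 (\<lambda>x y. sw ?T3 (\<lambda>a c. tens K TL L (tens K T L x a) c) y) (coact_cofree x)"
  proof (rule triple_ext[OF _ _ _ _ x, where P="?T3"])
    fix b l g assume b: "b \<in> carrier B" "l \<in> carrier L" and g: "g \<in> carrier L"
    have r: "tens K TL L (coact_cofree (tt b l g1)) q = sw ?T3 (\<lambda>g11 g12. tens K TL L (tens K T L (tt b l g11) g12) q) g1"
      if "g1 \<in> carrier L" "q \<in> carrier L" for g1 q
      unfolding coact_cofree_tt[OF b that(1)]
      by (rule linear_tsum[where K=K, where \<phi>="\<lambda>x. tens K TL L x q"]) (use b that in \<open>simp_all add: tlin\<close>)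
    have "tsum T L ?T3 (\<lambda>x y. tens K TL L (coact_cofree x) y) (coact_cofree (tt b l g)) =
      sw ?T3 (\<lambda>g1 g2. sw ?T3 (\<lambda>g11 g12. tens K TL L (tens K T L (tt b l g11) g12) g2) g1) g"
      unfolding coact_cofree_tt[OF b g]
      by (subst tsum_K) (use b g in \<open>simp_all add: r cofree_lin\<close>)
    also have "\<dots> = sw ?T3 (\<lambda>g1 g2. sw ?T3 (\<lambda>g21 g22. tens K TL L (tens K T L (tt b l g1) g21) g22) g2) g"
      by (rule sw_coassoc) (use b g in \<open>simp_all add: cofree_lin\<close>)
    also have "\<dots> = tsum T L ?T3 (\<lambda>x y. sw ?T3 (\<lambda>a c. tens K TL L (tens K T L x a) c) y) (coact_cofree (tt b l g))"
      using b g by (simp add: coact_cofree_tt tsum_K cofree_lin)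
    finally show "tsum T L ?T3 (\<lambda>x y. tens K TL L (coact_cofree x) y) (coact_cofree (tt b l g)) =
      tsum T L ?T3 (\<lambda>x y. sw ?T3 (\<lambda>a c. tens K TL L (tens K T L x a) c) y) (coact_cofree (tt b l g))" .
  qed (simp_all add: cofree_lin)
next
  fix x assume x: "x \<in> carrier T"
  show "tsum T L T (\<lambda>x y. \<epsilon> y \<odot>\<^bsub>T\<^esub> x) (coact_cofree x) = x"
    by (rule triple_ext[OF T _ _ _ x, where f="\<lambda>x. tsum T L T (\<lambda>x y. \<epsilon> y \<odot>\<^bsub>T\<^esub> x) (coact_cofree x)"])
      (simp_all add: cofree_lin coact_cofree_tt tsum_K)
qed (simp_all add: cofree_lin)

lemma yd_cofree: "yd T act_cofree coact_cofree"
  unfolding yd_def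
proof (intro conjI ballI rmodule_cofree comodule_cofree)
  fix x h assume x: "x \<in> carrier T" and h: "h \<in> carrier L"
  show "coact_cofree (act_cofree x h) =
    tsum T L TL (\<lambda>x y. tsum L L TL (\<lambda>p q. tens K T L (act_cofree x p) q) (twist y h)) (coact_cofree x)"
  proof (rule triple_ext[OF _ _ _ _ x, where P=TL and f="\<lambda>x. coact_cofree (act_cofree x h)"])
    fix b l g assume b: "b \<in> carrier B" "l \<in> carrier L" and g: "g \<in> carrier L"
    have "coact_cofree (act_cofree (tt b l g) h) = tsum L L TL (\<lambda>p q. coact_cofree (tt b (l \<otimes>\<^bsub>L\<^esub> p) q)) (twist g h)"
      unfolding act_cofree_tt[OF b g h]
      by (rule linear_tsum[where K=K, where \<phi>=coact_cofree]) (use b g h in \<open>simp_all add: cofree_lin\<close>)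
    also have "\<dots> = tsum L L TL (\<lambda>p q. sw TL (\<lambda>q1 q2. tens K T L (tt b (l \<otimes>\<^bsub>L\<^esub> p) q1) q2) q) (twist g h)"
      by (rule tsum_cong[OF refl]) (use b g h in \<open>simp add: coact_cofree_tt\<close>)
    also have "\<dots> = sw TL (\<lambda>g1 g2. tsum L L TL (\<lambda>p q.
        tsum L L TL (\<lambda>p' q'. tens K T L (tt b (l \<otimes>\<^bsub>L\<^esub> p') q') q) (twist g1 p)) (twist g2 h)) g"
      by (rule sw_twist) (use b g h in \<open>simp_all add: cofree_lin\<close>)
    also have "\<dots> = sw TL (\<lambda>g1 g2. tsum L L TL (\<lambda>p q. tens K T L (act_cofree (tt b l g1) p) q) (twist g2 h)) g"
    proof (rule tsum_cong[OF refl], rule tsum_cong[OF refl])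
      fix g1 p q assume c: "g1 \<in> carrier L" "p \<in> carrier L" "q \<in> carrier L"
      show "tsum L L TL (\<lambda>p' q'. tens K T L (tt b (l \<otimes>\<^bsub>L\<^esub> p') q') q) (twist g1 p) = tens K T L (act_cofree (tt b l g1) p) q"
        unfolding act_cofree_tt[OF b c(1,2)]
        by (rule linear_tsum[where K=K, where \<phi>="\<lambda>x. tens K T L x q", symmetric]) (use b c in \<open>simp_all add: tlin\<close>)
    qed
    also have "\<dots> = tsum T L TL (\<lambda>x y. tsum L L TL (\<lambda>p q. tens K T L (act_cofree x p) q) (twist y h)) (coact_cofree (tt b l g))"
      unfolding coact_cofree_tt[OF b g]
      by (subst tsum_K) (use b g h in \<open>simp_all add: cofree_lin\<close>)
    finally show "coact_cofree (act_cofree (tt b l g) h) =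
      tsum T L TL (\<lambda>x y. tsum L L TL (\<lambda>p q. tens K T L (act_cofree x p) q) (twist y h)) (coact_cofree (tt b l g))" .
  qed (use h in \<open>simp_all add: cofree_lin\<close>)
qed

end

section \<open>From separability to \<open>e\<close>\<close>

lemma smult_swap:
  assumes "module K M" "a \<in> carrier K" "b \<in> carrier K" "x \<in> carrier M"
  shows "a \<odot>\<^bsub>M\<^esub> (b \<odot>\<^bsub>M\<^esub> x) = b \<odot>\<^bsub>M\<^esub> (a \<odot>\<^bsub>M\<^esub> x)"
proof -
  interpret M: module K M by fact
  show ?thesis using assms(2-) by (simp add: M.smult_assoc1[symmetric] M.R.m_comm)
qed

lemma tens_smult_left:
  "\<lbrakk>module K M; module K N; a \<in> carrier K; x \<in> carrier M; y \<in> carrier N\<rbrakk> \<Longrightarrow>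
    tens K M N (a \<odot>\<^bsub>M\<^esub> x) y = a \<odot>\<^bsub>tensor_product K M N\<^esub> tens K M N x y"
  by (rule k_linear_smult[OF k_linear_tens_left[OF _ _ k_linear_id]])

lemma tens_smult_right:
  "\<lbrakk>module K M; module K N; a \<in> carrier K; x \<in> carrier M; y \<in> carrier N\<rbrakk> \<Longrightarrow>
    tens K M N x (a \<odot>\<^bsub>N\<^esub> y) = a \<odot>\<^bsub>tensor_product K M N\<^esub> tens K M N x y"
  by (rule k_linear_smult[OF k_linear_tens_right[OF _ _ k_linear_id]])

lemma tsum_smult_arg:
  "\<lbrakk>module K M; module K N; module K P; bilin K M N P f; a \<in> carrier K; t \<in> carrier (tensor_product K M N)\<rbrakk> \<Longrightarrow>
    tsum M N P f (a \<odot>\<^bsub>tensor_product K M N\<^esub> t) = a \<odot>\<^bsub>P\<^esub> tsum M N P f t"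
  by (rule k_linear_smult[OF tsum_linear])

context hopf_algebra
begin

text \<open>The restriction of a separating family to the endomorphisms of one object with elements \<open>A\<close>: \<open>D\<close> and \<open>C\<close>
  single out the endomorphisms in the two target categories, so that \<open>D\<close> and \<open>C\<close> together are those of
  the object itself. Maps count only through their values on \<open>A\<close>, hence the variable \<open>w\<close>.\<close>

definition separating where
  "separating A D C Q \<longleftrightarrow>
    (\<forall>h. D h \<longrightarrow> C (Q h)) \<and>
    (\<forall>u v h w x. D h \<and> D u \<and> C u \<and> D v \<and> C v \<and> D w \<and> (\<forall>x\<in>A. w x = v (h (u x))) \<and> x \<in> A
       \<longrightarrow> Q w x = v (Q h (u x))) \<and>
    (\<forall>f x. D f \<and> C f \<and> x \<in> A \<longrightarrow> Q f x = f x)"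

lemma separatingD:
  assumes "separating A D C Q"
  shows "D h \<Longrightarrow> C (Q h)"
    "\<lbrakk>D h; D u; C u; D v; C v; D w; \<And>x. x \<in> A \<Longrightarrow> w x = v (h (u x)); x \<in> A\<rbrakk> \<Longrightarrow> Q w x = v (Q h (u x))"
    "\<lbrakk>D f; C f; x \<in> A\<rbrakk> \<Longrightarrow> Q f x = f x"
proof -
  note a = assms[unfolded separating_def]
  show "C (Q h)" if "D h"
    by (rule a[THEN conjunct1, rule_format, OF that])
  show "Q w x = v (Q h (u x))" if "D h" "D u" "C u" "D v" "C v" "D w" "\<And>x. x \<in> A \<Longrightarrow> w x = v (h (u x))" "x \<in> A"
    by (rule a[THEN conjunct2, THEN conjunct1, rule_format]) (simp add: that)
  show "Q f x = f x" if "D f" "C f" "x \<in> A"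
    by (rule a[THEN conjunct2, THEN conjunct2, rule_format]) (simp add: that)
qed

text \<open>Naturality as it is used below: two factorisations of one map through \<open>h\<close> and \<open>h'\<close> give two expressions
  for its image.\<close>

lemma separating_comp:
  assumes "separating A D C Q" "D h" "D u" "C u" "D v" "C v" "D (\<lambda>x. v (h (u x)))"
    "D h'" "D u'" "C u'" "D v'" "C v'" "\<And>x. x \<in> A \<Longrightarrow> v (h (u x)) = v' (h' (u' x))" "x \<in> A"
  shows "v (Q h (u x)) = v' (Q h' (u' x))"
proof -
  let ?w = "\<lambda>x. v (h (u x))"
  have "Q ?w x = v (Q h (u x))"
    by (rule separatingD(2)[OF assms(1), OF assms(2-7) _ assms(14)]) simp
  moreover have "Q ?w x = v' (Q h' (u' x))"
    by (rule separatingD(2)[OF assms(1), OF assms(8-12) assms(7) _ assms(14)]) (rule assms(13))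
  ultimately show ?thesis by simp
qed

end

context triple
begin

lemma ts_smult_arg:
  "\<lbrakk>module K P; trilin K B L L P f; a \<in> carrier K; x \<in> carrier T\<rbrakk> \<Longrightarrow> ts P f (a \<odot>\<^bsub>T\<^esub> x) = a \<odot>\<^bsub>P\<^esub> ts P f x"
  by (rule k_linear_smult[OF ts_linear])

lemma tt_smult:
  "\<lbrakk>a \<in> carrier K; b \<in> carrier B; g \<in> carrier L; l \<in> carrier L\<rbrakk> \<Longrightarrow> tt (a \<odot>\<^bsub>B\<^esub> b) g l = a \<odot>\<^bsub>T\<^esub> tt b g l"
  "\<lbrakk>a \<in> carrier K; b \<in> carrier B; g \<in> carrier L; l \<in> carrier L\<rbrakk> \<Longrightarrow> tt b (a \<odot>\<^bsub>L\<^esub> g) l = a \<odot>\<^bsub>T\<^esub> tt b g l"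
  "\<lbrakk>a \<in> carrier K; b \<in> carrier B; g \<in> carrier L; l \<in> carrier L\<rbrakk> \<Longrightarrow> tt b g (a \<odot>\<^bsub>L\<^esub> l) = a \<odot>\<^bsub>T\<^esub> tt b g l"
  by (rule k_linear_smult[OF k_linear_tt(1)[OF k_linear_id]] k_linear_smult[OF k_linear_tt(2)[OF k_linear_id]]
     k_linear_smult[OF k_linear_tt(3)[OF k_linear_id]]; assumption)+

lemmas scal = ts_smult_arg tt_smult tens_smult_left tens_smult_right tsum_smult_arg smult_mult_left smult_mult_right

lemma act_mapI:
  assumes "bilin K T L T a" "k_linear K T T F"
    and "\<And>b g l h. \<lbrakk>b \<in> carrier B; g \<in> carrier L; l \<in> carrier L; h \<in> carrier L\<rbrakk> \<Longrightarrow>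
      F (a (tt b g l) h) = a (F (tt b g l)) h"
  shows "act_map T a T a F"
  unfolding act_map_def
proof (intro conjI ballI assms(2))
  fix x h assume x: "x \<in> carrier T" "h \<in> carrier L"
  show "F (a x h) = a (F x) h"
    by (rule triple_ext[OF T _ _ _ x(1), where f="\<lambda>x. F (a x h)"])
      (use x assms in \<open>simp_all add: k_linear_comp[OF assms(2)] k_linear_id bilin_left[OF assms(1)]\<close>)
qed

lemma coact_mapI:
  assumes "k_linear K T TL \<rho>" "k_linear K T T F"
    and "\<And>b g l. \<lbrakk>b \<in> carrier B; g \<in> carrier L; l \<in> carrier L\<rbrakk> \<Longrightarrow>
      \<rho> (F (tt b g l)) = tsum T L TL (\<lambda>x y. tens K T L (F x) y) (\<rho> (tt b g l))"
  shows "coact_map T \<rho> T \<rho> F"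
  unfolding coact_map_def
proof (intro conjI ballI assms(2))
  fix x assume x: "x \<in> carrier T"
  show "\<rho> (F x) = tsum T L TL (\<lambda>x y. tens K T L (F x) y) (\<rho> x)"
    by (rule triple_ext[OF _ _ _ _ x, where f="\<lambda>x. \<rho> (F x)" and P=TL])
      (use assms in \<open>simp_all add: hlin k_linear_comp[OF assms(1)] k_linear_comp[OF assms(2)] k_linear_closed[OF assms(2)]\<close>)
qed

end

text \<open>The cofree module with \<open>B = L\<close> tests a family from colinear to \<open>L\<close>-linear maps. The map \<open>probe\<close> sends
  \<open>a \<otimes> l \<otimes> g\<close> to \<open>\<epsilon>(a) l \<otimes> 1 \<otimes> g\<close>; it is colinear, and it moves the module variable \<open>l\<close> to a place
  where no later action changes it. If the family comes from \<open>e\<close>, then the image of \<open>probe\<close>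
  sends \<open>1 \<otimes> 1 \<otimes> g\<close> to an element whose projection \<open>proj\<close>, the counit on the last factor, is \<open>e(g)\<close>.\<close>

locale triple_L = triple K L L T \<phi> \<psi>
  for K :: "'k ring" and L :: "('k, 'l) hopf" and T :: "('k, 'u) module" and \<phi> \<psi>
begin

definition probe where "probe x = ts T (\<lambda>a l g. \<epsilon> a \<odot>\<^bsub>T\<^esub> tt l \<one>\<^bsub>L\<^esub> g) x"
definition shift where "shift m x = ts T (\<lambda>a l g. \<epsilon> a \<odot>\<^bsub>T\<^esub> tt \<one>\<^bsub>L\<^esub> (m \<otimes>\<^bsub>L\<^esub> l) g) x"
definition left_mult where "left_mult m x = ts T (\<lambda>a l g. tt (m \<otimes>\<^bsub>L\<^esub> a) l g) x"
definition merge where "merge x = ts T (\<lambda>a l g. tt \<one>\<^bsub>L\<^esub> (a \<otimes>\<^bsub>L\<^esub> l) g) x"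
definition proj where "proj x = ts LL (\<lambda>a l g. \<epsilon> g \<odot>\<^bsub>LL\<^esub> (a \<otimes>\<otimes> l)) x"

abbreviation "lin_endo \<equiv> act_map T act_cofree T act_cofree"
abbreviation "colin_endo \<equiv> coact_map T coact_cofree T coact_cofree"

lemma
  assumes "a \<in> carrier L" "l \<in> carrier L" "g \<in> carrier L"
  shows probe_tt: "probe (tt a l g) = \<epsilon> a \<odot>\<^bsub>T\<^esub> tt l \<one>\<^bsub>L\<^esub> g"
    and shift_tt: "m \<in> carrier L \<Longrightarrow> shift m (tt a l g) = \<epsilon> a \<odot>\<^bsub>T\<^esub> tt \<one>\<^bsub>L\<^esub> (m \<otimes>\<^bsub>L\<^esub> l) g"
    and left_mult_tt: "m \<in> carrier L \<Longrightarrow> left_mult m (tt a l g) = tt (m \<otimes>\<^bsub>L\<^esub> a) l g"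
    and merge_tt: "merge (tt a l g) = tt \<one>\<^bsub>L\<^esub> (a \<otimes>\<^bsub>L\<^esub> l) g"
    and proj_tt: "proj (tt a l g) = \<epsilon> g \<odot>\<^bsub>LL\<^esub> (a \<otimes>\<otimes> l)"
  using assms by (simp_all add: probe_def shift_def left_mult_def merge_def proj_def tlin)

lemma linear_maps:
  "k_linear K T T probe" "m \<in> carrier L \<Longrightarrow> k_linear K T T (shift m)"
  "m \<in> carrier L \<Longrightarrow> k_linear K T T (left_mult m)" "k_linear K T T merge" "k_linear K T LL proj"
  by (simp_all add: probe_def[abs_def] shift_def[abs_def] left_mult_def[abs_def] merge_def[abs_def] proj_def[abs_def] tlin)

lemmas clin = cofree_lin linear_maps linear_maps[THEN k_linear_comp] linear_maps[THEN k_linear_closed]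
lemmas map_tt = probe_tt shift_tt left_mult_tt merge_tt proj_tt
lemmas map_smult = linear_maps[THEN k_linear_smult] k_linear_smult[OF coact_cofree_linear]

lemma linear_endo_tsum:
  assumes "k_linear K T T F" "bilin K L L T f" "t \<in> carrier LL"
  shows "F (tsum L L T f t) = tsum L L T (\<lambda>p q. F (f p q)) t"
  by (rule linear_tsum[where K=K]) (use assms in simp_all)

lemma act_cofree_smult:
  "\<lbrakk>a \<in> carrier K; x \<in> carrier T; h \<in> carrier L\<rbrakk> \<Longrightarrow> act_cofree (a \<odot>\<^bsub>T\<^esub> x) h = a \<odot>\<^bsub>T\<^esub> act_cofree x h"
  by (rule k_linear_smult[where f="\<lambda>x. act_cofree x h", OF bilin_left[OF act_cofree_bilin k_linear_id]])

lemma probe_colinear: "colin_endo probe"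
  by (rule coact_mapI[OF coact_cofree_linear linear_maps(1)])
    (simp add: map_tt map_smult coact_cofree_tt tsum_K clin scal)

lemma shift_yd: assumes m: "m \<in> carrier L" shows "lin_endo (shift m)" "colin_endo (shift m)"
proof -
  show "lin_endo (shift m)"
  proof (rule act_mapI[OF act_cofree_bilin linear_maps(2)[OF m]])
    fix a l g h assume c: "a \<in> carrier L" "l \<in> carrier L" "g \<in> carrier L" "h \<in> carrier L"
    have "shift m (act_cofree (tt a l g) h) = tsum L L T (\<lambda>p q. shift m (tt a (l \<otimes>\<^bsub>L\<^esub> p) q)) (twist g h)"
      unfolding act_cofree_tt[OF c] by (rule linear_endo_tsum) (use c m in \<open>simp_all add: clin\<close>)
    then show "shift m (act_cofree (tt a l g) h) = act_cofree (shift m (tt a l g)) h"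
      using c m by (simp add: map_tt act_cofree_smult act_cofree_tt tsum_K clin L_ring.m_assoc)
  qed
  show "colin_endo (shift m)"
    by (rule coact_mapI[OF coact_cofree_linear linear_maps(2)[OF m]])
      (use m in \<open>simp add: map_tt map_smult coact_cofree_tt tsum_K clin scal\<close>)
qed

lemma left_mult_yd: assumes m: "m \<in> carrier L" shows "lin_endo (left_mult m)" "colin_endo (left_mult m)"
proof -
  show "lin_endo (left_mult m)"
  proof (rule act_mapI[OF act_cofree_bilin linear_maps(3)[OF m]])
    fix a l g h assume c: "a \<in> carrier L" "l \<in> carrier L" "g \<in> carrier L" "h \<in> carrier L"
    have "left_mult m (act_cofree (tt a l g) h) = tsum L L T (\<lambda>p q. left_mult m (tt a (l \<otimes>\<^bsub>L\<^esub> p) q)) (twist g h)"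
      unfolding act_cofree_tt[OF c] by (rule linear_endo_tsum) (use c m in \<open>simp_all add: clin\<close>)
    then show "left_mult m (act_cofree (tt a l g) h) = act_cofree (left_mult m (tt a l g)) h"
      using c m by (simp add: map_tt act_cofree_tt)
  qed
  show "colin_endo (left_mult m)"
    by (rule coact_mapI[OF coact_cofree_linear linear_maps(3)[OF m]])
      (use m in \<open>simp add: map_tt map_smult coact_cofree_tt tsum_K clin scal\<close>)
qed

lemma merge_yd: "lin_endo merge" "colin_endo merge"
proof -
  show "lin_endo merge"
  proof (rule act_mapI[OF act_cofree_bilin linear_maps(4)])
    fix a l g h assume c: "a \<in> carrier L" "l \<in> carrier L" "g \<in> carrier L" "h \<in> carrier L"
    have "merge (act_cofree (tt a l g) h) = tsum L L T (\<lambda>p q. merge (tt a (l \<otimes>\<^bsub>L\<^esub> p) q)) (twist g h)"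
      unfolding act_cofree_tt[OF c] by (rule linear_endo_tsum) (use c in \<open>simp_all add: clin\<close>)
    then show "merge (act_cofree (tt a l g) h) = act_cofree (merge (tt a l g)) h"
      using c by (simp add: map_tt act_cofree_tt L_ring.m_assoc)
  qed
  show "colin_endo merge"
    by (rule coact_mapI[OF coact_cofree_linear linear_maps(4)])
      (simp add: map_tt map_smult coact_cofree_tt tsum_K clin scal)
qed

lemma id_yd: "lin_endo (\<lambda>x. x)" "colin_endo (\<lambda>x. x)"
  by (simp_all add: act_map_def coact_map_def k_linear_id clin)

text \<open>The relations between \<open>probe\<close> and Yetter-Drinfeld endomorphisms determine the image \<open>R\<close> of \<open>probe\<close>:
  \<open>probe \<circ> shift m = left_mult m \<circ> probe\<close> gives \<open>R(1 \<otimes> m \<otimes> g)\<close> from \<open>R(1 \<otimes> 1 \<otimes> g)\<close>, so that \<open>L\<close>-linearity of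
  \<open>R\<close> at \<open>(1 \<otimes> 1 \<otimes> g) h = \<Sum> 1 \<otimes> p \<otimes> q\<close> is the first condition, and \<open>merge \<circ> probe = shift 1\<close> gives the
  second.\<close>

theorem casimir_exists:
  assumes Q: "separating (carrier T) colin_endo lin_endo Q"
  shows "casimir K L (\<lambda>g. proj (Q probe (tt \<one>\<^bsub>L\<^esub> \<one>\<^bsub>L\<^esub> g)))"
proof -
  let ?R = "Q probe"
  let ?e = "\<lambda>g. proj (?R (tt \<one>\<^bsub>L\<^esub> \<one>\<^bsub>L\<^esub> g))"
  have R: "lin_endo ?R" by (rule separatingD(1)[OF Q, OF probe_colinear])
  then have Rl: "k_linear K T T ?R" by (simp add: act_map_def)
  note l = clin Rl k_linear_comp[OF Rl] k_linear_closed[OF Rl]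
  have A: "proj (?R (tt \<one>\<^bsub>L\<^esub> m g)) = tsum L L LL (\<lambda>x y. (m \<otimes>\<^bsub>L\<^esub> x) \<otimes>\<otimes> y) (?e g)"
    if m: "m \<in> carrier L" and g: "g \<in> carrier L" for m g
  proof -
    have "?R (shift m (tt \<one>\<^bsub>L\<^esub> \<one>\<^bsub>L\<^esub> g)) = left_mult m (?R (tt \<one>\<^bsub>L\<^esub> \<one>\<^bsub>L\<^esub> g))"
    proof (rule separating_comp[OF Q, OF probe_colinear shift_yd(2)[OF m] shift_yd(1)[OF m] id_yd(2,1) _
          probe_colinear id_yd(2,1) left_mult_yd(2)[OF m] left_mult_yd(1)[OF m]])
      have eq: "probe (shift m x) = left_mult m (probe x)" if "x \<in> carrier T" for x
        by (rule triple_ext[OF T _ _ _ that, where f="\<lambda>x. probe (shift m x)"])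
          (use m in \<open>simp_all add: l map_tt map_smult counit_one smult_one_L\<close>)
      show "probe (shift m x) = left_mult m (probe x)" if "x \<in> carrier T" for x
        using that by (rule eq)
      show "colin_endo (\<lambda>x. probe (shift m x))"
        by (rule coact_mapI) (use m in \<open>simp_all add: l map_tt map_smult coact_cofree_tt tsum_K scal counit_one smult_one_L\<close>)
    qed (use g in simp)
    moreover have "shift m (tt \<one>\<^bsub>L\<^esub> \<one>\<^bsub>L\<^esub> g) = tt \<one>\<^bsub>L\<^esub> m g"
      using m g by (simp add: map_tt counit_one smult_one_L)
    moreover have "proj (left_mult m y) = tsum L L LL (\<lambda>x y. (m \<otimes>\<^bsub>L\<^esub> x) \<otimes>\<otimes> y) (proj y)" if "y \<in> carrier T" for y
      by (rule triple_ext[OF _ _ _ _ that, where P=LL and f="\<lambda>x. proj (left_mult m x)"])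
        (use m in \<open>simp_all add: l map_tt scal\<close>)
    ultimately show ?thesis using g by (simp add: l)
  qed
  have B: "proj (act_cofree y h) = tsum L L LL (\<lambda>x y. x \<otimes>\<otimes> (y \<otimes>\<^bsub>L\<^esub> h)) (proj y)"
    if h: "h \<in> carrier L" and y: "y \<in> carrier T" for h y
  proof (rule triple_ext[OF _ _ _ _ y, where P=LL and f="\<lambda>y. proj (act_cofree y h)"])
    fix a l g assume c: "a \<in> carrier L" "l \<in> carrier L" "g \<in> carrier L"
    have "proj (act_cofree (tt a l g) h) = tsum L L LL (\<lambda>p q. proj (tt a (l \<otimes>\<^bsub>L\<^esub> p) q)) (twist g h)"
      unfolding act_cofree_tt[OF c h] by (rule linear_tsum[where K=K]) (use c h in \<open>simp_all add: l\<close>)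
    also have "\<dots> = \<epsilon> g \<odot>\<^bsub>LL\<^esub> (a \<otimes>\<otimes> (l \<otimes>\<^bsub>L\<^esub> h))"
      using c h by (simp add: map_tt twist_counit[where f="\<lambda>p. a \<otimes>\<otimes> (l \<otimes>\<^bsub>L\<^esub> p)"] l)
    finally show "proj (act_cofree (tt a l g) h) = tsum L L LL (\<lambda>x y. x \<otimes>\<otimes> (y \<otimes>\<^bsub>L\<^esub> h)) (proj (tt a l g))"
      using c h by (simp add: map_tt scal l)
  qed (use h in \<open>simp_all add: l\<close>)
  show ?thesis
  proof (unfold_locales)
    show "k_linear K L LL ?e" by (simp add: l)
  next
    fix g h assume g: "g \<in> carrier L" and h: "h \<in> carrier L"
    have "tsum L L LL (\<lambda>x y. x \<otimes>\<otimes> (y \<otimes>\<^bsub>L\<^esub> h)) (?e g) = proj (act_cofree (?R (tt \<one>\<^bsub>L\<^esub> \<one>\<^bsub>L\<^esub> g)) h)"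
      using g h by (simp add: B l)
    also have "\<dots> = proj (?R (act_cofree (tt \<one>\<^bsub>L\<^esub> \<one>\<^bsub>L\<^esub> g) h))"
      using R g h by (simp add: act_map_def)
    also have "act_cofree (tt \<one>\<^bsub>L\<^esub> \<one>\<^bsub>L\<^esub> g) h = tsum L L T (\<lambda>p q. tt \<one>\<^bsub>L\<^esub> p q) (twist g h)"
      using g h by (simp add: act_cofree_tt)
    also have "proj (?R (tsum L L T (\<lambda>p q. tt \<one>\<^bsub>L\<^esub> p q) (twist g h))) = tsum L L LL (\<lambda>p q. proj (?R (tt \<one>\<^bsub>L\<^esub> p q))) (twist g h)"
      by (rule linear_tsum[where K=K, where \<phi>="\<lambda>x. proj (?R x)"]) (use g h in \<open>simp_all add: l\<close>)
    also have "\<dots> = tsum L L LL (\<lambda>p q. tsum L L LL (\<lambda>x y. (p \<otimes>\<^bsub>L\<^esub> x) \<otimes>\<otimes> y) (?e q)) (twist g h)"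
      by (rule tsum_cong[OF refl], rule A)
    finally show "tsum L L LL (\<lambda>x y. x \<otimes>\<otimes> (y \<otimes>\<^bsub>L\<^esub> h)) (?e g) =
      tsum L L LL (\<lambda>p q. tsum L L LL (\<lambda>x y. (p \<otimes>\<^bsub>L\<^esub> x) \<otimes>\<otimes> y) (?e q)) (twist g h)" .
  next
    fix g assume g: "g \<in> carrier L"
    let ?\<mu> = "\<lambda>y. tsum L L L (\<lambda>x y. x \<otimes>\<^bsub>L\<^esub> y) (proj y)"
    have "merge (?R (tt \<one>\<^bsub>L\<^esub> \<one>\<^bsub>L\<^esub> g)) = Q (shift \<one>\<^bsub>L\<^esub>) (tt \<one>\<^bsub>L\<^esub> \<one>\<^bsub>L\<^esub> g)"
    proof (rule separatingD(2)[OF Q, OF probe_colinear id_yd(2,1) merge_yd(2,1), symmetric])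
      show "colin_endo (shift \<one>\<^bsub>L\<^esub>)" by (rule shift_yd) simp
      show "shift \<one>\<^bsub>L\<^esub> x = merge (probe x)" if "x \<in> carrier T" for x
        by (rule triple_ext[OF T _ _ _ that]) (simp_all add: l map_tt map_smult)
    qed (use g in simp)
    also have "\<dots> = shift \<one>\<^bsub>L\<^esub> (tt \<one>\<^bsub>L\<^esub> \<one>\<^bsub>L\<^esub> g)"
      by (rule separatingD(3)[OF Q]) (use g in \<open>simp_all add: shift_yd\<close>)
    also have "\<dots> = tt \<one>\<^bsub>L\<^esub> \<one>\<^bsub>L\<^esub> g" using g by (simp add: map_tt counit_one smult_one_L)
    finally have "?\<mu> (merge (?R (tt \<one>\<^bsub>L\<^esub> \<one>\<^bsub>L\<^esub> g))) = ?\<mu> (tt \<one>\<^bsub>L\<^esub> \<one>\<^bsub>L\<^esub> g)" by simp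
    moreover have "?\<mu> (merge y) = ?\<mu> y" if "y \<in> carrier T" for y
      by (rule triple_ext[OF _ _ _ _ that, where P=L and f="\<lambda>y. ?\<mu> (merge y)"])
        (simp_all add: l map_tt scal)
    moreover have "?\<mu> (tt \<one>\<^bsub>L\<^esub> \<one>\<^bsub>L\<^esub> g) = \<epsilon> g \<odot>\<^bsub>L\<^esub> \<one>\<^bsub>L\<^esub>"
      using g by (simp add: map_tt l scal)
    ultimately show "?\<mu> (?R (tt \<one>\<^bsub>L\<^esub> \<one>\<^bsub>L\<^esub> g)) = \<epsilon> g \<odot>\<^bsub>L\<^esub> \<one>\<^bsub>L\<^esub>"
      using g by (simp add: l)
  qed
qed

end

section \<open>From separability to \<open>\<theta>\<close>\<close>

text \<open>The free module with \<open>B = L \<otimes> L\<close> tests a family from \<open>L\<close>-linear to colinear maps. Its part with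
  \<open>B = 1 \<otimes> L\<close> carries the argument, through \<open>inc\<close> and its left inverse \<open>snd_L\<close>. The map \<open>probe\<close> sends
  \<open>(1 \<otimes> a) \<otimes> g \<otimes> l\<close> to \<open>\<epsilon>(g) (1 \<otimes> 1) \<otimes> a \<otimes> l\<close>. If the family comes from \<open>\<theta>\<close>, then the image of \<open>probe\<close>
  sends \<open>(1 \<otimes> g) \<otimes> h \<otimes> 1\<close> to an element whose projection \<open>proj2\<close>, the counit on all factors but the
  last, is \<open>\<theta>(g \<otimes> h)\<close>. The second factor of \<open>B\<close> is there for \<open>probe2\<close>, which receives both legs of \<open>\<Delta>(g)\<close> at
  once, so that the sum over \<open>\<Delta>(g)\<close> is formed inside the object and the family is applied to single maps.\<close>

locale triple_LL = triple K L "tensor_product K L L" T \<phi> \<psi>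
  for K :: "'k ring" and L :: "('k, 'l) hopf" and T :: "('k, 'u) module" and \<phi> \<psi>
begin

definition snd_L where "snd_L b = tsum L L L (\<lambda>x y. \<epsilon> x \<odot>\<^bsub>L\<^esub> y) b"

abbreviation inc where "inc a \<equiv> \<one>\<^bsub>L\<^esub> \<otimes>\<otimes> a"

definition probe where "probe x = ts T (\<lambda>b g l. \<epsilon> g \<odot>\<^bsub>T\<^esub> tt (inc \<one>\<^bsub>L\<^esub>) (snd_L b) l) x"
definition probe2 where
  "probe2 x = ts T (\<lambda>b g l. \<epsilon> g \<odot>\<^bsub>T\<^esub> tsum L L T (\<lambda>x y. tt (inc x) y l) b) x"
definition split where
  "split x = ts T (\<lambda>b g l. \<epsilon> (snd_L b) \<odot>\<^bsub>T\<^esub> sw T (\<lambda>g1 g2. tt (inc g1) g2 l) g) x"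
definition on_base where "on_base f x = ts T (\<lambda>b g l. tt (f b) g l) x"
definition proj0 where "proj0 x = ts LL (\<lambda>b g l. \<epsilon> (snd_L b) \<odot>\<^bsub>LL\<^esub> (g \<otimes>\<otimes> l)) x"
definition proj1 where "proj1 x = ts LL (\<lambda>b g l. \<epsilon> g \<odot>\<^bsub>LL\<^esub> (snd_L b \<otimes>\<otimes> l)) x"
definition proj2 where "proj2 x = ts L (\<lambda>b g l. \<epsilon> (snd_L b) \<odot>\<^bsub>L\<^esub> (\<epsilon> g \<odot>\<^bsub>L\<^esub> l)) x"
definition const_base where "const_base a b = \<epsilon> (snd_L b) \<odot>\<^bsub>LL\<^esub> inc a"
definition pair_base where "pair_base a b = a \<otimes>\<otimes> snd_L b"

lemma snd_L_linear: "k_linear K LL L snd_L"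
  unfolding snd_L_def[abs_def] by (simp add: tlin)

lemma snd_L_closed [simp]: "b \<in> carrier LL \<Longrightarrow> snd_L b \<in> carrier L"
  by (rule k_linear_closed[OF snd_L_linear])

lemma snd_L_tens: "\<lbrakk>x \<in> carrier L; y \<in> carrier L\<rbrakk> \<Longrightarrow> snd_L (x \<otimes>\<otimes> y) = \<epsilon> x \<odot>\<^bsub>L\<^esub> y"
  unfolding snd_L_def by (simp add: tlin)

lemmas flin0 = free_lin k_linear_comp[OF snd_L_linear]

lemma base_linear:
  "a \<in> carrier L \<Longrightarrow> k_linear K LL LL (const_base a)" "a \<in> carrier L \<Longrightarrow> k_linear K LL LL (pair_base a)"
  by (simp_all add: const_base_def[abs_def] pair_base_def[abs_def] flin0 snd_L_linear)

lemma
  assumes "b \<in> carrier LL" "g \<in> carrier L" "l \<in> carrier L"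
  shows probe_tt: "probe (tt b g l) = \<epsilon> g \<odot>\<^bsub>T\<^esub> tt (inc \<one>\<^bsub>L\<^esub>) (snd_L b) l"
    and probe2_tt: "probe2 (tt b g l) = \<epsilon> g \<odot>\<^bsub>T\<^esub> tsum L L T (\<lambda>x y. tt (inc x) y l) b"
    and split_tt: "split (tt b g l) = \<epsilon> (snd_L b) \<odot>\<^bsub>T\<^esub> sw T (\<lambda>g1 g2. tt (inc g1) g2 l) g"
    and on_base_tt: "k_linear K LL LL f \<Longrightarrow> on_base f (tt b g l) = tt (f b) g l"
    and proj0_tt: "proj0 (tt b g l) = \<epsilon> (snd_L b) \<odot>\<^bsub>LL\<^esub> (g \<otimes>\<otimes> l)"
    and proj1_tt: "proj1 (tt b g l) = \<epsilon> g \<odot>\<^bsub>LL\<^esub> (snd_L b \<otimes>\<otimes> l)"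
    and proj2_tt: "proj2 (tt b g l) = \<epsilon> (snd_L b) \<odot>\<^bsub>L\<^esub> (\<epsilon> g \<odot>\<^bsub>L\<^esub> l)"
  using assms
  by (simp_all add: probe_def probe2_def split_def on_base_def proj0_def proj1_def proj2_def flin0
      k_linear_comp[of K LL LL f] k_linear_closed[of K LL LL f])

lemma linear_maps:
  "k_linear K T T probe" "k_linear K T T probe2" "k_linear K T T split"
  "k_linear K T LL proj0" "k_linear K T LL proj1" "k_linear K T L proj2"
  by (simp_all add: probe_def[abs_def] probe2_def[abs_def] split_def[abs_def]
    proj0_def[abs_def] proj1_def[abs_def] proj2_def[abs_def] flin0)

lemma on_base_linear: "k_linear K LL LL f \<Longrightarrow> k_linear K T T (on_base f)"
  by (simp add: on_base_def[abs_def] flin0 k_linear_comp[of K LL LL f] k_linear_closed[of K LL LL f])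

lemmas flin = flin0 linear_maps linear_maps[THEN k_linear_comp] linear_maps[THEN k_linear_closed]
  on_base_linear on_base_linear[THEN k_linear_comp] on_base_linear[THEN k_linear_closed]
  base_linear base_linear[THEN k_linear_comp] base_linear[THEN k_linear_closed]
lemmas map_tt = probe_tt probe2_tt split_tt on_base_tt proj0_tt proj1_tt proj2_tt
lemmas map_smult = linear_maps[THEN k_linear_smult] on_base_linear[THEN k_linear_smult]
  k_linear_smult[OF coact_free_linear] k_linear_smult[OF snd_L_linear]

abbreviation "lin_endo \<equiv> act_map T act_free T act_free"
abbreviation "colin_endo \<equiv> coact_map T coact_free T coact_free"

lemma act_free_smult:
  "\<lbrakk>a \<in> carrier K; x \<in> carrier T; h \<in> carrier L\<rbrakk> \<Longrightarrow> act_free (a \<odot>\<^bsub>T\<^esub> x) h = a \<odot>\<^bsub>T\<^esub> act_free x h"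
  by (rule k_linear_smult[where f="\<lambda>x. act_free x h", OF bilin_left[OF act_free_bilin k_linear_id]])

lemma act_free_tsum:
  assumes "bilin K L L T f" "t \<in> carrier LL" "h \<in> carrier L"
  shows "act_free (tsum L L T f t) h = tsum L L T (\<lambda>p q. act_free (f p q) h) t"
  by (rule linear_tsum[where K=K, where \<phi>="\<lambda>x. act_free x h"]) (use assms in \<open>simp_all add: flin\<close>)

lemma linear_T_tsum:
  assumes "k_linear K T P F" "module K P" "bilin K L L T f" "t \<in> carrier LL"
  shows "F (tsum L L T f t) = tsum L L P (\<lambda>p q. F (f p q)) t"
  by (rule linear_tsum[where K=K]) (use assms in simp_all)

lemmas maps_tsum = linear_maps[THEN linear_T_tsum]

lemma probe_lin: "lin_endo probe"
  by (rule act_mapI[OF act_free_bilin linear_maps(1)])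
    (simp add: map_tt act_free_tt act_free_smult flin)

lemma probe2_lin: "lin_endo probe2"
  by (rule act_mapI[OF act_free_bilin linear_maps(2)])
    (simp add: map_tt act_free_tt act_free_smult act_free_tsum flin)

lemma split_yd: "lin_endo split" "colin_endo split"
proof -
  show "lin_endo split"
    by (rule act_mapI[OF act_free_bilin linear_maps(3)])
      (simp add: map_tt act_free_tt act_free_smult act_free_tsum flin)
  show "colin_endo split"
  proof (rule coact_mapI[OF coact_free_linear linear_maps(3)])
    fix b g l assume c: "b \<in> carrier LL" "g \<in> carrier L" "l \<in> carrier L"
    have "coact_free (split (tt b g l)) = \<epsilon> (snd_L b) \<odot>\<^bsub>TL\<^esub> coact_free (sw T (\<lambda>g1 g2. tt (inc g1) g2 l) g)"
      using c by (simp add: map_tt map_smult flin)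
    also have "coact_free (sw T (\<lambda>g1 g2. tt (inc g1) g2 l) g) = sw TL (\<lambda>g1 g2. coact_free (tt (inc g1) g2 l)) g"
      by (rule linear_T_tsum) (use c in \<open>simp_all add: flin\<close>)
    also have "\<dots> = sw TL (\<lambda>g1 g2. sw TL (\<lambda>g21 g22. tsum L L TL (\<lambda>p q. tens K T L (tt (inc g1) g21 p) q) (twist g22 l)) g2) g"
      by (rule tsum_cong[OF refl]) (use c in \<open>simp add: coact_free_tt\<close>)
    also have "\<dots> = sw TL (\<lambda>g1 g2. sw TL (\<lambda>g11 g12. tsum L L TL (\<lambda>p q. tens K T L (tt (inc g11) g12 p) q) (twist g2 l)) g1) g"
      by (rule sw_coassoc[symmetric]) (use c in \<open>simp_all add: flin\<close>)
    also have "\<dots> = sw TL (\<lambda>g1 g2. tsum L L TL (\<lambda>p q. sw TL (\<lambda>g11 g12. tens K T L (tt (inc g11) g12 p) q) g1) (twist g2 l)) g"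
      by (rule tsum_cong[OF refl], rule tsum_swap[where K=K]) (use c in \<open>simp_all add: flin\<close>)
    also have "\<dots> = sw TL (\<lambda>g1 g2. tsum L L TL (\<lambda>p q. tens K T L (sw T (\<lambda>g11 g12. tt (inc g11) g12 p) g1) q) (twist g2 l)) g"
      by (rule tsum_cong[OF refl], rule tsum_cong[OF refl], rule linear_tsum[where K=K, where \<phi>="\<lambda>x. tens K T L x q" for q, symmetric])
        (use c in \<open>simp_all add: flin\<close>)
    finally have "coact_free (split (tt b g l)) = \<epsilon> (snd_L b) \<odot>\<^bsub>TL\<^esub> sw TL (\<lambda>g1 g2. tsum L L TL (\<lambda>p q.
        tens K T L (sw T (\<lambda>g11 g12. tt (inc g11) g12 p) g1) q) (twist g2 l)) g" .
    then show "coact_free (split (tt b g l)) = tsum T L TL (\<lambda>x y. tens K T L (split x) y) (coact_free (tt b g l))"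
      using c by (simp add: coact_free_tt tsum_K map_tt tens_smult_left flin)
  qed
qed

lemma on_base_yd:
  assumes "k_linear K LL LL f" shows "lin_endo (on_base f)" "colin_endo (on_base f)"
proof -
  note f = k_linear_comp[OF assms] k_linear_closed[OF assms]
  show "lin_endo (on_base f)"
    by (rule act_mapI[OF act_free_bilin on_base_linear[OF assms]])
      (use assms in \<open>simp add: map_tt act_free_tt flin f\<close>)
  show "colin_endo (on_base f)"
    by (rule coact_mapI[OF coact_free_linear on_base_linear[OF assms]])
      (use assms in \<open>simp add: map_tt coact_free_tt tsum_K flin f\<close>)
qed

lemma id_yd: "lin_endo (\<lambda>x. x)" "colin_endo (\<lambda>x. x)"
  by (simp_all add: act_map_def coact_map_def k_linear_id flin)

text \<open>Let \<open>R\<close> be the image of \<open>probe\<close>. From \<open>split \<circ> probe = probe2 \<circ> on_base dl\<close> and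
  \<open>probe2 \<circ> on_base (pair_base a) = on_base (const_base a) \<circ> probe\<close> follows
  \<open>proj0 (R((1 \<otimes> g) \<otimes> h \<otimes> 1)) = \<Sum> g\<^sub>1 \<otimes> \<theta>(g\<^sub>2 \<otimes> h)\<close>, named \<open>star\<close>. Colinearity of \<open>R\<close>, with the counit applied to all
  factors but the last two, then becomes the first condition, and \<open>probe \<circ> split = on_base (const_base 1)\<close>
  gives the second.\<close>

theorem theta_exists:
  assumes Q: "separating (carrier T) lin_endo colin_endo Q"
  shows "theta K L (tsum L L L (\<lambda>g h. proj2 (Q probe (tt (inc g) h \<one>\<^bsub>L\<^esub>))))"
proof -
  let ?R = "Q probe"
  let ?\<theta> = "tsum L L L (\<lambda>g h. proj2 (?R (tt (inc g) h \<one>\<^bsub>L\<^esub>)))"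
  have R: "colin_endo ?R" by (rule separatingD(1)[OF Q, OF probe_lin])
  then have Rl: "k_linear K T T ?R" by (simp add: coact_map_def)
  have R2: "colin_endo (Q probe2)" by (rule separatingD(1)[OF Q, OF probe2_lin])
  then have R2l: "k_linear K T T (Q probe2)" by (simp add: coact_map_def)
  note l = flin Rl k_linear_comp[OF Rl] k_linear_closed[OF Rl] k_linear_comp[OF R2l] k_linear_closed[OF R2l]
  have \<theta>: "?\<theta> (g \<otimes>\<otimes> h) = proj2 (?R (tt (inc g) h \<one>\<^bsub>L\<^esub>))" if "g \<in> carrier L" "h \<in> carrier L" for g h
    using that by (simp add: l)
  have lin\<theta>: "k_linear K LL L ?\<theta>" by (simp add: l tsum_linear)
  note l = l k_linear_comp[OF lin\<theta>] k_linear_closed[OF lin\<theta>]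
  define dl where "dl b = \<Delta> (snd_L b)" for b
  have dl: "k_linear K LL LL dl" unfolding dl_def by (simp add: l)
  have split_R: "split (?R x) = Q probe2 (on_base dl x)" if x: "x \<in> carrier T" for x
  proof (rule separating_comp[OF Q, OF probe_lin id_yd split_yd _ probe2_lin on_base_yd[OF dl] id_yd _ x])
    show "split (probe x) = probe2 (on_base dl x)" if "x \<in> carrier T" for x
      by (rule triple_ext[OF T _ _ _ that, where f="\<lambda>x. split (probe x)"])
        (use dl in \<open>simp_all add: l map_tt map_smult snd_L_tens counit_one smult_one_L dl_def\<close>)
    show "lin_endo (\<lambda>x. split (probe x))"
      by (rule act_mapI[OF act_free_bilin])
        (simp_all add: l map_tt map_smult snd_L_tens counit_one smult_one_L act_free_tt act_free_smult act_free_tsum)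
  qed
  have R_pair: "Q probe2 (on_base (pair_base a) x) = on_base (const_base a) (?R x)"
    if a: "a \<in> carrier L" and x: "x \<in> carrier T" for a x
  proof (rule separating_comp[OF Q, OF probe2_lin on_base_yd[OF base_linear(2)[OF a]] id_yd _ probe_lin id_yd
        on_base_yd[OF base_linear(1)[OF a]] _ x])
    show "probe2 (on_base (pair_base a) x) = on_base (const_base a) (probe x)" if "x \<in> carrier T" for x
      by (rule triple_ext[OF T _ _ _ that, where f="\<lambda>x. probe2 (on_base (pair_base a) x)"])
        (use a in \<open>simp_all add: l map_tt map_smult snd_L_tens counit_one smult_one_L pair_base_def const_base_def\<close>)
    show "lin_endo (\<lambda>x. probe2 (on_base (pair_base a) x))"
      by (rule act_mapI[OF act_free_bilin])
        (use a in \<open>simp_all add: l map_tt act_free_tt act_free_smult act_free_tsum\<close>)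
  qed
  have R_split: "?R (split x) = on_base (const_base \<one>\<^bsub>L\<^esub>) x" if x: "x \<in> carrier T" for x
  proof -
    have "Q (on_base (const_base \<one>\<^bsub>L\<^esub>)) x = ?R (split x)"
    proof (rule separatingD(2)[OF Q, OF probe_lin split_yd id_yd _ _ x])
      show "lin_endo (on_base (const_base \<one>\<^bsub>L\<^esub>))" by (rule on_base_yd) (simp add: l)
      show "on_base (const_base \<one>\<^bsub>L\<^esub>) x = probe (split x)" if "x \<in> carrier T" for x
        by (rule triple_ext[OF T _ _ _ that])
          (simp_all add: l map_tt map_smult maps_tsum snd_L_tens counit_one smult_one_L const_base_def tt_smult)
    qed
    moreover have "Q (on_base (const_base \<one>\<^bsub>L\<^esub>)) x = on_base (const_base \<one>\<^bsub>L\<^esub>) x"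
      by (rule separatingD(3)[OF Q]) (use x in \<open>simp_all add: on_base_yd base_linear\<close>)
    ultimately show ?thesis by simp
  qed
  have p1: "proj1 (split y) = proj0 y" if "y \<in> carrier T" for y
    by (rule triple_ext[OF _ _ _ _ that, where P=LL and f="\<lambda>y. proj1 (split y)"])
      (simp_all add: l map_tt map_smult maps_tsum snd_L_tens counit_one smult_one_L)
  have p2: "proj1 (on_base (const_base a) y) = a \<otimes>\<otimes> proj2 y" if a: "a \<in> carrier L" and "y \<in> carrier T" for a y
    by (rule triple_ext[OF _ _ _ _ that(2), where P=LL and f="\<lambda>y. proj1 (on_base (const_base a) y)"])
      (use a in \<open>simp_all add: l map_tt map_smult const_base_def snd_L_tens counit_one smult_one_L
        tt_smult tens_smult_left tens_smult_right smult_swap[of K LL]\<close>)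
  have star: "proj0 (?R (tt (inc g) h \<one>\<^bsub>L\<^esub>)) = sw LL (\<lambda>g1 g2. g1 \<otimes>\<otimes> ?\<theta> (g2 \<otimes>\<otimes> h)) g"
    if g: "g \<in> carrier L" "h \<in> carrier L" for g h
  proof -
    have "proj0 (?R (tt (inc g) h \<one>\<^bsub>L\<^esub>)) = proj1 (Q probe2 (tt (\<Delta> g) h \<one>\<^bsub>L\<^esub>))"
      using g dl by (simp add: p1[symmetric] split_R l map_tt dl_def snd_L_tens counit_one smult_one_L)
    also have "tt (\<Delta> g) h \<one>\<^bsub>L\<^esub> = tt (sw LL (\<lambda>g1 g2. g1 \<otimes>\<otimes> g2) g) h \<one>\<^bsub>L\<^esub>"
      using g by simp
    also have "\<dots> = sw T (\<lambda>g1 g2. tt (g1 \<otimes>\<otimes> g2) h \<one>\<^bsub>L\<^esub>) g"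
      by (rule linear_tsum[where K=K, where \<phi>="\<lambda>x. tt x h \<one>\<^bsub>L\<^esub>"]) (use g in \<open>simp_all add: l\<close>)
    also have "proj1 (Q probe2 \<dots>) = sw LL (\<lambda>g1 g2. proj1 (Q probe2 (tt (g1 \<otimes>\<otimes> g2) h \<one>\<^bsub>L\<^esub>))) g"
      by (rule linear_tsum[where K=K, where \<phi>="\<lambda>x. proj1 (Q probe2 x)"]) (use g in \<open>simp_all add: l\<close>)
    also have "\<dots> = sw LL (\<lambda>g1 g2. g1 \<otimes>\<otimes> proj2 (?R (tt (inc g2) h \<one>\<^bsub>L\<^esub>))) g"
    proof (rule tsum_cong[OF refl])
      fix g1 g2 assume c: "g1 \<in> carrier L" "g2 \<in> carrier L"
      have "tt (g1 \<otimes>\<otimes> g2) h \<one>\<^bsub>L\<^esub> = on_base (pair_base g1) (tt (inc g2) h \<one>\<^bsub>L\<^esub>)"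
        using c g by (simp add: map_tt l pair_base_def snd_L_tens counit_one smult_one_L)
      then show "proj1 (Q probe2 (tt (g1 \<otimes>\<otimes> g2) h \<one>\<^bsub>L\<^esub>)) = g1 \<otimes>\<otimes> proj2 (?R (tt (inc g2) h \<one>\<^bsub>L\<^esub>))"
        using c g by (simp add: R_pair p2 l)
    qed
    finally show ?thesis using g by (simp add: \<theta>)
  qed
  have coact: "tsum T L LL (\<lambda>x z. proj2 x \<otimes>\<otimes> z) (coact_free y) = tsum L L LL twist (proj0 y)"
    if "y \<in> carrier T" for y
  proof (rule triple_ext[OF _ _ _ _ that, where P=LL and f="\<lambda>y. tsum T L LL (\<lambda>x z. proj2 x \<otimes>\<otimes> z) (coact_free y)"])
    fix b g l assume c: "b \<in> carrier LL" "g \<in> carrier L" "l \<in> carrier L"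
    have "tsum T L LL (\<lambda>x z. proj2 x \<otimes>\<otimes> z) (coact_free (tt b g l)) =
      \<epsilon> (snd_L b) \<odot>\<^bsub>LL\<^esub> sw LL (\<lambda>g1 g2. \<epsilon> g1 \<odot>\<^bsub>LL\<^esub> twist g2 l) g"
      using c by (simp add: coact_free_tt tsum_K map_tt tens_smult_left l)
    also have "\<dots> = \<epsilon> (snd_L b) \<odot>\<^bsub>LL\<^esub> twist g l"
      using c by (simp add: l)
    finally show "tsum T L LL (\<lambda>x z. proj2 x \<otimes>\<otimes> z) (coact_free (tt b g l)) = tsum L L LL twist (proj0 (tt b g l))"
      using c by (simp add: map_tt tsum_smult_arg bilin_twist)
  qed (simp_all add: l bilin_twist)
  show ?thesis
  proof (unfold_locales)
    show "k_linear K LL L ?\<theta>" by (rule lin\<theta>)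
  next
    fix g h assume g: "g \<in> carrier L" and h: "h \<in> carrier L"
    have \<rho>: "coact_free (tt (inc g) h \<one>\<^bsub>L\<^esub>) = sw TL (\<lambda>h1 h2. tens K T L (tt (inc g) h1 \<one>\<^bsub>L\<^esub>) h2) h"
      using g h by (simp add: coact_free_tt twist_one l)
    have "coact_free (?R (tt (inc g) h \<one>\<^bsub>L\<^esub>)) = sw TL (\<lambda>h1 h2. tens K T L (?R (tt (inc g) h1 \<one>\<^bsub>L\<^esub>)) h2) h"
      using R g h by (simp add: coact_map_def \<rho> tsum_K l)
    then have "tsum L L LL twist (proj0 (?R (tt (inc g) h \<one>\<^bsub>L\<^esub>))) = sw LL (\<lambda>h1 h2. ?\<theta> (g \<otimes>\<otimes> h1) \<otimes>\<otimes> h2) h"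
      using g h by (simp add: coact[symmetric] tsum_K \<theta> l)
    moreover have "tsum L L LL twist (proj0 (?R (tt (inc g) h \<one>\<^bsub>L\<^esub>))) = sw LL (\<lambda>g1 g2. twist g1 (?\<theta> (g2 \<otimes>\<otimes> h))) g"
    proof -
      have "tsum L L LL twist (sw LL (\<lambda>g1 g2. g1 \<otimes>\<otimes> ?\<theta> (g2 \<otimes>\<otimes> h)) g) =
        sw LL (\<lambda>g1 g2. tsum L L LL twist (g1 \<otimes>\<otimes> ?\<theta> (g2 \<otimes>\<otimes> h))) g"
        by (rule linear_tsum[where K=K, OF _ _ _ _ _ tsum_linear[OF _ _ _ bilin_twist]]) (use g h in \<open>simp_all add: l\<close>)
      also have "\<dots> = sw LL (\<lambda>g1 g2. twist g1 (?\<theta> (g2 \<otimes>\<otimes> h))) g"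
        by (rule tsum_cong[OF refl], rule tsum_tens[OF _ _ _ bilin_twist]) (use g h in \<open>simp_all add: l\<close>)
      finally show ?thesis by (simp only: star[OF g h])
    qed
    ultimately show "sw LL (\<lambda>h1 h2. ?\<theta> (g \<otimes>\<otimes> h1) \<otimes>\<otimes> h2) h = sw LL (\<lambda>g1 g2. twist g1 (?\<theta> (g2 \<otimes>\<otimes> h))) g"
      by simp
  next
    fix h assume h: "h \<in> carrier L"
    have "?\<theta> (\<Delta> h) = proj2 (?R (sw T (\<lambda>h1 h2. tt (inc h1) h2 \<one>\<^bsub>L\<^esub>) h))"
      by (rule linear_tsum[where K=K, where \<phi>="\<lambda>x. proj2 (?R x)", symmetric]) (use h in \<open>simp_all add: l\<close>)
    also have "\<dots> = proj2 (?R (split (tt (inc \<one>\<^bsub>L\<^esub>) h \<one>\<^bsub>L\<^esub>)))"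
      using h by (simp add: map_tt snd_L_tens counit_one smult_one_L l)
    also have "\<dots> = proj2 (on_base (const_base \<one>\<^bsub>L\<^esub>) (tt (inc \<one>\<^bsub>L\<^esub>) h \<one>\<^bsub>L\<^esub>))"
      by (rule arg_cong[of _ _ proj2], rule R_split) (use h in simp)
    also have "\<dots> = \<epsilon> h \<odot>\<^bsub>L\<^esub> \<one>\<^bsub>L\<^esub>"
      using h by (simp add: map_tt l const_base_def snd_L_tens counit_one smult_one_L)
    finally show "?\<theta> (\<Delta> h) = \<epsilon> h \<odot>\<^bsub>L\<^esub> \<one>\<^bsub>L\<^esub>" .
  qed
qed

end

section \<open>Dual bases\<close>

lemma linear_zero:
  assumes "module K M" "module K N" "k_linear K M N f" shows "f \<zero>\<^bsub>M\<^esub> = \<zero>\<^bsub>N\<^esub>"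
proof -
  interpret M: module K M by fact
  interpret N: module K N by fact
  have "f (\<zero>\<^bsub>K\<^esub> \<odot>\<^bsub>M\<^esub> \<zero>\<^bsub>M\<^esub>) = \<zero>\<^bsub>K\<^esub> \<odot>\<^bsub>N\<^esub> f \<zero>\<^bsub>M\<^esub>"
    by (rule k_linear_smult[OF assms(3)]) simp_all
  then show ?thesis using k_linear_closed[OF assms(3)] by simp
qed

lemma linear_finsum:
  assumes "module K M" "module K N" "k_linear K M N f" "finite A" "h \<in> A \<rightarrow> carrier M"
  shows "f (\<Oplus>\<^bsub>M\<^esub>a\<in>A. h a) = (\<Oplus>\<^bsub>N\<^esub>a\<in>A. f (h a))"
proof -
  interpret M: module K M by fact
  interpret N: module K N by fact
  show ?thesis using assms(4,5)
  proof (induction rule: finite_induct)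
    case empty
    then show ?case using linear_zero[OF assms(1-3)] by simp
  next
    case (insert a A)
    have h: "h a \<in> carrier M" "h \<in> A \<rightarrow> carrier M" using insert by auto
    moreover have "(\<lambda>a. f (h a)) \<in> A \<rightarrow> carrier N" using h k_linear_closed[OF assms(3)] by auto
    moreover have "(\<Oplus>\<^bsub>M\<^esub>a\<in>A. h a) \<in> carrier M" using h by (intro M.M.finsum_closed)
    ultimately show ?case using insert k_linear_closed[OF assms(3) h(1)]
      by (simp add: k_linear_add[OF assms(3)])
  qed
qed

lemma linear_finsum_maps:
  assumes "module K N" "module K M" "finite A" "\<And>a. a \<in> A \<Longrightarrow> k_linear K M N (h a)"
  shows "k_linear K M N (\<lambda>x. \<Oplus>\<^bsub>N\<^esub>a\<in>A. h a x)"
proof -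
  interpret N: module K N by fact
  interpret M: module K M by fact
  show ?thesis using assms(3,4)
  proof (induction rule: finite_induct)
    case empty
    then show ?case by (simp add: k_linear_def N.smult_r_null)
  next
    case (insert a A)
    have "k_linear K M N (\<lambda>x. h a x \<oplus>\<^bsub>N\<^esub> (\<Oplus>\<^bsub>N\<^esub>a\<in>A. h a x))"
      using insert assms by (intro k_linear_plus) auto
    moreover have "(\<Oplus>\<^bsub>N\<^esub>a\<in>insert a A. h a x) = h a x \<oplus>\<^bsub>N\<^esub> (\<Oplus>\<^bsub>N\<^esub>a\<in>A. h a x)" if "x \<in> carrier M" for x
      using insert k_linear_closed[OF insert.prems that] by (intro N.M.finsum_insert) auto
    ultimately show ?case
      by (rule k_linear_cong[OF _ assms(2) sym])
  qed
qed

lemma PiE_lepoll: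
  assumes "infinite (UNIV :: 'u set)" "C \<lesssim> (UNIV :: 'u set)" "finite A"
  shows "(A \<rightarrow>\<^sub>E C) \<lesssim> (UNIV :: 'u set)"
  using assms(3)
proof (induction rule: finite_induct)
  case empty
  have "finite ({} \<rightarrow>\<^sub>E C)" by simp
  then show ?case using assms(1) by (rule finite_lepoll_infinite[rotated])
next
  case (insert a A)
  have "inj_on (\<lambda>f. (f a, restrict f A)) (insert a A \<rightarrow>\<^sub>E C)"
  proof (rule inj_onI)
    fix f g assume f: "f \<in> insert a A \<rightarrow>\<^sub>E C" and g: "g \<in> insert a A \<rightarrow>\<^sub>E C"
      and e: "(f a, restrict f A) = (g a, restrict g A)"
    show "f = g"
    proof (rule PiE_ext[OF f g])
      fix x assume "x \<in> insert a A"
      then show "f x = g x" using e by (auto dest: fun_cong[of _ _ x])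
    qed
  qed
  then have "(insert a A \<rightarrow>\<^sub>E C) \<lesssim> C \<times> (A \<rightarrow>\<^sub>E C)"
    unfolding lepoll_def by (intro exI[of _ "\<lambda>f. (f a, restrict f A)"]) auto
  also have "\<dots> \<lesssim> (UNIV :: 'u set)"
    by (rule times_lepoll_universe[OF assms(1,2) insert.IH])
  finally show ?case .
qed

text \<open>The isomorphism from \<open>M\<close> to its copy in the universe is lifted along the projection from a copy of the
  free module \<open>K\<^sup>A\<close>, which fits into the universe because \<open>K\<close> does; \<open>\<phi> a\<close> is the coordinate at \<open>a\<close> of the
  lift.\<close>

lemma dual_basis:
  fixes M :: "('k, 'm, 'x) module_scheme"
  assumes M: "module K M" and fg: "finitely_generated K M" and proj: "projective_module TYPE('u) K M"
    and inf: "infinite (UNIV :: 'u set)" and le: "carrier K \<lesssim> (UNIV :: 'u set)" "carrier M \<lesssim> (UNIV :: 'u set)"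
  obtains A \<phi> where "finite A" "A \<subseteq> carrier M"
    "\<forall>a\<in>A. \<forall>x\<in>carrier M. \<phi> a x \<in> carrier K"
    "\<forall>a\<in>A. \<forall>x\<in>carrier M. \<forall>y\<in>carrier M. \<phi> a (x \<oplus>\<^bsub>M\<^esub> y) = \<phi> a x \<oplus>\<^bsub>K\<^esub> \<phi> a y"
    "\<forall>a\<in>A. \<forall>c\<in>carrier K. \<forall>x\<in>carrier M. \<phi> a (c \<odot>\<^bsub>M\<^esub> x) = c \<otimes>\<^bsub>K\<^esub> \<phi> a x"
    "\<forall>x\<in>carrier M. (\<Oplus>\<^bsub>M\<^esub>a\<in>A. \<phi> a x \<odot>\<^bsub>M\<^esub> a) = x"
proof -
  interpret M: module K M by fact
  obtain A where A: "finite A" "A \<subseteq> carrier M"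
    and gen: "\<And>x. x \<in> carrier M \<Longrightarrow> \<exists>c\<in>A \<rightarrow> carrier K. x = (\<Oplus>\<^bsub>M\<^esub>a\<in>A. c a \<odot>\<^bsub>M\<^esub> a)"
    using fg unfolding finitely_generated_def by blast
  define F :: "('k, 'm \<Rightarrow> 'k) module" where "F = \<lparr>carrier = A \<rightarrow>\<^sub>E carrier K, monoid.mult = undefined, one = undefined,
    ring.zero = (\<lambda>a\<in>A. \<zero>\<^bsub>K\<^esub>), ring.add = (\<lambda>f g. \<lambda>a\<in>A. f a \<oplus>\<^bsub>K\<^esub> g a), smult = (\<lambda>c f. \<lambda>a\<in>A. c \<otimes>\<^bsub>K\<^esub> f a)\<rparr>"
  have FK: "f a \<in> carrier K" if "f \<in> carrier F" "a \<in> A" for f a using that by (auto simp: F_def)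
  have Fext: "f = g" if "f \<in> carrier F" "g \<in> carrier F" "\<And>a. a \<in> A \<Longrightarrow> f a = g a" for f g
    using that unfolding F_def by (auto intro: PiE_ext)
  have F: "module K F"
  proof (rule moduleI[OF M.R.is_cring])
    show "abelian_group F"
    proof (rule abelian_groupI)
      fix f assume f: "f \<in> carrier F"
      show "\<exists>g\<in>carrier F. g \<oplus>\<^bsub>F\<^esub> f = \<zero>\<^bsub>F\<^esub>"
        by (rule bexI[of _ "\<lambda>a\<in>A. \<ominus>\<^bsub>K\<^esub> f a"]) (use FK[OF f] in \<open>auto simp: F_def M.R.l_neg intro!: restrict_ext\<close>)
    next
      fix f g h assume f: "f \<in> carrier F" and g: "g \<in> carrier F"
      show "f \<oplus>\<^bsub>F\<^esub> g = g \<oplus>\<^bsub>F\<^esub> f"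
        using FK[OF f] FK[OF g] by (auto simp: F_def M.R.a_comm intro!: restrict_ext)
      assume h: "h \<in> carrier F"
      show "f \<oplus>\<^bsub>F\<^esub> g \<oplus>\<^bsub>F\<^esub> h = f \<oplus>\<^bsub>F\<^esub> (g \<oplus>\<^bsub>F\<^esub> h)"
        using FK[OF f] FK[OF g] FK[OF h] by (auto simp: F_def M.R.a_assoc intro!: restrict_ext)
    next
      fix f assume f: "f \<in> carrier F"
      show "\<zero>\<^bsub>F\<^esub> \<oplus>\<^bsub>F\<^esub> f = f"
        by (rule Fext) (use f FK[OF f] in \<open>auto simp: F_def\<close>)
    qed (auto simp: F_def)
  next
    fix f assume f: "f \<in> carrier F"
    show "\<one>\<^bsub>K\<^esub> \<odot>\<^bsub>F\<^esub> f = f"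
      by (rule Fext) (use f FK[OF f] in \<open>auto simp: F_def\<close>)
  qed (auto simp: F_def M.R.l_distr M.R.r_distr M.R.m_assoc PiE_mem[of _ A "\<lambda>_. carrier K"] intro!: restrict_ext)
  have Fle: "carrier F \<lesssim> (UNIV :: 'u set)"
    using PiE_lepoll[OF inf le(1) A(1)] by (simp add: F_def)
  obtain U :: "('k, 'u) module" and \<alpha> \<alpha>' where U: "module K U" "k_linear K F U \<alpha>" "k_linear K U F \<alpha>'"
    "\<forall>x\<in>carrier F. \<alpha>' (\<alpha> x) = x" "\<forall>y\<in>carrier U. \<alpha> (\<alpha>' y) = y"
    by (rule module_copy[OF F Fle])
  obtain V :: "('k, 'u) module" and \<beta> \<beta>' where V: "module K V" "k_linear K M V \<beta>" "k_linear K V M \<beta>'"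
    "\<forall>x\<in>carrier M. \<beta>' (\<beta> x) = x" "\<forall>y\<in>carrier V. \<beta> (\<beta>' y) = y"
    by (rule module_copy[OF M le(2)])
  define p0 where "p0 c = (\<Oplus>\<^bsub>M\<^esub>a\<in>A. c a \<odot>\<^bsub>M\<^esub> a)" for c
  have p0: "k_linear K F M p0"
    unfolding p0_def[abs_def]
    by (rule linear_finsum_maps[OF M F A(1)])
      (use A(2) FK in \<open>auto simp: k_linear_def F_def M.smult_l_distr M.smult_assoc1 intro!: M.smult_closed\<close>)
  let ?p = "\<lambda>y. \<beta> (p0 (\<alpha>' y))"
  have p: "k_linear K U V ?p"
    by (rule k_linear_comp[OF V(2)], rule k_linear_comp[OF p0], rule U(3))
  have surj: "?p ` carrier U = carrier V"
  proof
    show "?p ` carrier U \<subseteq> carrier V" using k_linear_closed[OF p] by auto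
    show "carrier V \<subseteq> ?p ` carrier U"
    proof
      fix v assume v: "v \<in> carrier V"
      obtain c where c: "c \<in> A \<rightarrow> carrier K" "\<beta>' v = (\<Oplus>\<^bsub>M\<^esub>a\<in>A. c a \<odot>\<^bsub>M\<^esub> a)"
        using gen k_linear_closed[OF V(3) v] by metis
      let ?c = "restrict c A"
      have cF: "?c \<in> carrier F" using c by (auto simp: F_def)
      have "p0 ?c = \<beta>' v"
        unfolding p0_def c(2) using c(1) A(2) by (intro M.M.finsum_cong') auto
      then have "?p (\<alpha> ?c) = v" using U(4) V(5) cF v by simp
      then show "v \<in> ?p ` carrier U" using k_linear_closed[OF U(2) cF] by force
    qed
  qed
  obtain g where g: "k_linear K M U g" "\<And>x. x \<in> carrier M \<Longrightarrow> ?p (g x) = \<beta> x"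
    using proj[unfolded projective_module_def, rule_format, of U V ?p \<beta>] U(1) V(1,2) p surj by blast
  let ?f = "\<lambda>x. \<alpha>' (g x)"
  have f: "k_linear K M F ?f" by (rule k_linear_comp[OF U(3) g(1)])
  show thesis
  proof (rule that[OF A, of "\<lambda>a x. ?f x a"]; intro ballI)
    fix a x y assume a: "a \<in> A" "x \<in> carrier M"
    show "?f x a \<in> carrier K" using k_linear_closed[OF f a(2)] a(1) by (rule FK)
    { assume y: "y \<in> carrier M"
      show "?f (x \<oplus>\<^bsub>M\<^esub> y) a = ?f x a \<oplus>\<^bsub>K\<^esub> ?f y a"
        using a k_linear_add[OF f a(2) y] by (simp add: F_def) }
    fix c assume "c \<in> carrier K"
    then show "?f (c \<odot>\<^bsub>M\<^esub> x) a = c \<otimes>\<^bsub>K\<^esub> ?f x a"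
      using a k_linear_smult[OF f _ a(2)] by (simp add: F_def)
  next
    fix x assume x: "x \<in> carrier M"
    have "p0 (?f x) \<in> carrier M" using k_linear_closed[OF p0 k_linear_closed[OF f x]] .
    then show "(\<Oplus>\<^bsub>M\<^esub>a\<in>A. ?f x a \<odot>\<^bsub>M\<^esub> a) = x"
      using g(2)[OF x] V(4) x by (metis p0_def)
  qed
qed

section \<open>The module of endomorphisms\<close>

lemma module_End:
  assumes "module K M" shows "module K (End_module K M)"
proof -
  interpret M: module K M by fact
  let ?E = "End_module K M"
  have c: "f x \<in> carrier M" if "f \<in> carrier ?E" "x \<in> carrier M" for f x
    using that by (auto simp: End_module_def k_linear_def)
  have ext: "f = g" if "f \<in> carrier ?E" "g \<in> carrier ?E" "\<And>x. x \<in> carrier M \<Longrightarrow> f x = g x" for f g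
    using that by (auto simp: End_module_def intro: extensionalityI)
  have r: "k_linear K M M (restrict f (carrier M)) = k_linear K M M f" for f
    by (auto simp: k_linear_def Pi_def)
  have zero: "k_linear K M M (\<lambda>x. \<zero>\<^bsub>M\<^esub>)" by (simp add: k_linear_def M.smult_r_null)
  have lin: "k_linear K M M f" if "f \<in> carrier ?E" for f using that by (simp add: End_module_def)
  have E: "carrier ?E = {f \<in> extensional (carrier M). k_linear K M M f}"
    "\<zero>\<^bsub>?E\<^esub> = (\<lambda>x\<in>carrier M. \<zero>\<^bsub>M\<^esub>)" "f \<oplus>\<^bsub>?E\<^esub> g = (\<lambda>x\<in>carrier M. f x \<oplus>\<^bsub>M\<^esub> g x)"
    "a \<odot>\<^bsub>?E\<^esub> f = (\<lambda>x\<in>carrier M. a \<odot>\<^bsub>M\<^esub> f x)" for f g a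
    by (simp_all add: End_module_def)
  have add: "f \<oplus>\<^bsub>?E\<^esub> g \<in> carrier ?E" if "f \<in> carrier ?E" "g \<in> carrier ?E" for f g
    using that by (simp add: E r k_linear_plus assms)
  have sm: "a \<odot>\<^bsub>?E\<^esub> f \<in> carrier ?E" if "a \<in> carrier K" "f \<in> carrier ?E" for f a
    using that by (simp add: E r k_linear_smult_right assms)
  have z: "\<zero>\<^bsub>?E\<^esub> \<in> carrier ?E" using zero by (simp add: E r)
  note pt = E(2-4)
  show ?thesis
  proof (rule moduleI[OF M.R.is_cring])
    show "abelian_group ?E"
    proof (rule abelian_groupI)
      fix f assume f: "f \<in> carrier ?E"
      have m: "(\<ominus>\<^bsub>K\<^esub> \<one>\<^bsub>K\<^esub>) \<odot>\<^bsub>?E\<^esub> f \<in> carrier ?E" using f by (intro sm) simp_all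
      have "((\<ominus>\<^bsub>K\<^esub> \<one>\<^bsub>K\<^esub>) \<odot>\<^bsub>?E\<^esub> f) \<oplus>\<^bsub>?E\<^esub> f = \<zero>\<^bsub>?E\<^esub>"
        by (rule ext[OF add[OF m f] z]) (use c[OF f] in \<open>simp add: pt M.smult_l_minus M.M.l_neg\<close>)
      then show "\<exists>g\<in>carrier ?E. g \<oplus>\<^bsub>?E\<^esub> f = \<zero>\<^bsub>?E\<^esub>" using m by blast
    next
      fix f assume f: "f \<in> carrier ?E"
      show "\<zero>\<^bsub>?E\<^esub> \<oplus>\<^bsub>?E\<^esub> f = f"
        by (rule ext[OF add[OF z f] f]) (use c[OF f] in \<open>simp add: pt\<close>)
    next
      fix f g assume f: "f \<in> carrier ?E" and g: "g \<in> carrier ?E"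
      show "f \<oplus>\<^bsub>?E\<^esub> g = g \<oplus>\<^bsub>?E\<^esub> f"
        by (rule ext[OF add[OF f g] add[OF g f]]) (use c[OF f] c[OF g] in \<open>simp add: pt M.M.a_comm\<close>)
    next
      fix f g h assume f: "f \<in> carrier ?E" and g: "g \<in> carrier ?E" and h: "h \<in> carrier ?E"
      show "f \<oplus>\<^bsub>?E\<^esub> g \<oplus>\<^bsub>?E\<^esub> h = f \<oplus>\<^bsub>?E\<^esub> (g \<oplus>\<^bsub>?E\<^esub> h)"
        by (rule ext[OF add[OF add[OF f g] h] add[OF f add[OF g h]]])
          (use c[OF f] c[OF g] c[OF h] in \<open>simp add: pt M.M.a_assoc\<close>)
    qed (fact z add)+
  next
    fix a b f assume a: "a \<in> carrier K" "b \<in> carrier K" and f: "f \<in> carrier ?E"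
    show "(a \<oplus>\<^bsub>K\<^esub> b) \<odot>\<^bsub>?E\<^esub> f = a \<odot>\<^bsub>?E\<^esub> f \<oplus>\<^bsub>?E\<^esub> b \<odot>\<^bsub>?E\<^esub> f"
      by (rule ext[OF sm add[OF sm sm]]) (use a f c[OF f] in \<open>simp_all add: pt M.smult_l_distr\<close>)
    show "(a \<otimes>\<^bsub>K\<^esub> b) \<odot>\<^bsub>?E\<^esub> f = a \<odot>\<^bsub>?E\<^esub> (b \<odot>\<^bsub>?E\<^esub> f)"
      by (rule ext[OF sm sm[OF _ sm]]) (use a f c[OF f] in \<open>simp_all add: pt M.smult_assoc1\<close>)
  next
    fix a f g assume a: "a \<in> carrier K" and f: "f \<in> carrier ?E" and g: "g \<in> carrier ?E"
    show "a \<odot>\<^bsub>?E\<^esub> (f \<oplus>\<^bsub>?E\<^esub> g) = a \<odot>\<^bsub>?E\<^esub> f \<oplus>\<^bsub>?E\<^esub> a \<odot>\<^bsub>?E\<^esub> g"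
      by (rule ext[OF sm[OF _ add] add[OF sm sm]]) (use a f g c[OF f] c[OF g] in \<open>simp_all add: pt M.smult_r_distr\<close>)
  next
    fix f assume f: "f \<in> carrier ?E"
    show "\<one>\<^bsub>K\<^esub> \<odot>\<^bsub>?E\<^esub> f = f"
      by (rule ext[OF sm f]) (use f c[OF f] in \<open>simp_all add: pt\<close>)
  qed (rule sm)
qed

lemma End_apply:
  "f \<in> carrier (End_module K M) \<Longrightarrow> k_linear K M M f"
  by (simp add: End_module_def)

lemma restrict_in_End:
  "module K M \<Longrightarrow> k_linear K M M f \<Longrightarrow> restrict f (carrier M) \<in> carrier (End_module K M)"
  by (auto simp: End_module_def intro: k_linear_cong[of K M M f])

lemma End_eval_linear:
  "x \<in> carrier M \<Longrightarrow> k_linear K (End_module K M) M (\<lambda>f. f x)"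
  by (auto simp: k_linear_def End_module_def)

section \<open>Relative separability of the forgetful functors\<close>

definition with_structure ::
  "('k, 'u) module \<Rightarrow> ('u \<Rightarrow> 'l \<Rightarrow> 'u) \<Rightarrow> ('u \<Rightarrow> ('u, 'l) tensor) \<Rightarrow> ('k, 'u, 'l) ydmod" where
  "with_structure T a \<rho> = \<lparr>carrier = carrier T, monoid.mult = monoid.mult T, one = one T,
     ring.zero = ring.zero T, ring.add = ring.add T, smult = smult T, ract = a, yd_coact = \<rho>\<rparr>"

lemma with_structure_simps [simp]:
  "same_module (with_structure T a \<rho>) T" "carrier (with_structure T a \<rho>) = carrier T"
  "ract (with_structure T a \<rho>) = a" "yd_coact (with_structure T a \<rho>) = \<rho>"
  by (simp_all add: with_structure_def same_module_def)

context hopf_algebra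
begin

lemma act_map_cong:
  assumes "rmodule M a" "\<And>x. x \<in> carrier M \<Longrightarrow> f x = g x"
  shows "act_map M a N b f \<longleftrightarrow> act_map M a N b g"
proof -
  note M = rmoduleD[OF assms(1)]
  have "k_linear K M N f \<longleftrightarrow> k_linear K M N g"
    using k_linear_cong[of K M N f g] k_linear_cong[of K M N g f] M(1) assms(2) by auto
  then show ?thesis using M(3) assms(2) by (simp add: act_map_def)
qed

lemma coact_map_cong:
  assumes "comodule M \<rho>" "\<And>x. x \<in> carrier M \<Longrightarrow> f x = g x"
  shows "coact_map M \<rho> N \<sigma> f \<longleftrightarrow> coact_map M \<rho> N \<sigma> g"
proof -
  note M = comoduleD[OF assms(1)]
  have "k_linear K M N f \<longleftrightarrow> k_linear K M N g"
    using k_linear_cong[of K M N f g] k_linear_cong[of K M N g f] M(1) assms(2) by auto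
  then show ?thesis using assms(2) by (simp add: coact_map_def)
qed

lemma act_map_restrict: "rmodule M a \<Longrightarrow> act_map M a N b (restrict f (carrier M)) \<longleftrightarrow> act_map M a N b f"
  by (rule act_map_cong) simp_all

lemma coact_map_restrict:
  "comodule M \<rho> \<Longrightarrow> coact_map M \<rho> N \<sigma> (restrict f (carrier M)) \<longleftrightarrow> coact_map M \<rho> N \<sigma> f"
  by (rule coact_map_cong) simp_all

lemma mod_hom_iff:
  "f \<in> Hom (Mod_cat K L) (forget_coaction X) (forget_coaction Y) \<longleftrightarrow>
    f \<in> extensional (carrier X) \<and> act_map X (ract X) Y (ract Y) f"
  by (simp add: Mod_cat_def L_linear_iff same_act_map[OF same_module_forget(2) same_module_forget(2)])

lemma comod_hom_iff:
  "yetter_drinfeld K L X \<Longrightarrow> f \<in> Hom (Comod_cat K L) (forget_action X) (forget_action Y) \<longleftrightarrow>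
    f \<in> extensional (carrier X) \<and> coact_map X (yd_coact X) Y (yd_coact Y) f"
  by (simp add: Comod_cat_def yetter_drinfeld_def colinear_iff
      same_coact_map[OF same_module_forget(1) same_module_forget(1)])

lemma yd_hom_iff:
  "yetter_drinfeld K L X \<Longrightarrow> f \<in> Hom (YD_cat K L) X Y \<longleftrightarrow>
    f \<in> extensional (carrier X) \<and> act_map X (ract X) Y (ract Y) f \<and>
    coact_map X (yd_coact X) Y (yd_coact Y) f"
  by (simp add: YD_cat_def yetter_drinfeld_def colinear_iff L_linear_iff
      same_act_map[OF same_module_forget(2) same_module_forget(2)]
      same_coact_map[OF same_module_forget(1) same_module_forget(1)])

lemma Obj_YD: "X \<in> Obj (YD_cat K L) \<longleftrightarrow> yd X (ract X) (yd_coact X)"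
  by (simp add: YD_cat_def yetter_drinfeld_iff)

lemma act_map_closed: "\<lbrakk>act_map M a N b f; x \<in> carrier M\<rbrakk> \<Longrightarrow> f x \<in> carrier N"
  by (auto simp: act_map_def intro: k_linear_closed)

text \<open>Morphisms are extensional functions, whereas \<^const>\<open>separating\<close> speaks about arbitrary ones; the
  family is applied to restrictions.\<close>

lemma separating_from_separable:
  assumes sep: "relatively_separable (YD_cat K L) D C U V" and X: "X \<in> Obj (YD_cat K L)"
    and homs: "\<And>f. f \<in> Hom (YD_cat K L) X X \<longleftrightarrow> f \<in> extensional (carrier X) \<and> d f \<and> c f"
      "\<And>f. f \<in> Hom D (fobj U X) (fobj U X) \<longleftrightarrow> f \<in> extensional (carrier X) \<and> d f"
      "\<And>f. f \<in> Hom C (fobj V X) (fobj V X) \<longleftrightarrow> f \<in> extensional (carrier X) \<and> c f"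
    and maps: "\<And>f. fmap U X X f = f" "\<And>f. fmap V X X f = f"
    and comps: "\<And>g f. Comp D (fobj U X) (fobj U X) (fobj U X) g f = compose (carrier X) g f"
      "\<And>g f. Comp C (fobj V X) (fobj V X) (fobj V X) g f = compose (carrier X) g f"
    and cong: "\<And>f g. (\<And>x. x \<in> carrier X \<Longrightarrow> f x = g x) \<Longrightarrow> d f = d g"
      "\<And>f g. (\<And>x. x \<in> carrier X \<Longrightarrow> f x = g x) \<Longrightarrow> c f = c g"
    and closed: "\<And>f x. d f \<Longrightarrow> x \<in> carrier X \<Longrightarrow> f x \<in> carrier X"
    and closed': "\<And>f x. c f \<Longrightarrow> x \<in> carrier X \<Longrightarrow> f x \<in> carrier X"
  shows "\<exists>Q. separating (carrier X) d c Q"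
proof -
  obtain P where P0: "\<forall>X\<in>Obj (YD_cat K L). \<forall>Y\<in>Obj (YD_cat K L).
           P X Y \<in> Hom D (fobj U X) (fobj U Y) \<rightarrow> Hom C (fobj V X) (fobj V Y)"
    and nat0: "\<forall>X\<in>Obj (YD_cat K L). \<forall>Y\<in>Obj (YD_cat K L). \<forall>Z\<in>Obj (YD_cat K L). \<forall>T\<in>Obj (YD_cat K L).
           \<forall>u\<in>Hom (YD_cat K L) X Y. \<forall>v\<in>Hom (YD_cat K L) Z T. \<forall>h\<in>Hom D (fobj U Y) (fobj U Z).
             P X T (Comp D (fobj U X) (fobj U Z) (fobj U T) (fmap U Z T v)
                      (Comp D (fobj U X) (fobj U Y) (fobj U Z) h (fmap U X Y u))) =
             Comp C (fobj V X) (fobj V Z) (fobj V T) (fmap V Z T v)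
               (Comp C (fobj V X) (fobj V Y) (fobj V Z) (P Y Z h) (fmap V X Y u))"
    and fix0: "\<forall>X\<in>Obj (YD_cat K L). \<forall>Y\<in>Obj (YD_cat K L). \<forall>f\<in>Hom (YD_cat K L) X Y.
             P X Y (fmap U X Y f) = fmap V X Y f"
    using sep unfolding relatively_separable_def by (elim exE conjE)
  have P: "P X X h \<in> Hom C (fobj V X) (fobj V X)" if "h \<in> Hom D (fobj U X) (fobj U X)" for h
    using P0 X that by (auto simp: Pi_def)
  have nat: "P X X (compose (carrier X) v (compose (carrier X) h u)) =
      compose (carrier X) v (compose (carrier X) (P X X h) u)"
    if "u \<in> Hom (YD_cat K L) X X" "v \<in> Hom (YD_cat K L) X X" "h \<in> Hom D (fobj U X) (fobj U X)" for u v h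
    using nat0[rule_format, OF X X X X that] by (simp only: maps comps)
  have fixes_P: "P X X f = f" if "f \<in> Hom (YD_cat K L) X X" for f
    using fix0[rule_format, OF X X that] by (simp only: maps)
  let ?r = "\<lambda>f. restrict f (carrier X)"
  have r: "d (?r f) = d f" "c (?r f) = c f" for f
    by (rule cong, simp)+
  have "separating (carrier X) d c (\<lambda>h. P X X (?r h))"
    unfolding separating_def
  proof (intro conjI allI impI)
    fix h assume "d h"
    then show "c (P X X (?r h))" using P[of "?r h"] by (simp add: homs r)
  next
    fix u v h w x
    assume a: "d h \<and> d u \<and> c u \<and> d v \<and> c v \<and> d w \<and> (\<forall>x\<in>carrier X. w x = v (h (u x))) \<and> x \<in> carrier X"
    have "?r w = compose (carrier X) (?r v) (compose (carrier X) (?r h) (?r u))"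
      using a closed by (auto simp: compose_def intro!: restrict_ext)
    then have "P X X (?r w) = compose (carrier X) (?r v) (compose (carrier X) (P X X (?r h)) (?r u))"
      using nat[of "?r u" "?r v" "?r h"] a by (simp add: homs r)
    moreover have "P X X (?r h) (u x) \<in> carrier X"
      using P[of "?r h"] a closed closed' by (simp add: homs r)
    ultimately show "P X X (?r w) x = v (P X X (?r h) (u x))"
      using a closed by (simp add: compose_def)
  next
    fix f x assume "d f \<and> c f \<and> x \<in> carrier X"
    then show "P X X (?r f) x = f x" using fixes_P[of "?r f"] by (simp add: homs r)
  qed
  then show ?thesis by blast
qed

lemma FH_separating:
  assumes sep: "relatively_separable (YD_cat K L :: (('k, 'u, 'l) ydmod, 'u \<Rightarrow> 'u) category) (Mod_cat K L) (Comod_cat K L) F_functor H_functor"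
    and yd: "yd (T :: ('k, 'u) module) a \<rho>"
  obtains Q where "separating (carrier T) (act_map T a T a) (coact_map T \<rho> T \<rho>) Q"
proof -
  let ?X = "with_structure T a \<rho>"
  have X: "yd ?X a \<rho>" using yd same_yd[of ?X T a \<rho>] by simp
  then have X': "yetter_drinfeld K L ?X" by (simp add: yetter_drinfeld_iff)
  have am: "act_map ?X a ?X a f = act_map T a T a f" for f by (simp add: same_act_map)
  have cm: "coact_map ?X \<rho> ?X \<rho> f = coact_map T \<rho> T \<rho> f" for f by (simp add: same_coact_map)
  have "\<exists>Q. separating (carrier ?X) (act_map T a T a) (coact_map T \<rho> T \<rho>) Q"
  proof (rule separating_from_separable[OF sep, where X="?X"])
    show "?X \<in> Obj (YD_cat K L)" using X by (simp add: Obj_YD)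
    show "act_map T a T a f = act_map T a T a g" if "\<And>x. x \<in> carrier ?X \<Longrightarrow> f x = g x" for f g
      by (rule act_map_cong[OF ydD(1)[OF yd]]) (use that in simp)
    show "coact_map T \<rho> T \<rho> f = coact_map T \<rho> T \<rho> g" if "\<And>x. x \<in> carrier ?X \<Longrightarrow> f x = g x" for f g
      by (rule coact_map_cong[OF ydD(2)[OF yd]]) (use that in simp)
    show "f x \<in> carrier ?X" if "act_map T a T a f" "x \<in> carrier ?X" for f x
      using act_map_closed[OF that(1)] that(2) by simp
    show "f x \<in> carrier ?X" if "coact_map T \<rho> T \<rho> f" "x \<in> carrier ?X" for f x
      using coact_mapD(2)[OF that(1)] that(2) by simp
  qed (use X' in \<open>auto simp: yd_hom_iff mod_hom_iff comod_hom_iff F_functor_def H_functor_def am cm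
        Mod_cat_def[THEN arg_cong, of Comp] Comod_cat_def[THEN arg_cong, of Comp]\<close>)
  then show thesis using that by auto
qed

lemma HF_separating:
  assumes sep: "relatively_separable (YD_cat K L :: (('k, 'u, 'l) ydmod, 'u \<Rightarrow> 'u) category) (Comod_cat K L) (Mod_cat K L) H_functor F_functor"
    and yd: "yd (T :: ('k, 'u) module) a \<rho>"
  obtains Q where "separating (carrier T) (coact_map T \<rho> T \<rho>) (act_map T a T a) Q"
proof -
  let ?X = "with_structure T a \<rho>"
  have X: "yd ?X a \<rho>" using yd same_yd[of ?X T a \<rho>] by simp
  then have X': "yetter_drinfeld K L ?X" by (simp add: yetter_drinfeld_iff)
  have am: "act_map ?X a ?X a f = act_map T a T a f" for f by (simp add: same_act_map)
  have cm: "coact_map ?X \<rho> ?X \<rho> f = coact_map T \<rho> T \<rho> f" for f by (simp add: same_coact_map)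
  have "\<exists>Q. separating (carrier ?X) (coact_map T \<rho> T \<rho>) (act_map T a T a) Q"
  proof (rule separating_from_separable[OF sep, where X="?X"])
    show "?X \<in> Obj (YD_cat K L)" using X by (simp add: Obj_YD)
    show "act_map T a T a f = act_map T a T a g" if "\<And>x. x \<in> carrier ?X \<Longrightarrow> f x = g x" for f g
      by (rule act_map_cong[OF ydD(1)[OF yd]]) (use that in simp)
    show "coact_map T \<rho> T \<rho> f = coact_map T \<rho> T \<rho> g" if "\<And>x. x \<in> carrier ?X \<Longrightarrow> f x = g x" for f g
      by (rule coact_map_cong[OF ydD(2)[OF yd]]) (use that in simp)
    show "f x \<in> carrier ?X" if "act_map T a T a f" "x \<in> carrier ?X" for f x
      using act_map_closed[OF that(1)] that(2) by simp
    show "f x \<in> carrier ?X" if "coact_map T \<rho> T \<rho> f" "x \<in> carrier ?X" for f x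
      using coact_mapD(2)[OF that(1)] that(2) by simp
  qed (use X' in \<open>auto simp: yd_hom_iff mod_hom_iff comod_hom_iff F_functor_def H_functor_def am cm
        Mod_cat_def[THEN arg_cong, of Comp] Comod_cat_def[THEN arg_cong, of Comp]\<close>)
  then show thesis using that by auto
qed

theorem theta_of_separable:
  assumes sep: "relatively_separable (YD_cat K L :: (('k, 'u, 'l) ydmod, 'u \<Rightarrow> 'u) category)
      (Mod_cat K L) (Comod_cat K L) F_functor H_functor"
    and inf: "infinite (UNIV :: 'u set)" and le: "carrier L \<lesssim> (UNIV :: 'u set)"
  shows "\<exists>\<theta>. theta K L \<theta>"
proof -
  let ?LLLL = "tensor_product K (tensor_product K LL L) L"
  have "module K ?LLLL" "carrier ?LLLL \<lesssim> (UNIV :: 'u set)"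
    using inf le by (simp_all add: tensor_product_lepoll)
  then obtain T :: "('k, 'u) module" and \<phi> \<psi> where T: "module K T" "k_linear K ?LLLL T \<phi>" "k_linear K T ?LLLL \<psi>"
    "\<forall>x\<in>carrier ?LLLL. \<psi> (\<phi> x) = x" "\<forall>y\<in>carrier T. \<phi> (\<psi> y) = y"
    by (rule module_copy)
  have "triple K L LL T \<phi> \<psi>"
    by (rule triple.intro[OF hopf_algebra_axioms], rule triple_axioms.intro) (use T in simp_all)
  then interpret triple_LL K L T \<phi> \<psi> by (rule triple_LL.intro)
  obtain Q where "separating (carrier T) lin_endo colin_endo Q"
    using FH_separating[OF sep yd_free] .
  from theta_exists[OF this] show ?thesis by blast
qed

theorem casimir_of_separable:
  assumes sep: "relatively_separable (YD_cat K L :: (('k, 'u, 'l) ydmod, 'u \<Rightarrow> 'u) category)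
      (Comod_cat K L) (Mod_cat K L) H_functor F_functor"
    and inf: "infinite (UNIV :: 'u set)" and le: "carrier L \<lesssim> (UNIV :: 'u set)"
  shows "\<exists>e. casimir K L e"
proof -
  let ?LLL = "tensor_product K LL L"
  have "module K ?LLL" "carrier ?LLL \<lesssim> (UNIV :: 'u set)"
    using inf le by (simp_all add: tensor_product_lepoll)
  then obtain T :: "('k, 'u) module" and \<phi> \<psi> where T: "module K T" "k_linear K ?LLL T \<phi>" "k_linear K T ?LLL \<psi>"
    "\<forall>x\<in>carrier ?LLL. \<psi> (\<phi> x) = x" "\<forall>y\<in>carrier T. \<phi> (\<psi> y) = y"
    by (rule module_copy)
  have "triple K L L T \<phi> \<psi>"
    by (rule triple.intro[OF hopf_algebra_axioms], rule triple_axioms.intro) (use T in simp_all)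
  then interpret triple_L K L T \<phi> \<psi> by (rule triple_L.intro)
  obtain Q where "separating (carrier T) colin_endo lin_endo Q"
    using HF_separating[OF sep yd_cofree] .
  from casimir_exists[OF this] show ?thesis by blast
qed

end

context theta
begin

lemma colift_cong: "(\<And>x. x \<in> carrier V \<Longrightarrow> h x = h' x) \<Longrightarrow> colift V \<sigma> M a \<rho> h v = colift V \<sigma> M a \<rho> h' v"
  unfolding colift_def by (intro tsum_cong refl) simp

theorem separable: "relatively_separable (YD_cat K L :: (('k, 'u, 'l) ydmod, 'u \<Rightarrow> 'u) category)
    (Mod_cat K L) (Comod_cat K L) F_functor H_functor"
  unfolding relatively_separable_def
proof (intro exI[of _ "\<lambda>X Y h. restrict (colift X (yd_coact X) Y (ract Y) (yd_coact Y) h) (carrier X)"] conjI ballI funcsetI)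
  fix X Y :: "('k, 'u, 'l) ydmod" and h
  assume X: "X \<in> Obj (YD_cat K L)" and Y: "Y \<in> Obj (YD_cat K L)"
    and "h \<in> Hom (Mod_cat K L) (fobj F_functor X) (fobj F_functor Y)"
  then have h: "k_linear K X Y h" by (simp add: F_functor_def mod_hom_iff act_map_def)
  have X': "yetter_drinfeld K L X" using X by (simp add: YD_cat_def)
  note X = X[unfolded Obj_YD] and Y = Y[unfolded Obj_YD]
  show "restrict (colift X (yd_coact X) Y (ract Y) (yd_coact Y) h) (carrier X)
      \<in> Hom (Comod_cat K L) (fobj H_functor X) (fobj H_functor Y)"
    using colift_colinear[OF Y ydD(2)[OF X] h]
    by (simp add: H_functor_def comod_hom_iff[OF X'] coact_map_restrict[OF ydD(2)[OF X]])
next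
  fix X Y Z T :: "('k, 'u, 'l) ydmod" and u v h
  assume o: "X \<in> Obj (YD_cat K L)" "Y \<in> Obj (YD_cat K L)" "Z \<in> Obj (YD_cat K L)" "T \<in> Obj (YD_cat K L)"
    and uv: "u \<in> Hom (YD_cat K L) X Y" "v \<in> Hom (YD_cat K L) Z T"
    and "h \<in> Hom (Mod_cat K L) (fobj F_functor Y) (fobj F_functor Z)"
  then have h: "k_linear K Y Z h" by (simp add: F_functor_def mod_hom_iff act_map_def)
  have u: "coact_map X (yd_coact X) Y (yd_coact Y) u"
    and v: "act_map Z (ract Z) T (ract T) v" "coact_map Z (yd_coact Z) T (yd_coact T) v"
    using uv o by (simp_all add: yd_hom_iff yetter_drinfeld_iff Obj_YD)
  note o = o[unfolded Obj_YD]
  have "colift X (yd_coact X) T (ract T) (yd_coact T) (compose (carrier X) v (compose (carrier X) h u)) x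
    = v (colift Y (yd_coact Y) Z (ract Z) (yd_coact Z) h (u x))" if x: "x \<in> carrier X" for x
  proof -
    have hu: "k_linear K X Z (\<lambda>x. h (u x))" using h coact_mapD(1)[OF u] by (rule k_linear_comp)
    have "colift X (yd_coact X) T (ract T) (yd_coact T) (compose (carrier X) v (compose (carrier X) h u)) x
      = colift X (yd_coact X) T (ract T) (yd_coact T) (\<lambda>x. v (h (u x))) x"
      by (rule colift_cong) (simp add: compose_def)
    also have "\<dots> = v (colift X (yd_coact X) Z (ract Z) (yd_coact Z) (\<lambda>x. h (u x)) x)"
      by (rule colift_natural[OF o(3,4) ydD(2)[OF o(1)] hu v x, symmetric])
    also have "\<dots> = v (colift Y (yd_coact Y) Z (ract Z) (yd_coact Z) h (u x))"
      by (simp only: colift_comp[OF o(3) ydD(2)[OF o(2)] ydD(2)[OF o(1)] h u x])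
    finally show ?thesis .
  qed
  then show "restrict (colift X (yd_coact X) T (ract T) (yd_coact T)
      (Comp (Mod_cat K L) (fobj F_functor X) (fobj F_functor Z) (fobj F_functor T) (fmap F_functor Z T v)
        (Comp (Mod_cat K L) (fobj F_functor X) (fobj F_functor Y) (fobj F_functor Z) h (fmap F_functor X Y u)))) (carrier X) =
    Comp (Comod_cat K L) (fobj H_functor X) (fobj H_functor Z) (fobj H_functor T) (fmap H_functor Z T v)
      (Comp (Comod_cat K L) (fobj H_functor X) (fobj H_functor Y) (fobj H_functor Z)
        (restrict (colift Y (yd_coact Y) Z (ract Z) (yd_coact Z) h) (carrier Y)) (fmap H_functor X Y u))"
    using coact_mapD(2)[OF u]
    by (simp add: Mod_cat_def Comod_cat_def F_functor_def H_functor_def compose_def cong: restrict_cong)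
next
  fix X Y :: "('k, 'u, 'l) ydmod" and f
  assume X: "X \<in> Obj (YD_cat K L)" and Y: "Y \<in> Obj (YD_cat K L)" and f: "f \<in> Hom (YD_cat K L) X Y"
  have f': "f \<in> extensional (carrier X)" "coact_map X (yd_coact X) Y (yd_coact Y) f"
    using f X by (simp_all add: yd_hom_iff yetter_drinfeld_iff Obj_YD)
  note X = X[unfolded Obj_YD] and Y = Y[unfolded Obj_YD]
  show "restrict (colift X (yd_coact X) Y (ract Y) (yd_coact Y) (fmap F_functor X Y f)) (carrier X) = fmap H_functor X Y f"
    unfolding F_functor_def H_functor_def cat_functor.simps
    by (rule extensionalityI[OF restrict_extensional f'(1)])
      (simp add: colift_fix[OF Y ydD(2)[OF X] f'(2)])
qed

text \<open>If \<open>r\<close> is a linear retraction of \<open>i\<close>, then \<open>f \<circ> r\<close> extends \<open>f\<close> linearly, and the operator makes it colinear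
  without changing its restriction along \<open>i\<close>.\<close>

theorem injective:
  assumes "M \<in> Obj (YD_cat K L)"
  shows "relative_injective K L (fobj H_functor M)"
  unfolding relative_injective_def
proof (intro allI impI, elim conjE exE)
  note M = assms[unfolded Obj_YD]
  fix U V :: "('k, 'a, 'l) comod" and i f r
  assume U: "right_comodule K L U" and V: "right_comodule K L V" and i: "colinear K L U V i"
    and r: "k_linear K V U r" "\<forall>x\<in>carrier U. r (i x) = x" and f: "colinear K L U (fobj H_functor M) f"
  note U' = U[unfolded right_comodule_iff] and V' = V[unfolded right_comodule_iff]
  note i = i[unfolded colinear_iff[OF U]] 
  have f: "coact_map U (coact U) M (yd_coact M) f"
  proof -
    have "same_module U U" by (simp add: same_module_def)
    then show ?thesis using f
      by (simp add: colinear_iff[OF U] H_functor_def same_coact_map[OF _ same_module_forget(1)])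
  qed
  let ?h = "\<lambda>v. f (r v)"
  have h: "k_linear K V M ?h" using coact_mapD(1)[OF f] r(1) by (rule k_linear_comp)
  let ?g = "colift V (coact V) M (ract M) (yd_coact M) ?h"
  have "same_module V V" by (simp add: same_module_def)
  then have "colinear K L V (fobj H_functor M) ?g"
    using colift_colinear[OF M V' h]
    by (simp add: colinear_iff[OF V] H_functor_def same_coact_map[OF _ same_module_forget(1)])
  moreover have "?g (i x) = f x" if x: "x \<in> carrier U" for x
  proof -
    have "?g (i x) = colift U (coact U) M (ract M) (yd_coact M) (\<lambda>x. f (r (i x))) x"
      by (rule colift_comp[OF M V' U' h i x])
    also have "\<dots> = colift U (coact U) M (ract M) (yd_coact M) f x"
      by (rule colift_cong) (simp add: r(2))
    also have "\<dots> = f x" by (rule colift_fix[OF M U' f x])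
    finally show ?thesis .
  qed
  ultimately show "\<exists>g. colinear K L V (fobj H_functor M) g \<and> (\<forall>x\<in>carrier U. g (i x) = f x)" by blast
qed

end

context casimir
begin

lemma linlift_cong:
  assumes "yd X a \<rho>" "\<And>x. x \<in> carrier X \<Longrightarrow> h x = h' x"
  shows "linlift X a \<rho> Y b h x = linlift X a \<rho> Y b h' x"
  unfolding linlift_def using assms(2) rmoduleD(3)[OF ydD(1)[OF assms(1)]] by (intro tsum_cong refl) simp

theorem separable: "relatively_separable (YD_cat K L :: (('k, 'u, 'l) ydmod, 'u \<Rightarrow> 'u) category)
    (Comod_cat K L) (Mod_cat K L) H_functor F_functor"
  unfolding relatively_separable_def
proof (intro exI[of _ "\<lambda>X Y h. restrict (linlift X (ract X) (yd_coact X) Y (ract Y) h) (carrier X)"] conjI ballI funcsetI)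
  fix X Y :: "('k, 'u, 'l) ydmod" and h
  assume X: "X \<in> Obj (YD_cat K L)" and Y: "Y \<in> Obj (YD_cat K L)"
    and h: "h \<in> Hom (Comod_cat K L) (fobj H_functor X) (fobj H_functor Y)"
  have X': "yetter_drinfeld K L X" using X by (simp add: YD_cat_def)
  have h: "k_linear K X Y h" using h by (simp add: H_functor_def comod_hom_iff[OF X'] coact_map_def)
  note X = X[unfolded Obj_YD] and Y = Y[unfolded Obj_YD]
  show "restrict (linlift X (ract X) (yd_coact X) Y (ract Y) h) (carrier X)
      \<in> Hom (Mod_cat K L) (fobj F_functor X) (fobj F_functor Y)"
    using linlift_act[OF X ydD(1)[OF Y] h]
    by (simp add: F_functor_def mod_hom_iff act_map_restrict[OF ydD(1)[OF X]])
next
  fix X Y Z T :: "('k, 'u, 'l) ydmod" and u v h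
  assume o: "X \<in> Obj (YD_cat K L)" "Y \<in> Obj (YD_cat K L)" "Z \<in> Obj (YD_cat K L)" "T \<in> Obj (YD_cat K L)"
    and uv: "u \<in> Hom (YD_cat K L) X Y" "v \<in> Hom (YD_cat K L) Z T"
    and h: "h \<in> Hom (Comod_cat K L) (fobj H_functor Y) (fobj H_functor Z)"
  have Y': "yetter_drinfeld K L Y" using o(2) by (simp add: YD_cat_def)
  have h: "k_linear K Y Z h" using h by (simp add: H_functor_def comod_hom_iff[OF Y'] coact_map_def)
  have u: "act_map X (ract X) Y (ract Y) u" "coact_map X (yd_coact X) Y (yd_coact Y) u"
    and v: "act_map Z (ract Z) T (ract T) v"
    using uv o by (simp_all add: yd_hom_iff yetter_drinfeld_iff Obj_YD)
  note o = o[unfolded Obj_YD]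
  have "linlift X (ract X) (yd_coact X) T (ract T) (compose (carrier X) v (compose (carrier X) h u)) x
    = v (linlift Y (ract Y) (yd_coact Y) Z (ract Z) h (u x))" if x: "x \<in> carrier X" for x
  proof -
    have hu: "k_linear K X Z (\<lambda>x. h (u x))" using h coact_mapD(1)[OF u(2)] by (rule k_linear_comp)
    have "linlift X (ract X) (yd_coact X) T (ract T) (compose (carrier X) v (compose (carrier X) h u)) x
      = linlift X (ract X) (yd_coact X) T (ract T) (\<lambda>x. v (h (u x))) x"
      by (rule linlift_cong[OF o(1)]) (simp add: compose_def)
    also have "\<dots> = v (linlift X (ract X) (yd_coact X) Z (ract Z) (\<lambda>x. h (u x)) x)"
      by (rule linlift_natural[OF o(1) ydD(1)[OF o(3)] ydD(1)[OF o(4)] hu v x, symmetric])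
    also have "\<dots> = v (linlift Y (ract Y) (yd_coact Y) Z (ract Z) h (u x))"
      by (simp only: linlift_comp[OF o(2,1) ydD(1)[OF o(3)] h u x])
    finally show ?thesis .
  qed
  then show "restrict (linlift X (ract X) (yd_coact X) T (ract T)
      (Comp (Comod_cat K L) (fobj H_functor X) (fobj H_functor Z) (fobj H_functor T) (fmap H_functor Z T v)
        (Comp (Comod_cat K L) (fobj H_functor X) (fobj H_functor Y) (fobj H_functor Z) h (fmap H_functor X Y u)))) (carrier X) =
    Comp (Mod_cat K L) (fobj F_functor X) (fobj F_functor Z) (fobj F_functor T) (fmap F_functor Z T v)
      (Comp (Mod_cat K L) (fobj F_functor X) (fobj F_functor Y) (fobj F_functor Z)
        (restrict (linlift Y (ract Y) (yd_coact Y) Z (ract Z) h) (carrier Y)) (fmap F_functor X Y u))"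
    using coact_mapD(2)[OF u(2)]
    by (simp add: Mod_cat_def Comod_cat_def F_functor_def H_functor_def compose_def cong: restrict_cong)
next
  fix X Y :: "('k, 'u, 'l) ydmod" and f
  assume X: "X \<in> Obj (YD_cat K L)" and Y: "Y \<in> Obj (YD_cat K L)" and f: "f \<in> Hom (YD_cat K L) X Y"
  have f': "f \<in> extensional (carrier X)" "act_map X (ract X) Y (ract Y) f"
    using f X by (simp_all add: yd_hom_iff yetter_drinfeld_iff Obj_YD)
  note X = X[unfolded Obj_YD] and Y = Y[unfolded Obj_YD]
  show "restrict (linlift X (ract X) (yd_coact X) Y (ract Y) (fmap H_functor X Y f)) (carrier X) = fmap F_functor X Y f"
    unfolding F_functor_def H_functor_def cat_functor.simps
    by (rule extensionalityI[OF restrict_extensional f'(1)])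
      (simp add: linlift_fix[OF X ydD(1)[OF Y] f'(2)])
qed

text \<open>If \<open>s\<close> is a linear section of \<open>p\<close>, then \<open>s \<circ> f\<close> lifts \<open>f\<close> linearly, and the operator makes it \<open>L\<close>-linear
  without changing its composite with \<open>p\<close>.\<close>

theorem projective:
  assumes "M \<in> Obj (YD_cat K L)"
  shows "relative_projective K L (fobj F_functor M)"
  unfolding relative_projective_def
proof (intro allI impI, elim conjE exE)
  note M = assms[unfolded Obj_YD]
  fix U V :: "('k, 'a, 'l) rmod" and p f s
  assume U: "right_module K L U" and V: "right_module K L V" and p: "L_linear K L U V p"
    and s: "k_linear K V U s" "\<forall>y\<in>carrier V. p (s y) = y" and f: "L_linear K L (fobj F_functor M) V f"
  note U' = U[unfolded right_module_iff] and V' = V[unfolded right_module_iff]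
  note p = p[unfolded L_linear_iff]
  have V_refl: "same_module V V" and U_refl: "same_module U U" by (simp_all add: same_module_def)
  have f: "act_map M (ract M) V (ract V) f"
    using f by (simp add: L_linear_iff F_functor_def same_act_map[OF same_module_forget(2) V_refl])
  let ?h = "\<lambda>x. s (f x)"
  have fl: "k_linear K M V f" using f by (simp add: act_map_def)
  have h: "k_linear K M U ?h" using s(1) fl by (rule k_linear_comp)
  let ?g = "linlift M (ract M) (yd_coact M) U (ract U) ?h"
  have "L_linear K L (fobj F_functor M) U ?g"
    using linlift_act[OF M U' h]
    by (simp add: L_linear_iff F_functor_def same_act_map[OF same_module_forget(2) U_refl])
  moreover have "p (?g x) = f x" if x: "x \<in> carrier M" for x
  proof -
    have "p (?g x) = linlift M (ract M) (yd_coact M) V (ract V) (\<lambda>x. p (s (f x))) x"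
      by (rule linlift_natural[OF M U' V' h p x])
    also have "\<dots> = linlift M (ract M) (yd_coact M) V (ract V) f x"
      by (rule linlift_cong[OF M]) (simp add: s(2) k_linear_closed[OF fl])
    also have "\<dots> = f x" by (rule linlift_fix[OF M V' f x])
    finally show ?thesis .
  qed
  ultimately show "\<exists>g. L_linear K L (fobj F_functor M) U g \<and> (\<forall>x\<in>carrier (fobj F_functor M). p (g x) = f x)"
    by (auto simp: F_functor_def)
qed

end

section \<open>The equivalent forms of the conditions\<close>

context hopf_algebra
begin

abbreviation "EndL \<equiv> End_module K L"

lemma theta_iff:
  "theta K L \<theta> \<longleftrightarrow> k_linear K LL L \<theta> \<and>
     (\<forall>g\<in>carrier L. \<forall>h\<in>carrier L.
        sweedler2 L LL (\<lambda>h1 h2. tens K L L (\<theta> (tens K L L g h1)) h2) h =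
        sweedler2 L LL (\<lambda>g1 g2. sweedler3 L LL
          (\<lambda>t1 t2 t3. tens K L L t2 (S t1 \<otimes>\<^bsub>L\<^esub> g1 \<otimes>\<^bsub>L\<^esub> t3)) (\<theta> (tens K L L g2 h))) g) \<and>
     (\<forall>h\<in>carrier L. \<theta> (\<Delta> h) = \<epsilon> h \<odot>\<^bsub>L\<^esub> \<one>\<^bsub>L\<^esub>)"
proof (cases "k_linear K LL L \<theta>")
  case True
  then have "\<theta> t \<in> carrier L" if "t \<in> carrier LL" for t using that by (rule k_linear_closed)
  then show ?thesis
    using True hopf_algebra_axioms
    by (simp add: theta_def theta_axioms_def sweedler2_tsum sweedler3_tsum twist_def Ball_def)
qed (simp add: theta_def theta_axioms_def)

lemma casimir_iff:
  "casimir K L e \<longleftrightarrow> k_linear K L LL e \<and>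
     (\<forall>g\<in>carrier L. \<forall>h\<in>carrier L.
        tensor_lift LL (\<lambda>x y. tens K L L x (y \<otimes>\<^bsub>L\<^esub> h)) (e g) =
        sweedler3 L LL (\<lambda>h1 h2 h3. tensor_lift LL (\<lambda>x y. tens K L L (h2 \<otimes>\<^bsub>L\<^esub> x) y)
          (e (S h1 \<otimes>\<^bsub>L\<^esub> g \<otimes>\<^bsub>L\<^esub> h3))) h) \<and>
     (\<forall>g\<in>carrier L. tensor_lift L (\<lambda>x y. x \<otimes>\<^bsub>L\<^esub> y) (e g) = \<epsilon> g \<odot>\<^bsub>L\<^esub> \<one>\<^bsub>L\<^esub>)"
proof (cases "k_linear K L LL e")
  case True
  then have "e g \<in> carrier LL" if "g \<in> carrier L" for g using that by (rule k_linear_closed)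
  then show ?thesis
    using True hopf_algebra_axioms
    by (simp add: casimir_def casimir_axioms_def sweedler3_tsum tensor_lift_eq_tsum[of K L L] tsum_twist
        hlin k_linear_comp[OF True] Ball_def)
qed (simp add: casimir_def casimir_axioms_def)

text \<open>The correspondence is \<open>\<gamma>(h)(g) = \<theta>(g \<otimes> h)\<close>.\<close>

lemma gamma_iff:
  "(\<exists>\<theta>. theta K L \<theta>) \<longleftrightarrow> (\<exists>\<gamma>. k_linear K L EndL \<gamma> \<and>
     (\<forall>g\<in>carrier L. \<forall>h\<in>carrier L.
        sweedler2 L LL (\<lambda>h1 h2. tens K L L (\<gamma> h1 g) h2) h =
        sweedler2 L LL (\<lambda>g1 g2. sweedler3 L LL
          (\<lambda>t1 t2 t3. tens K L L t2 (S t1 \<otimes>\<^bsub>L\<^esub> g1 \<otimes>\<^bsub>L\<^esub> t3)) (\<gamma> h g2)) g) \<and>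
     (\<forall>h\<in>carrier L. sweedler2 L L (\<lambda>h1 h2. \<gamma> h2 h1) h = \<epsilon> h \<odot>\<^bsub>L\<^esub> \<one>\<^bsub>L\<^esub>))"
proof (intro iffI; elim exE conjE)
  fix \<theta> assume "theta K L \<theta>"
  then interpret theta K L \<theta> .
  let ?\<gamma> = "\<lambda>h. \<lambda>g\<in>carrier L. \<theta> (g \<otimes>\<otimes> h)"
  have r: "k_linear K L L (\<lambda>h. \<theta> (g \<otimes>\<otimes> h))" if "g \<in> carrier L" for g using that by (simp add: tlin)
  have "k_linear K L EndL ?\<gamma>"
  proof (rule k_linearI)
    fix h assume "h \<in> carrier L"
    then show "?\<gamma> h \<in> carrier EndL" by (intro restrict_in_End) (simp_all add: tlin)
    fix h' assume "h' \<in> carrier L"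
    with \<open>h \<in> carrier L\<close> show "?\<gamma> (h \<oplus>\<^bsub>L\<^esub> h') = ?\<gamma> h \<oplus>\<^bsub>EndL\<^esub> ?\<gamma> h'"
      by (auto simp: End_module_def k_linear_add[OF r] intro!: restrict_ext)
  next
    fix a h assume "a \<in> carrier K" "h \<in> carrier L"
    then show "?\<gamma> (a \<odot>\<^bsub>L\<^esub> h) = a \<odot>\<^bsub>EndL\<^esub> ?\<gamma> h"
      by (auto simp: End_module_def k_linear_smult[OF r] intro!: restrict_ext)
  qed
  moreover have "sw L (\<lambda>h1 h2. \<theta> (h1 \<otimes>\<otimes> h2)) h = \<theta> (\<Delta> h)" if "h \<in> carrier L" for h
  proof -
    have "\<theta> (sw LL (tens K L L) h) = sw L (\<lambda>h1 h2. \<theta> (h1 \<otimes>\<otimes> h2)) h"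
      by (rule linear_tsum[where K=K]) (use that in \<open>simp_all add: tlin theta_linear\<close>)
    then show ?thesis using that by simp
  qed
  ultimately show "\<exists>\<gamma>. k_linear K L EndL \<gamma> \<and>
     (\<forall>g\<in>carrier L. \<forall>h\<in>carrier L.
        sweedler2 L LL (\<lambda>h1 h2. tens K L L (\<gamma> h1 g) h2) h =
        sweedler2 L LL (\<lambda>g1 g2. sweedler3 L LL
          (\<lambda>t1 t2 t3. tens K L L t2 (S t1 \<otimes>\<^bsub>L\<^esub> g1 \<otimes>\<^bsub>L\<^esub> t3)) (\<gamma> h g2)) g) \<and>
     (\<forall>h\<in>carrier L. sweedler2 L L (\<lambda>h1 h2. \<gamma> h2 h1) h = \<epsilon> h \<odot>\<^bsub>L\<^esub> \<one>\<^bsub>L\<^esub>)"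
    using theta_twist theta_comult
    by (intro exI[of _ ?\<gamma>]) (simp add: sweedler2_tsum sweedler3_tsum twist_def)
next
  fix \<gamma> assume \<gamma>: "k_linear K L EndL \<gamma>"
    and c1: "\<forall>g\<in>carrier L. \<forall>h\<in>carrier L.
        sweedler2 L LL (\<lambda>h1 h2. tens K L L (\<gamma> h1 g) h2) h =
        sweedler2 L LL (\<lambda>g1 g2. sweedler3 L LL
          (\<lambda>t1 t2 t3. tens K L L t2 (S t1 \<otimes>\<^bsub>L\<^esub> g1 \<otimes>\<^bsub>L\<^esub> t3)) (\<gamma> h g2)) g"
    and c2: "\<forall>h\<in>carrier L. sweedler2 L L (\<lambda>h1 h2. \<gamma> h2 h1) h = \<epsilon> h \<odot>\<^bsub>L\<^esub> \<one>\<^bsub>L\<^esub>"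
  have l: "k_linear K L L (\<gamma> h)" if "h \<in> carrier L" for h
    using End_apply[OF k_linear_closed[OF \<gamma> that]] .
  have l': "k_linear K L L (\<lambda>h. \<gamma> h g)" if "g \<in> carrier L" for g
    by (rule k_linear_comp[OF End_eval_linear[OF that] \<gamma>])
  have cl: "\<gamma> h g \<in> carrier L" if "h \<in> carrier L" "g \<in> carrier L" for h g
    by (rule k_linear_closed[OF l[OF that(1)] that(2)])
  let ?\<theta> = "tsum L L L (\<lambda>g h. \<gamma> h g)"
  have b: "bilin K L L L (\<lambda>g h. \<gamma> h g)" by (simp add: bilin_def l l')
  have t: "?\<theta> (g \<otimes>\<otimes> h) = \<gamma> h g" if "g \<in> carrier L" "h \<in> carrier L" for g h
    using that b by simp
  have "theta K L ?\<theta>"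
    unfolding theta_iff using c1 c2 b
    by (simp add: sweedler2_tsum sweedler3_tsum t cl tsum_linear)
  then show "\<exists>\<theta>. theta K L \<theta>" by blast
qed

text \<open>The map \<open>g \<mapsto> \<Sum> f\<^sub>i(g) \<otimes> h\<^sub>i\<close> of an element \<open>\<Sum> f\<^sub>i \<otimes> h\<^sub>i\<close>.\<close>

definition casimir_map where
  "casimir_map w g = tsum EndL L LL (\<lambda>f x. f g \<otimes>\<otimes> x) w"

lemma module_EndL [simp]: "module K EndL"
  by (rule module_End) simp

lemmas wlin = hlin End_apply k_linear_comp[OF End_eval_linear]

lemma EndL_closed: "\<lbrakk>f \<in> carrier EndL; g \<in> carrier L\<rbrakk> \<Longrightarrow> f g \<in> carrier L"
  by (rule k_linear_closed[OF End_apply])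

lemma casimir_map_bilin: "g \<in> carrier L \<Longrightarrow> bilin K EndL L LL (\<lambda>f x. f g \<otimes>\<otimes> x)"
  by (simp add: wlin EndL_closed End_eval_linear)

lemma casimir_map_linear:
  assumes "w \<in> carrier (tensor_product K EndL L)" shows "k_linear K L LL (casimir_map w)"
  unfolding casimir_map_def[abs_def]
  by (rule k_linear_tsum_fun) (use assms in \<open>simp_all add: casimir_map_bilin k_linear_tens_left End_apply\<close>)

lemma casimir_map_iff:
  assumes w: "w \<in> carrier (tensor_product K EndL L)"
  shows "casimir K L (casimir_map w) \<longleftrightarrow>
     (\<forall>g\<in>carrier L. \<forall>h\<in>carrier L.
        tensor_lift LL (\<lambda>f x. tens K L L (f g) (x \<otimes>\<^bsub>L\<^esub> h)) w =
        sweedler3 L LL (\<lambda>h1 h2 h3. tensor_lift LL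
           (\<lambda>f x. tens K L L (h2 \<otimes>\<^bsub>L\<^esub> f (S h1 \<otimes>\<^bsub>L\<^esub> g \<otimes>\<^bsub>L\<^esub> h3)) x) w) h) \<and>
     (\<forall>g\<in>carrier L. tensor_lift L (\<lambda>f x. f g \<otimes>\<^bsub>L\<^esub> x) w = \<epsilon> g \<odot>\<^bsub>L\<^esub> \<one>\<^bsub>L\<^esub>)"
proof -
  note lin = casimir_map_linear[OF w]
  have cl: "casimir_map w g \<in> carrier LL" if "g \<in> carrier L" for g
    by (rule k_linear_closed[OF lin that])
  have push: "tensor_lift P (\<lambda>f x. F (f q) x) w = tensor_lift P F (casimir_map w q)"
    if "module K P" "bilin K L L P F" "q \<in> carrier L" for q and P :: "('k, 'p, 'y) module_scheme" and F
  proof -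
    have "tsum L L P F (casimir_map w q) = tsum EndL L P (\<lambda>f x. tsum L L P F (f q \<otimes>\<otimes> x)) w"
      unfolding casimir_map_def by (rule tsum_tsum[where K=K]) (use that w in \<open>simp_all add: casimir_map_bilin\<close>)
    also have "\<dots> = tsum EndL L P (\<lambda>f x. F (f q) x) w"
      by (rule tsum_cong[OF refl]) (use that in \<open>simp add: EndL_closed\<close>)
    finally show ?thesis
      using that w cl by (simp add: tensor_lift_eq_tsum[of K L L] tensor_lift_eq_tsum[of K EndL L])
  qed
  have p1: "tensor_lift LL (\<lambda>f x. tens K L L (f g) (x \<otimes>\<^bsub>L\<^esub> h)) w =
      tensor_lift LL (\<lambda>x y. tens K L L x (y \<otimes>\<^bsub>L\<^esub> h)) (casimir_map w g)"
    if "g \<in> carrier L" "h \<in> carrier L" for g h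
    by (rule push[of LL "\<lambda>x y. x \<otimes>\<otimes> (y \<otimes>\<^bsub>L\<^esub> h)"]) (use that in \<open>simp_all add: hlin\<close>)
  have p2: "tensor_lift LL (\<lambda>f x. tens K L L (p \<otimes>\<^bsub>L\<^esub> f q) x) w =
      tensor_lift LL (\<lambda>x y. tens K L L (p \<otimes>\<^bsub>L\<^esub> x) y) (casimir_map w q)"
    if "p \<in> carrier L" "q \<in> carrier L" for p q
    by (rule push[of LL "\<lambda>x y. (p \<otimes>\<^bsub>L\<^esub> x) \<otimes>\<otimes> y"]) (use that in \<open>simp_all add: hlin\<close>)
  have p3: "tensor_lift L (\<lambda>f x. f g \<otimes>\<^bsub>L\<^esub> x) w = tensor_lift L (\<lambda>x y. x \<otimes>\<^bsub>L\<^esub> y) (casimir_map w g)"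
    if "g \<in> carrier L" for g
    by (rule push[of L "\<lambda>x y. x \<otimes>\<^bsub>L\<^esub> y"]) (use that in \<open>simp_all add: hlin\<close>)
  show ?thesis
    unfolding casimir_iff using lin
    by (simp add: sweedler3_tsum p1 p2 p3)
qed

lemma casimir_cong:
  assumes "casimir K L e" "\<And>g. g \<in> carrier L \<Longrightarrow> e' g = e g"
  shows "casimir K L e'"
proof -
  interpret casimir K L e by fact
  show ?thesis
  proof
    show "k_linear K L LL e'" by (rule k_linear_cong[OF e_linear]) (simp_all add: assms(2))
  qed (simp_all add: assms(2) e_twist e_mult)
qed

text \<open>The counit is a left inverse of \<open>a \<mapsto> a 1\<close>.\<close>

lemma scalars_lepoll: "carrier K \<lesssim> carrier L"
proof -
  have "inj_on (\<lambda>a. a \<odot>\<^bsub>L\<^esub> \<one>\<^bsub>L\<^esub>) (carrier K)"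
    by (rule inj_on_inverseI[of _ \<epsilon>]) (simp add: counit_smult counit_one)
  then show ?thesis unfolding lepoll_def by (intro exI[of _ "\<lambda>a. a \<odot>\<^bsub>L\<^esub> \<one>\<^bsub>L\<^esub>"]) auto
qed

text \<open>With a dual basis, \<open>e(g) = \<Sum> \<phi>\<^sub>a(g) e(a)\<close>, so \<open>e\<close> comes from \<open>\<Sum> \<phi>\<^sub>a(-) e\<^sup>1(a) \<otimes> e\<^sup>2(a)\<close>.\<close>

lemma casimir_map_surj:
  assumes e: "k_linear K L LL e"
    and fg: "finitely_generated K L" and pr: "projective_module TYPE('u) K L"
    and inf: "infinite (UNIV :: 'u set)" and le: "carrier L \<lesssim> (UNIV :: 'u set)"
  shows "\<exists>w\<in>carrier (tensor_product K EndL L). \<forall>g\<in>carrier L. casimir_map w g = e g"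
proof -
  obtain A \<phi> where A: "finite A" "A \<subseteq> carrier L"
    and \<phi>': "\<forall>a\<in>A. \<forall>x\<in>carrier L. \<phi> a x \<in> carrier K"
      "\<forall>a\<in>A. \<forall>x\<in>carrier L. \<forall>y\<in>carrier L. \<phi> a (x \<oplus>\<^bsub>L\<^esub> y) = \<phi> a x \<oplus>\<^bsub>K\<^esub> \<phi> a y"
      "\<forall>a\<in>A. \<forall>c\<in>carrier K. \<forall>x\<in>carrier L. \<phi> a (c \<odot>\<^bsub>L\<^esub> x) = c \<otimes>\<^bsub>K\<^esub> \<phi> a x"
    and sum: "\<forall>x\<in>carrier L. (\<Oplus>\<^bsub>L\<^esub>a\<in>A. \<phi> a x \<odot>\<^bsub>L\<^esub> a) = x"
    by (rule dual_basis[OF module_L fg pr inf lepoll_trans[OF scalars_lepoll le] le])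
  note \<phi> = \<phi>'[rule_format]
  let ?EL = "tensor_product K EndL L"
  have EL: "module K ?EL" by simp
  let ?f = "\<lambda>a x. \<lambda>g\<in>carrier L. \<phi> a g \<odot>\<^bsub>L\<^esub> x"
  have fl: "k_linear K L L (\<lambda>g. \<phi> a g \<odot>\<^bsub>L\<^esub> x)" if "a \<in> A" "x \<in> carrier L" for a x
    by (rule k_linearI) (use that \<phi> in \<open>simp_all add: K_mod.smult_l_distr K_mod.smult_assoc1\<close>)
  have f: "k_linear K L EndL (?f a)" if a: "a \<in> A" for a
  proof (rule k_linearI)
    fix x assume x: "x \<in> carrier L"
    show "?f a x \<in> carrier EndL" by (intro restrict_in_End) (simp_all add: fl[OF a x])
    fix y assume "y \<in> carrier L"
    with x show "?f a (x \<oplus>\<^bsub>L\<^esub> y) = ?f a x \<oplus>\<^bsub>EndL\<^esub> ?f a y"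
      using \<phi>(1)[OF a] by (auto simp: End_module_def K_mod.smult_r_distr intro!: restrict_ext)
  next
    fix c x assume "c \<in> carrier K" "x \<in> carrier L"
    then show "?f a (c \<odot>\<^bsub>L\<^esub> x) = c \<odot>\<^bsub>EndL\<^esub> ?f a x"
      using \<phi>(1)[OF a] by (auto simp: End_module_def smult_swap[of K L] intro!: restrict_ext)
  qed
  let ?t = "\<lambda>a. tsum L L ?EL (\<lambda>x y. tens K EndL L (?f a x) y) (e a)"
  have ea: "e a \<in> carrier LL" if "a \<in> carrier L" for a using k_linear_closed[OF e that] .
  have fb: "bilin K L L ?EL (\<lambda>x y. tens K EndL L (?f a x) y)" if a: "a \<in> A" for a
    using f[OF a] k_linear_closed[OF f[OF a]] by (auto simp: bilin_def intro!: k_linear_tens_left k_linear_tens_right k_linear_id)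
  have t: "?t \<in> A \<rightarrow> carrier ?EL"
    using A fb ea by (auto intro!: tsum_closed[where K=K])
  define w where "w = (\<Oplus>\<^bsub>?EL\<^esub>a\<in>A. ?t a)"
  interpret EL: module K ?EL by (rule EL)
  have w: "w \<in> carrier ?EL" unfolding w_def using t by (rule EL.M.finsum_closed)
  have "casimir_map w g = e g" if g: "g \<in> carrier L" for g
  proof -
    have "casimir_map w g = (\<Oplus>\<^bsub>LL\<^esub>a\<in>A. casimir_map (?t a) g)"
      unfolding w_def casimir_map_def
      by (rule linear_finsum[OF EL _ tsum_linear[OF _ _ _ casimir_map_bilin[OF g]] A(1) t]) simp_all
    also have "\<dots> = (\<Oplus>\<^bsub>LL\<^esub>a\<in>A. e (\<phi> a g \<odot>\<^bsub>L\<^esub> a))"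
    proof -
      interpret LL: module K LL by simp
      have "casimir_map (?t a) g = e (\<phi> a g \<odot>\<^bsub>L\<^esub> a)" if a: "a \<in> A" for a
      proof -
        have aL: "a \<in> carrier L" using a A by auto
        have "casimir_map (?t a) g = tsum L L LL (\<lambda>x y. tsum EndL L LL (\<lambda>f x. f g \<otimes>\<otimes> x) (tens K EndL L (?f a x) y)) (e a)"
          unfolding casimir_map_def
          by (rule tsum_tsum[where K=K]) (use fb[OF a] ea[OF aL] casimir_map_bilin[OF g] in simp_all)
        also have "\<dots> = tsum L L LL (\<lambda>x y. \<phi> a g \<odot>\<^bsub>LL\<^esub> (x \<otimes>\<otimes> y)) (e a)"
          by (rule tsum_cong[OF refl])
            (use g \<phi>(1)[OF a g] k_linear_closed[OF f[OF a]] casimir_map_bilin[OF g] in \<open>simp add: tens_smult_left\<close>)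
        also have "\<dots> = \<phi> a g \<odot>\<^bsub>LL\<^esub> e a"
          using ea[OF aL] \<phi>(1)[OF a g] by (simp add: tsum_K hlin)
        finally show ?thesis using k_linear_smult[OF e \<phi>(1)[OF a g] aL] by simp
      qed
      moreover have "e (\<phi> a g \<odot>\<^bsub>L\<^esub> a) \<in> carrier LL" if "a \<in> A" for a
        using that A(2) \<phi>(1)[OF that g] by (intro ea) auto
      ultimately show ?thesis by (intro LL.M.finsum_cong') auto
    qed
    also have "\<dots> = e (\<Oplus>\<^bsub>L\<^esub>a\<in>A. \<phi> a g \<odot>\<^bsub>L\<^esub> a)"
      by (rule linear_finsum[OF module_L _ e A(1), symmetric]) (use A(2) \<phi>(1)[OF _ g] in auto)
    finally show ?thesis by (simp add: sum g)
  qed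
  then show ?thesis using w by blast
qed

theorem separable_iff_theta:
  assumes "infinite (UNIV :: 'u set)" "carrier L \<lesssim> (UNIV :: 'u set)"
  shows "relatively_separable (YD_cat K L :: (('k, 'u, 'l) ydmod, 'u \<Rightarrow> 'u) category)
      (Mod_cat K L) (Comod_cat K L) F_functor H_functor \<longleftrightarrow> (\<exists>\<theta>. theta K L \<theta>)"
  using theta_of_separable[OF _ assms] theta.separable by blast

theorem separable_iff_casimir:
  assumes "infinite (UNIV :: 'u set)" "carrier L \<lesssim> (UNIV :: 'u set)"
  shows "relatively_separable (YD_cat K L :: (('k, 'u, 'l) ydmod, 'u \<Rightarrow> 'u) category)
      (Comod_cat K L) (Mod_cat K L) H_functor F_functor \<longleftrightarrow> (\<exists>e. casimir K L e)"
  using casimir_of_separable[OF _ assms] casimir.separable by blast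

theorem casimir_iff_map:
  assumes "finitely_generated K L" "projective_module TYPE('u) K L"
    and "infinite (UNIV :: 'u set)" "carrier L \<lesssim> (UNIV :: 'u set)"
  shows "(\<exists>e. casimir K L e) \<longleftrightarrow> (\<exists>w\<in>carrier (tensor_product K EndL L). casimir K L (casimir_map w))"
proof
  assume "\<exists>e. casimir K L e"
  then obtain e where e: "casimir K L e" by blast
  then have "k_linear K L LL e" by (simp add: casimir_iff)
  then show "\<exists>w\<in>carrier (tensor_product K EndL L). casimir K L (casimir_map w)"
    using casimir_map_surj[OF _ assms] casimir_cong[OF e] by metis
qed blast

end

theorem corollary5p18:
  fixes K :: "'k ring" and L :: "('k, 'l) hopf"
  assumes "hopf_algebra K L"
    and "infinite (UNIV :: 'u set)" and "carrier L \<lesssim> (UNIV :: 'u set)"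
  shows
    "(let YD = (YD_cat K L :: (('k, 'u, 'l) ydmod, 'u \<Rightarrow> 'u) category);
          F_H_separable = relatively_separable YD (Mod_cat K L) (Comod_cat K L) F_functor H_functor;
          H_F_separable = relatively_separable YD (Comod_cat K L) (Mod_cat K L) H_functor F_functor;
          S = antipode L;
          LL = tensor_product K L L;
          End = End_module K L
      in
       (F_H_separable \<longleftrightarrow>
          (\<exists>\<theta>. k_linear K LL L \<theta> \<and>
             (\<forall>g\<in>carrier L. \<forall>h\<in>carrier L.
                sweedler2 L LL (\<lambda>h1 h2. tens K L L (\<theta> (tens K L L g h1)) h2) h =
                sweedler2 L LL
                  (\<lambda>g1 g2. sweedler3 L LL
                     (\<lambda>t1 t2 t3. tens K L L t2 (S t1 \<otimes>\<^bsub>L\<^esub> g1 \<otimes>\<^bsub>L\<^esub> t3)) (\<theta> (tens K L L g2 h))) g) \<and>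
             (\<forall>h\<in>carrier L. \<theta> (comult L h) = counit L h \<odot>\<^bsub>L\<^esub> \<one>\<^bsub>L\<^esub>))) \<and>
       (F_H_separable \<longleftrightarrow>
          (\<exists>\<gamma>. k_linear K L End \<gamma> \<and>
             (\<forall>g\<in>carrier L. \<forall>h\<in>carrier L.
                sweedler2 L LL (\<lambda>h1 h2. tens K L L (\<gamma> h1 g) h2) h =
                sweedler2 L LL
                  (\<lambda>g1 g2. sweedler3 L LL
                     (\<lambda>t1 t2 t3. tens K L L t2 (S t1 \<otimes>\<^bsub>L\<^esub> g1 \<otimes>\<^bsub>L\<^esub> t3)) (\<gamma> h g2)) g) \<and>
             (\<forall>h\<in>carrier L.
                sweedler2 L L (\<lambda>h1 h2. \<gamma> h2 h1) h = counit L h \<odot>\<^bsub>L\<^esub> \<one>\<^bsub>L\<^esub>))) \<and>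
       (F_H_separable \<longrightarrow> (\<forall>M\<in>Obj YD. relative_injective K L (fobj H_functor M))) \<and>
       (H_F_separable \<longleftrightarrow>
          (\<exists>e. k_linear K L LL e \<and>
             (\<forall>g\<in>carrier L. \<forall>h\<in>carrier L.
                tensor_lift LL (\<lambda>x y. tens K L L x (y \<otimes>\<^bsub>L\<^esub> h)) (e g) =
                sweedler3 L LL
                  (\<lambda>h1 h2 h3. tensor_lift LL (\<lambda>x y. tens K L L (h2 \<otimes>\<^bsub>L\<^esub> x) y)
                     (e (S h1 \<otimes>\<^bsub>L\<^esub> g \<otimes>\<^bsub>L\<^esub> h3))) h) \<and>
             (\<forall>g\<in>carrier L.
                tensor_lift L (\<lambda>x y. x \<otimes>\<^bsub>L\<^esub> y) (e g) = counit L g \<odot>\<^bsub>L\<^esub> \<one>\<^bsub>L\<^esub>))) \<and>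
       (H_F_separable \<longrightarrow> (\<forall>M\<in>Obj YD. relative_projective K L (fobj F_functor M))) \<and>
       (finitely_generated K L \<and> projective_module TYPE('u) K L \<longrightarrow>
          (H_F_separable \<longleftrightarrow>
            (\<exists>w\<in>carrier (tensor_product K End L).
               (\<forall>g\<in>carrier L. \<forall>h\<in>carrier L.
                  tensor_lift LL (\<lambda>f x. tens K L L (f g) (x \<otimes>\<^bsub>L\<^esub> h)) w =
                  sweedler3 L LL
                    (\<lambda>h1 h2 h3. tensor_lift LL
                       (\<lambda>f x. tens K L L (h2 \<otimes>\<^bsub>L\<^esub> f (S h1 \<otimes>\<^bsub>L\<^esub> g \<otimes>\<^bsub>L\<^esub> h3)) x) w) h) \<and>
               (\<forall>g\<in>carrier L.
                  tensor_lift L (\<lambda>f x. f g \<otimes>\<^bsub>L\<^esub> x) w = counit L g \<odot>\<^bsub>L\<^esub> \<one>\<^bsub>L\<^esub>)))))"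
  proof -
  interpret hopf_algebra K L by fact
  note FH = separable_iff_theta[OF assms(2,3)] and HF = separable_iff_casimir[OF assms(2,3)]
  show ?thesis
    unfolding Let_def
  proof (intro conjI impI, goal_cases)
    case 1
    show ?case unfolding FH theta_iff ..
  next
    case 2
    show ?case unfolding FH gamma_iff ..
  next
    case 3
    then show ?case unfolding FH using theta.injective by blast
  next
    case 4
    show ?case unfolding HF casimir_iff ..
  next
    case 5
    then show ?case unfolding HF using casimir.projective by blast
  next
    case 6
    then have map_form: "(\<exists>e. casimir K L e) \<longleftrightarrow>
        (\<exists>w\<in>carrier (tensor_product K EndL L). casimir K L (casimir_map w))"
      by (intro casimir_iff_map[OF _ _ assms(2,3)]) simp_all
    show ?case unfolding HF map_form by (rule bex_cong[OF refl casimir_map_iff])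
  qed
qed

end
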